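(* Let $(Q,\mathfrak m_Q,\mathsf k)$ be a Gorenstein Artin local ring which is decomposable as a connected sum over $\mathsf k$ of rings with embedding dimensions $m$ and $n$. Let $0\neq f\in\mathfrak m_Q$, and let $L=\dfrac{(0:_Qf)+\mathfrak m_Q^2}{\mathfrak m_Q^2}$. If $\lambda(L)<\min\{m,n\}$, then $Q/(0:_Qf)$ is also decomposable as a connected sum over $\mathsf k$. In particular, the conclusion holds if $(0:_Qf)\subset\mathfrak m_Q^2$.
   Context: $\lambda(M)$ denotes the length of a module $M$; $\ell\ell(T)=\max\{n:\mathfrak m_T^n\neq 0\}$ is the Loewy length of an Artinian local ring $T$; the embedding dimension of a local ring is the minimal number of generators of its maximal ideal. Fibre product: for local rings $(R,\mathfrak m_R,\mathsf k)$, $(S,\mathfrak m_S,\mathsf k)$ with natural projections $\pi_R,\pi_S$ onto $\mathsf k$, $R\times_{\mathsf k}S=\{(r,s)\in R\times S:\pi_R(r)=\pi_S(s)\}$. Connected sum: if $R,S$ are Gorenstein Artin local rings with residue field $\mathsf k$, different from $\mathsf k$, and $\operatorname{soc}(R)=\langle\delta_R\rangle$, $\operatorname{soc}(S)=\langle\delta_S\rangle$, then $R\#_{\mathsf k}S=(R\times_{\mathsf k}S)/\langle(\delta_R,0)-(0,\delta_S)\rangle$. It depends on the chosen socle generators; $Q\simeq R\#_{\mathsf k}S$ means that this holds for some choice. A Gorenstein Artin local ring $(Q,\mathfrak m_Q,\mathsf k)$ is decomposable as a connected sum over $\mathsf k$ (of the rings $R$ and $S$) if there are Gorenstein Artin local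 rings $R,S$ with residue field $\mathsf k$ and $\ell\ell(R),\ell\ell(S)\ge 2$ such that $Q\simeq R\#_{\mathsf k}S$ and $R\not\simeq Q\not\simeq S$ (the last condition is automatic by length). *)

theory Defs
  imports "HOL-Algebra.Module" "HOL-Algebra.Ideal_Product" "HOL-Algebra.Chinese_Remainder"
    "HOL-Library.Extended_Nat"
begin

section \<open>Modules and length\<close>

text \<open>
  The fields \<open>mult\<close> and \<open>one\<close> of a module record play no role in \<^locale>\<open>module\<close>; they only have to
  be filled with something.
\<close>

definition ideal_module :: "('a, 'b) ring_scheme \<Rightarrow> 'a set \<Rightarrow> ('a, 'a) module" where
  "ideal_module R I =
    \<lparr>carrier = I, mult = mult R, one = one R, zero = zero R, add = add R, smult = mult R\<rparr>"

definition quotient_module ::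
    "('a, 'b, 'c) module_scheme \<Rightarrow> 'b set \<Rightarrow> ('a, 'b set) module" where
  "quotient_module M N =
    \<lparr>carrier = a_rcosets\<^bsub>M\<^esub> N, mult = undefined, one = undefined, zero = N, add = set_add M,
     smult = (\<lambda>a X. \<Union>x\<in>X. N +>\<^bsub>M\<^esub> (a \<odot>\<^bsub>M\<^esub> x))\<rparr>"

text \<open>The supremum of the lengths \<open>n\<close> of strict chains \<open>N\<^sub>0 \<subset> \<dots> \<subset> N\<^sub>n\<close> of submodules.\<close>

definition module_length :: "('a, 'b) ring_scheme \<Rightarrow> ('a, 'c, 'd) module_scheme \<Rightarrow> enat" where
  "module_length R M =
    Sup {enat n |n. \<exists>N :: nat \<Rightarrow> 'c set.
      (\<forall>i\<le>n. submodule (N i) R M) \<and> (\<forall>i<n. N i \<subset> N (Suc i))}"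


section \<open>Gorenstein Artin local rings\<close>

locale local_ring = cring R for R (structure) +
  assumes unique_maximal: "\<exists>!M. maximalideal M R"

definition max_ideal :: "('a, 'b) ring_scheme \<Rightarrow> 'a set" where
  "max_ideal R = (THE M. maximalideal M R)"

locale artinian_ring = ring R for R (structure) +
  assumes descending_chain_condition:
    "\<lbrakk>\<And>n :: nat. ideal (I n) R; \<And>n. I (Suc n) \<subseteq> I n\<rbrakk> \<Longrightarrow> \<exists>n0. \<forall>n\<ge>n0. I n = I n0"

definition annihilator :: "('a, 'b) ring_scheme \<Rightarrow> 'a \<Rightarrow> 'a set" where
  "annihilator R f = {a \<in> carrier R. a \<otimes>\<^bsub>R\<^esub> f = \<zero>\<^bsub>R\<^esub>}"

definition socle :: "('a, 'b) ring_scheme \<Rightarrow> 'a set" where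
  "socle R = {a \<in> carrier R. \<forall>x\<in>max_ideal R. a \<otimes>\<^bsub>R\<^esub> x = \<zero>\<^bsub>R\<^esub>}"

text \<open>
  For an Artin local ring, Gorenstein means type one: the socle \<open>(0 : \<mm>)\<close> has length one, i.e. is
  one-dimensional over the residue field.
\<close>

locale gorenstein_artin_local_ring = local_ring R + artinian_ring R for R (structure) +
  assumes type_one: "module_length R (ideal_module R (socle R)) = 1"

abbreviation ideal_power :: "('a, 'b) ring_scheme \<Rightarrow> 'a set \<Rightarrow> nat \<Rightarrow> 'a set" where
  "ideal_power R I n \<equiv> I [^]\<^bsub>ideals_set R\<^esub> n"

text \<open>
  The maximal ideal of an Artin local ring is nilpotent and finitely generated, so the maximum and
  the minimum below exist.
\<close>

definition loewy_length :: "('a, 'b) ring_scheme \<Rightarrow> nat" where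
  "loewy_length R = Max {n. ideal_power R (max_ideal R) n \<noteq> {\<zero>\<^bsub>R\<^esub>}}"

definition emb_dim :: "('a, 'b) ring_scheme \<Rightarrow> nat" where
  "emb_dim R = (LEAST n. \<exists>A \<subseteq> carrier R. finite A \<and> card A = n \<and> Idl\<^bsub>R\<^esub> A = max_ideal R)"


section \<open>Fibre products and connected sums\<close>

text \<open>
  That \<open>k\<close> is the residue field of \<open>R\<close> is expressed by a projection of \<open>R\<close> onto \<open>k\<close> with kernel
  the maximal ideal, which amounts to an identification of \<open>R Quot max_ideal R\<close> with \<open>k\<close>.
\<close>

definition residue_map ::
    "('a, 'b) ring_scheme \<Rightarrow> ('k, 'c) ring_scheme \<Rightarrow> ('a \<Rightarrow> 'k) \<Rightarrow> bool" where
  "residue_map R k \<pi> \<longleftrightarrow>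
    field k \<and> \<pi> \<in> ring_hom R k \<and> \<pi> ` carrier R = carrier k \<and> a_kernel R k \<pi> = max_ideal R"

definition fibre_product ::
    "('a, 'c) ring_scheme \<Rightarrow> ('a \<Rightarrow> 'k) \<Rightarrow> ('b, 'd) ring_scheme \<Rightarrow> ('b \<Rightarrow> 'k) \<Rightarrow> ('a \<times> 'b) ring" where
  "fibre_product R \<pi>\<^sub>R S \<pi>\<^sub>S =
    (RDirProd R S)\<lparr>carrier := {(r, s). r \<in> carrier R \<and> s \<in> carrier S \<and> \<pi>\<^sub>R r = \<pi>\<^sub>S s}\<rparr>"

definition connected_sum ::
    "('a, 'c) ring_scheme \<Rightarrow> ('a \<Rightarrow> 'k) \<Rightarrow> 'a \<Rightarrow>
     ('b, 'd) ring_scheme \<Rightarrow> ('b \<Rightarrow> 'k) \<Rightarrow> 'b \<Rightarrow> ('a \<times> 'b) set ring" where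
  "connected_sum R \<pi>\<^sub>R \<delta>\<^sub>R S \<pi>\<^sub>S \<delta>\<^sub>S =
    (let P = fibre_product R \<pi>\<^sub>R S \<pi>\<^sub>S
     in P Quot (Idl\<^bsub>P\<^esub> {(\<delta>\<^sub>R, \<zero>\<^bsub>S\<^esub>) \<ominus>\<^bsub>P\<^esub> (\<zero>\<^bsub>R\<^esub>, \<delta>\<^sub>S)}))"

definition socle_generator :: "('a, 'b) ring_scheme \<Rightarrow> 'a \<Rightarrow> bool" where
  "socle_generator R \<delta> \<longleftrightarrow> \<delta> \<in> carrier R \<and> socle R = Idl\<^bsub>R\<^esub> {\<delta>}"

text \<open>
  \<open>Q\<close> is decomposable over \<open>k\<close> as a connected sum of the rings \<open>R\<close> and \<open>S\<close>. The choices of the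
  socle generators and of the identifications of the residue fields of \<open>R\<close> and \<open>S\<close> with \<open>k\<close> are
  part of what is asserted to exist. Loewy length at least two excludes \<open>R = k\<close> and \<open>S = k\<close>.
\<close>

definition decomposable_as_connected_sum ::
    "('k, 'd) ring_scheme \<Rightarrow> ('q, 'a) ring_scheme \<Rightarrow> ('r, 'b) ring_scheme \<Rightarrow> ('s, 'c) ring_scheme
      \<Rightarrow> bool" where
  "decomposable_as_connected_sum k Q R S \<longleftrightarrow>
    gorenstein_artin_local_ring Q \<and> (\<exists>\<pi>\<^sub>Q. residue_map Q k \<pi>\<^sub>Q) \<and>
    gorenstein_artin_local_ring R \<and> loewy_length R \<ge> 2 \<and>
    gorenstein_artin_local_ring S \<and> loewy_length S \<ge> 2 \<and>
    (\<exists>\<pi>\<^sub>R \<pi>\<^sub>S \<delta>\<^sub>R \<delta>\<^sub>S. residue_map R k \<pi>\<^sub>R \<and> residue_map S k \<pi>\<^sub>S \<and>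
      socle_generator R \<delta>\<^sub>R \<and> socle_generator S \<delta>\<^sub>S \<and>
      Q \<simeq> connected_sum R \<pi>\<^sub>R \<delta>\<^sub>R S \<pi>\<^sub>S \<delta>\<^sub>S) \<and>
    \<not> R \<simeq> Q \<and> \<not> Q \<simeq> S"

text \<open>
  Looking for \<open>R\<close> and \<open>S\<close> over the element type of \<open>Q\<close> loses nothing: if \<open>\<sigma>\<close> is a section of
  \<open>\<pi>\<^sub>S\<close>, then \<open>r \<mapsto> [(r, \<sigma> (\<pi>\<^sub>R r))]\<close> injects \<open>R\<close> into the connected sum (as a set), and likewise
  for \<open>S\<close>; so any decomposition of \<open>Q\<close> can be transported to rings over that type.
\<close>

definition decomposable_connected_sum ::
    "('k, 'b) ring_scheme \<Rightarrow> ('q, 'a) ring_scheme \<Rightarrow> bool" where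
  "decomposable_connected_sum k Q \<longleftrightarrow>
    (\<exists>(R :: 'q ring) (S :: 'q ring). decomposable_as_connected_sum k Q R S)"

text \<open>The \<open>Q\<close>-module \<open>((0 : f) + \<mm>\<^sup>2) / \<mm>\<^sup>2\<close>.\<close>

definition annihilator_mod_square ::
    "('a, 'b) ring_scheme \<Rightarrow> 'a \<Rightarrow> ('a, 'a set) module" where
  "annihilator_mod_square Q f =
    (let m2 = ideal_power Q (max_ideal Q) 2
     in quotient_module (ideal_module Q (annihilator Q f <+>\<^bsub>Q\<^esub> m2)) m2)"


section \<open>Well-formedness\<close>

lemma ideal_module_is_module:
  assumes "cring R" "ideal I R" shows "Module.module R (ideal_module R I)"
proof -
  interpret cring R by fact
  interpret ideal I R by fact
  show ?thesis
  proof (rule moduleI)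
    show "abelian_group (ideal_module R I)"
    proof (rule abelian_groupI)
      fix x assume "x \<in> carrier (ideal_module R I)"
      then show "\<exists>y\<in>carrier (ideal_module R I). y \<oplus>\<^bsub>ideal_module R I\<^esub> x = \<zero>\<^bsub>ideal_module R I\<^esub>"
        by (intro bexI[of _ "\<ominus>\<^bsub>R\<^esub> x"]) (auto simp: ideal_module_def Icarr l_neg)
    qed (auto simp: ideal_module_def Icarr a_assoc, auto simp: a_comm Icarr)
  qed (auto simp: ideal_module_def l_distr r_distr m_assoc Icarr I_l_closed is_cring)
qed

lemma quotient_module_is_module:
  assumes "Module.module R M" "submodule N R M" shows "Module.module R (quotient_module M N)"
proof -
  interpret Module.module R M by fact
  interpret N: submodule N R M by fact
  interpret A: abelian_subgroup N M
    by (rule abelian_subgroupI3) (auto simp: additive_subgroup_def N.subgroup_axioms abelian_group_axioms)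
  have sm: "(\<Union>x\<in>N +>\<^bsub>M\<^esub> y. N +>\<^bsub>M\<^esub> (a \<odot>\<^bsub>M\<^esub> x)) = N +>\<^bsub>M\<^esub> (a \<odot>\<^bsub>M\<^esub> y)"
    if a: "a \<in> carrier R" and y: "y \<in> carrier M" for a y
  proof -
    have "N +>\<^bsub>M\<^esub> (a \<odot>\<^bsub>M\<^esub> x) = N +>\<^bsub>M\<^esub> (a \<odot>\<^bsub>M\<^esub> y)" if "x \<in> N +>\<^bsub>M\<^esub> y" for x
    proof -
      obtain h where h: "h \<in> N" "x = h \<oplus>\<^bsub>M\<^esub> y" using \<open>x \<in> N +>\<^bsub>M\<^esub> y\<close> by (auto simp: a_r_coset_def r_coset_def)
      hence hc: "h \<in> carrier M" by auto
      have "a \<odot>\<^bsub>M\<^esub> x = a \<odot>\<^bsub>M\<^esub> h \<oplus>\<^bsub>M\<^esub> a \<odot>\<^bsub>M\<^esub> y" using h hc a y by (simp add: smult_r_distr)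
      moreover have "a \<odot>\<^bsub>M\<^esub> h \<in> N" using a h by auto
      ultimately have "a \<odot>\<^bsub>M\<^esub> x \<in> N +>\<^bsub>M\<^esub> (a \<odot>\<^bsub>M\<^esub> y)" by (auto simp: a_r_coset_def r_coset_def)
      thus ?thesis using A.a_repr_independence'[of "a \<odot>\<^bsub>M\<^esub> x" "a \<odot>\<^bsub>M\<^esub> y"] a y by simp
    qed
    moreover have "y \<in> N +>\<^bsub>M\<^esub> y" using y A.a_rcos_self by blast
    ultimately show ?thesis by blast
  qed
  have el: "\<exists>x\<in>carrier M. X = N +>\<^bsub>M\<^esub> x" if "X \<in> a_rcosets\<^bsub>M\<^esub> N" for X
    using that by (auto simp: A_RCOSETS_def' RCOSETS_def a_r_coset_def r_coset_def)
  note [simp] = A.a_rcos_sum sm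
  have cl: "N +>\<^bsub>M\<^esub> x \<in> a_rcosets\<^bsub>M\<^esub> N" if "x \<in> carrier M" for x
    using that by (auto simp: A_RCOSETS_def' RCOSETS_def a_r_coset_def r_coset_def)
  show ?thesis
  proof (rule moduleI)
    let ?M = "quotient_module M N"
    have carr: "\<exists>x\<in>carrier M. X = N +>\<^bsub>M\<^esub> x" if "X \<in> carrier ?M" for X
      using that el by (simp add: quotient_module_def)
    have carr': "N +>\<^bsub>M\<^esub> x \<in> carrier ?M" if "x \<in> carrier M" for x
      using that cl by (simp add: quotient_module_def)
    have add: "(N +>\<^bsub>M\<^esub> x) \<oplus>\<^bsub>?M\<^esub> (N +>\<^bsub>M\<^esub> y) = N +>\<^bsub>M\<^esub> (x \<oplus>\<^bsub>M\<^esub> y)"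
      if "x \<in> carrier M" "y \<in> carrier M" for x y
      using that by (simp add: quotient_module_def)
    have zero: "\<zero>\<^bsub>?M\<^esub> = N +>\<^bsub>M\<^esub> \<zero>\<^bsub>M\<^esub>"
      by (simp add: quotient_module_def A.a_subset M.a_coset_add_zero)
    show "abelian_group ?M"
    proof (rule abelian_groupI)
      show "\<zero>\<^bsub>?M\<^esub> \<in> carrier ?M" by (simp add: zero carr')
    next
      fix X Y assume XY: "X \<in> carrier ?M" "Y \<in> carrier ?M"
      then obtain x y where x: "x \<in> carrier M" "X = N +>\<^bsub>M\<^esub> x" and y: "y \<in> carrier M" "Y = N +>\<^bsub>M\<^esub> y"
        using carr by meson
      show "X \<oplus>\<^bsub>?M\<^esub> Y \<in> carrier ?M" using x y by (simp add: add carr')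
      show "X \<oplus>\<^bsub>?M\<^esub> Y = Y \<oplus>\<^bsub>?M\<^esub> X" using x y by (simp add: add M.a_comm)
      fix Z assume Z: "Z \<in> carrier ?M"
      then obtain z where "z \<in> carrier M" "Z = N +>\<^bsub>M\<^esub> z" using carr by meson
      then show "X \<oplus>\<^bsub>?M\<^esub> Y \<oplus>\<^bsub>?M\<^esub> Z = X \<oplus>\<^bsub>?M\<^esub> (Y \<oplus>\<^bsub>?M\<^esub> Z)"
        using x y by (simp add: add M.a_assoc)
    next
      fix X assume "X \<in> carrier ?M"
      then obtain x where x: "x \<in> carrier M" "X = N +>\<^bsub>M\<^esub> x" using carr by meson
      show "\<zero>\<^bsub>?M\<^esub> \<oplus>\<^bsub>?M\<^esub> X = X" using x by (simp add: add zero)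
      show "\<exists>Y\<in>carrier ?M. Y \<oplus>\<^bsub>?M\<^esub> X = \<zero>\<^bsub>?M\<^esub>"
        using x by (intro bexI[of _ "N +>\<^bsub>M\<^esub> (\<ominus>\<^bsub>M\<^esub> x)"]) (simp_all add: add zero carr' M.l_neg)
    qed
  next
    fix a b X Y assume ab: "a \<in> carrier R" "b \<in> carrier R"
      and "X \<in> carrier (quotient_module M N)" "Y \<in> carrier (quotient_module M N)"
    then obtain x y where x: "x \<in> carrier M" "X = N +>\<^bsub>M\<^esub> x" and y: "y \<in> carrier M" "Y = N +>\<^bsub>M\<^esub> y"
      unfolding quotient_module_def using el by simp metis
    note [simp] = x y ab cl
    let ?M = "quotient_module M N"
    show "a \<odot>\<^bsub>?M\<^esub> X \<in> carrier ?M" by (simp add: quotient_module_def)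
    show "(a \<oplus>\<^bsub>R\<^esub> b) \<odot>\<^bsub>?M\<^esub> X = a \<odot>\<^bsub>?M\<^esub> X \<oplus>\<^bsub>?M\<^esub> b \<odot>\<^bsub>?M\<^esub> X"
      by (simp add: quotient_module_def smult_l_distr)
    show "a \<odot>\<^bsub>?M\<^esub> (X \<oplus>\<^bsub>?M\<^esub> Y) = a \<odot>\<^bsub>?M\<^esub> X \<oplus>\<^bsub>?M\<^esub> a \<odot>\<^bsub>?M\<^esub> Y"
      by (simp add: quotient_module_def smult_r_distr)
    show "(a \<otimes>\<^bsub>R\<^esub> b) \<odot>\<^bsub>?M\<^esub> X = a \<odot>\<^bsub>?M\<^esub> (b \<odot>\<^bsub>?M\<^esub> X)"
      by (simp add: quotient_module_def smult_assoc1)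
  next
    fix X assume "X \<in> carrier (quotient_module M N)"
    then obtain x where "x \<in> carrier M" "X = N +>\<^bsub>M\<^esub> x"
      unfolding quotient_module_def using el by simp metis
    then show "\<one>\<^bsub>R\<^esub> \<odot>\<^bsub>quotient_module M N\<^esub> X = X" by (simp add: quotient_module_def)
  qed (rule is_cring)
qed

lemma fibre_product_is_cring:
  assumes "cring R" "cring S" "field k" "\<pi> \<in> ring_hom R k" "\<rho> \<in> ring_hom S k"
  shows "cring (fibre_product R \<pi> S \<rho>)"
proof -
  interpret R: cring R by fact
  interpret S: cring S by fact
  interpret k: field k by fact
  interpret p: ring_hom_cring R k \<pi> by (unfold_locales) (use assms in auto)
  interpret q: ring_hom_cring S k \<rho> by (unfold_locales) (use assms in auto)
  show ?thesis
  proof (rule cringI)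
    show "abelian_group (fibre_product R \<pi> S \<rho>)"
    proof (rule abelian_groupI)
      fix x assume "x \<in> carrier (fibre_product R \<pi> S \<rho>)"
      then show "\<exists>y\<in>carrier (fibre_product R \<pi> S \<rho>). y \<oplus>\<^bsub>fibre_product R \<pi> S \<rho>\<^esub> x = \<zero>\<^bsub>fibre_product R \<pi> S \<rho>\<^esub>"
        by (intro bexI[of _ "(\<ominus>\<^bsub>R\<^esub> fst x, \<ominus>\<^bsub>S\<^esub> snd x)"])
           (auto simp: fibre_product_def RDirProd_def DirProd_def monoid.defs R.l_neg S.l_neg)
    qed (auto simp: fibre_product_def RDirProd_def DirProd_def monoid.defs R.a_ac S.a_ac)
    show "comm_monoid (fibre_product R \<pi> S \<rho>)"
      by (rule comm_monoidI)
         (auto simp: fibre_product_def RDirProd_def DirProd_def monoid.defs R.m_ac S.m_ac)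
  qed (auto simp: fibre_product_def RDirProd_def DirProd_def monoid.defs R.l_distr S.l_distr)
qed

end

theory Submission
  imports Defs "HOL-Algebra.Ring_Divisibility" "HOL-Algebra.Weak_Morphisms"
begin

text \<open>
  Write \<open>Q = P / D\<close> with \<open>P\<close> the fibre product of \<open>R\<close> and \<open>S\<close> over \<open>k\<close> and
  \<open>D = {(a\<delta>, -b\<epsilon>) | (a, b) \<in> P}\<close>, where \<open>\<delta>\<close> and \<open>\<epsilon>\<close> generate the two socles, and let
  \<open>(g, h)\<close> represent \<open>f\<close>. The pair \<open>(r, s)\<close> kills \<open>f\<close> exactly if \<open>(rg, sh) \<in> D\<close>.

  The decomposition of \<open>Q / (0 : f)\<close> is explicit: it is a connected sum of \<open>R / (0 : g)\<close> and
  \<open>S / (0 : h)\<close>. Indeed, quotients of Gorenstein rings by annihilators of nonzero elements are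
  Gorenstein, and if \<open>dg = \<delta>\<close> and \<open>eh = \<epsilon>\<close>, then the classes of \<open>d\<close> and \<open>e\<close> generate the socles
  of the two quotients, and \<open>(rg, sh) = (a\<delta>, -b\<epsilon>)\<close> says that the classes of \<open>r\<close> and \<open>-s\<close> are
  the multiples \<open>ad\<close> and \<open>be\<close> of these generators (\<open>quotient_presentation\<close>). For this to be an
  admissible decomposition both quotients must have Loewy length at least two, which means
  \<open>\<mm>\<^sub>R\<^sup>2 g \<noteq> 0\<close> and \<open>\<mm>\<^sub>S\<^sup>2 h \<noteq> 0\<close>.

  It remains to see that \<open>(0 : f)\<close> is large if one of these fails, say \<open>\<mm>\<^sub>R\<^sup>2 g = 0\<close>
  (\<open>annihilator_large\<close>). If \<open>\<mm>\<^sub>S h = 0\<close>, all \<open>(0, s)\<close> with \<open>s \<in> \<mm>\<^sub>S\<close> kill \<open>f\<close>. Otherwise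
  \<open>\<mm>\<^sub>S h\<close> contains the socle of \<open>S\<close>. For \<open>r \<in> \<mm>\<^sub>R\<close> the element \<open>rg\<close> is in the socle of \<open>R\<close>, say
  \<open>rg = a\<delta>\<close>, so there is \<open>s \<in> \<mm>\<^sub>S\<close> with \<open>sh = -b\<epsilon>\<close> for a \<open>b\<close> matching \<open>a\<close>, and \<open>(r, s)\<close> kills
  \<open>f\<close>. In either case \<open>(0 : f)\<close> projects onto the maximal ideal of one of the two summands.
  By Nakayama's lemma that maximal ideal \<open>\<mm>\<close> has a chain of ideals down to \<open>\<mm>\<^sup>2\<close> whose length is
  the embedding dimension (\<open>emb_dim_chain\<close>). Its preimages in \<open>Q\<close> give a chain of submodules of
  \<open>L\<close>, so \<open>\<lambda>(L) \<ge> min {m, n}\<close>, and \<open>(0 : f)\<close> is not contained in \<open>\<mm>\<^sub>Q\<^sup>2\<close>.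

  That a summand is never isomorphic to the connected sum follows from the strict inequality of
  embedding dimensions (\<open>emb_dim_less\<close>).
\<close>

(* The symbol is used for sums of ideals throughout. *)
no_notation Sum_Type.Plus (infixr \<open><+>\<close> 65)

section \<open>Ideals of commutative and Artinian rings\<close>

lemma (in cring) ideal_criterion:
  assumes "I \<subseteq> carrier R" "\<zero> \<in> I" "\<And>a b. a \<in> I \<Longrightarrow> b \<in> I \<Longrightarrow> a \<oplus> b \<in> I"
    and scal: "\<And>a x. a \<in> I \<Longrightarrow> x \<in> carrier R \<Longrightarrow> x \<otimes> a \<in> I"
  shows "ideal I R"
proof (rule idealI[OF ring_axioms])
  have "\<ominus> a \<in> I" if "a \<in> I" for a
    using scal[OF that, of "\<ominus> \<one>"] that assms(1) by (auto simp: l_minus)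
  then show "subgroup I (add_monoid R)"
    using assms by (intro add.subgroupI) (auto simp: a_inv_def)
  show "x \<otimes> a \<in> I" "a \<otimes> x \<in> I" if "a \<in> I" "x \<in> carrier R" for a x
    using that scal assms(1) m_comm[of a x] by auto
qed

lemma (in ring) ideal_zero_mem: "ideal I R \<Longrightarrow> \<zero> \<in> I"
  by (simp add: additive_subgroup.zero_closed ideal.axioms(1))

lemma (in ring) ideal_add_mem: "ideal I R \<Longrightarrow> a \<in> I \<Longrightarrow> b \<in> I \<Longrightarrow> a \<oplus> b \<in> I"
  by (simp add: additive_subgroup.a_closed ideal.axioms(1))

lemma (in ring) ideal_minus_mem: "ideal I R \<Longrightarrow> a \<in> I \<Longrightarrow> b \<in> I \<Longrightarrow> a \<ominus> b \<in> I"
  by (metis a_minus_def additive_subgroup.a_inv_closed ideal.axioms(1) ideal_add_mem)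

lemma (in ring) ideal_subset: "ideal I R \<Longrightarrow> I \<subseteq> carrier R"
  by (rule subsetI) (rule ideal.Icarr)

lemma (in ring) ideal_prod_least:
  assumes "ideal K R" "\<And>i j. i \<in> I \<Longrightarrow> j \<in> J \<Longrightarrow> i \<otimes> j \<in> K"
  shows "I \<cdot> J \<subseteq> K"
proof
  fix s assume "s \<in> I \<cdot> J" then show "s \<in> K"
    by induction (use assms in \<open>auto intro: ideal_add_mem\<close>)
qed

lemma (in ring) set_add_memI: "i \<in> I \<Longrightarrow> j \<in> J \<Longrightarrow> i \<oplus> j \<in> I <+> J"
  unfolding set_add_def' by blast

lemma (in ring) set_add_memE:
  fixes x :: 'a assumes "x \<in> I <+> J" obtains i j where "i \<in> I" "j \<in> J" "x = i \<oplus> j"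
  using assms unfolding set_add_def' by blast

lemma (in ring) set_add_least:
  assumes K: "ideal K R" and "I \<subseteq> K" "J \<subseteq> K" shows "I <+> J \<subseteq> K"
proof
  fix x assume "x \<in> I <+> J"
  then obtain i j where "i \<in> I" "j \<in> J" "x = i \<oplus> j" by (rule set_add_memE)
  then show "x \<in> K" using assms(2,3) ideal_add_mem[OF K, of i j] by auto
qed

lemma (in cring) genideal_insert:
  assumes N: "ideal N R" and x: "x \<in> carrier R" and y: "y \<in> Idl (insert x N)"
  shows "\<exists>n\<in>N. \<exists>c\<in>carrier R. y = n \<oplus> c \<otimes> x"
proof -
  have P: "\<zero> \<in> PIdl x" by (rule ideal_zero_mem[OF cgenideal_ideal[OF x]])
  have "Idl (insert x N) \<subseteq> N <+> PIdl x"
  proof (rule genideal_minimal)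
    show "ideal (N <+> PIdl x) R" by (intro add_ideals N cgenideal_ideal x)
    have "n \<in> N <+> PIdl x" if "n \<in> N" for n
      using set_add_memI[OF that P] ideal.Icarr[OF N that] by simp
    moreover have "x \<in> N <+> PIdl x"
      using set_add_memI[OF ideal_zero_mem[OF N] cgenideal_self[OF x]] x by simp
    ultimately show "insert x N \<subseteq> N <+> PIdl x" by blast
  qed
  then have "y \<in> N <+> PIdl x" using y by blast
  then obtain n z where "n \<in> N" "z \<in> PIdl x" "y = n \<oplus> z" by (rule set_add_memE)
  then show ?thesis by (auto simp: cgenideal_def)
qed

lemma (in ring) genideal_of_ideal: "ideal I R \<Longrightarrow> Idl I = I"
  using genideal_minimal[of I I] genideal_self[of I] ideal_subset[of I] by blast

lemma (in ring) genideal_insert_genideal: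
  assumes "insert x A \<subseteq> carrier R"
  shows "Idl (insert x (Idl A)) = Idl (insert x A)"
proof
  have A: "A \<subseteq> carrier R" and i: "ideal (Idl A) R" "ideal (Idl (insert x A)) R"
    using assms by (auto intro: genideal_ideal)
  have s: "insert x A \<subseteq> Idl (insert x A)" using genideal_self assms by blast
  show "Idl (insert x (Idl A)) \<subseteq> Idl (insert x A)"
    using s genideal_minimal[OF i(2), of A] by (intro genideal_minimal i) auto
  have c: "insert x (Idl A) \<subseteq> carrier R" using assms ideal_subset[OF i(1)] by auto
  show "Idl (insert x A) \<subseteq> Idl (insert x (Idl A))"
    using subset_Idl_subset[OF c, of "insert x A"] genideal_self[OF A] by auto
qed

text \<open>
  Applied to the element one, this yields maximal ideals. Applied to ideals between \<open>\<mm>\<^sup>2\<close> and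
  \<open>\<mm>\<close>, it yields a hyperplane of the vector space \<open>W / \<mm>\<^sup>2\<close> that misses the class of \<open>x\<close>.
\<close>

lemma (in ring) maximal_ideal_avoiding:
  assumes I: "ideal I R" "I \<subseteq> W" "x \<notin> I"
  obtains H where "ideal H R" "I \<subseteq> H" "H \<subseteq> W" "x \<notin> H"
    "\<And>J. ideal J R \<Longrightarrow> H \<subseteq> J \<Longrightarrow> J \<subseteq> W \<Longrightarrow> x \<notin> J \<Longrightarrow> J = H"
proof -
  define C where "C = {H. ideal H R \<and> I \<subseteq> H \<and> H \<subseteq> W \<and> x \<notin> H}"
  have "\<exists>H\<in>C. \<forall>J\<in>C. H \<subseteq> J \<longrightarrow> J = H"
  proof (rule subset_Zorn_nonempty)
    show "C \<noteq> {}" using I by (auto simp: C_def)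
    fix D assume D: "D \<noteq> {}" "subset.chain C D"
    then have "subset.chain {I. ideal I R} D" by (auto simp: C_def subset_chain_def)
    then have "ideal (\<Union>D) R" using chain_Union_is_ideal[of D] D by simp
    then show "\<Union>D \<in> C" using D by (auto simp: C_def subset_chain_def)
  qed
  then obtain H where H: "H \<in> C" and max: "\<And>J. J \<in> C \<Longrightarrow> H \<subseteq> J \<Longrightarrow> J = H" by blast
  show thesis
  proof (rule that)
    show "J = H" if "ideal J R" "H \<subseteq> J" "J \<subseteq> W" "x \<notin> J" for J
      using that H by (intro max) (auto simp: C_def)
  qed (use H in \<open>auto simp: C_def\<close>)
qed

text \<open>
  If no member were minimal, iterating the choice of a strictly smaller one would contradict the
  descending chain condition.
\<close>

lemma (in artinian_ring) minimal_ideal: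
  assumes "I0 \<in> C" and C: "\<And>I. I \<in> C \<Longrightarrow> ideal I R"
  obtains I where "I \<in> C" "\<And>J. J \<in> C \<Longrightarrow> J \<subseteq> I \<Longrightarrow> J = I"
proof -
  have "\<exists>I\<in>C. \<forall>J\<in>C. J \<subseteq> I \<longrightarrow> J = I"
  proof (rule ccontr)
    assume "\<not> ?thesis"
    then obtain g where g: "\<And>I. I \<in> C \<Longrightarrow> g I \<in> C \<and> g I \<subseteq> I \<and> g I \<noteq> I" by metis
    have c: "(g ^^ n) I0 \<in> C" for n by (induction n) (use assms g in auto)
    then have "\<exists>n0. \<forall>n\<ge>n0. (g ^^ n) I0 = (g ^^ n0) I0"
      using C g by (intro descending_chain_condition) auto
    then obtain n0 where "(g ^^ Suc n0) I0 = (g ^^ n0) I0" by (meson le_SucI order_refl)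
    then show False using g[OF c] by auto
  qed
  then obtain I where "I \<in> C" "\<forall>J\<in>C. J \<subseteq> I \<longrightarrow> J = I" by (elim bexE)
  then show thesis by (intro that) auto
qed

lemma (in cring) ideals_monoid: "Group.monoid (ideals_set R)"
  using ideals_set_is_comm_monoid by (rule comm_monoid.axioms)

lemma (in cring) ideal_power_0: "ideal_power R I 0 = carrier R"
  by (simp add: ideals_set_def nat_pow_def)

lemma (in cring) ideal_power_Suc: "ideal_power R I (Suc n) = ideal_power R I n \<cdot> I"
  by (simp add: ideals_set_def nat_pow_def)

lemma (in cring) ideal_power_ideal: "ideal I R \<Longrightarrow> ideal (ideal_power R I n) R"
  by (induction n) (simp_all add: ideals_set_def oneideal ideal_prod_is_ideal)

lemma (in cring) ideal_power_1: "ideal I R \<Longrightarrow> ideal_power R I (Suc 0) = I"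
  unfolding ideal_power_Suc ideal_power_0 by (simp add: ideal_prod_commute oneideal ideal_prod_one)

lemma (in cring) ideal_power_2: "ideal I R \<Longrightarrow> ideal_power R I 2 = I \<cdot> I"
  by (metis ideal_power_Suc ideal_power_1 numeral_2_eq_2)

lemma (in cring) ideal_power_add:
  assumes "ideal I R"
  shows "ideal_power R I n \<cdot> ideal_power R I m = ideal_power R I (n + m)"
  using monoid.nat_pow_mult[OF ideals_monoid, of I n m] assms by (simp add: ideals_set_def)

lemma (in cring) ideal_power_antimono:
  assumes "ideal I R" shows "ideal_power R I (n + d) \<subseteq> ideal_power R I n"
  using ideal_prod_inter[OF ideal_power_ideal ideal_power_ideal, OF assms assms]
  unfolding ideal_power_add[OF assms, symmetric] by blast

section \<open>Artinian local rings\<close>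

lemma (in local_ring) max_ideal_maximal: "maximalideal (max_ideal R) R"
  unfolding max_ideal_def by (rule theI'[OF unique_maximal])

lemma (in local_ring) max_ideal_ideal: "ideal (max_ideal R) R"
  using max_ideal_maximal by (simp add: maximalideal_def)

lemma (in local_ring) max_idealD: "x \<in> max_ideal R \<Longrightarrow> x \<in> carrier R"
  by (rule ideal.Icarr[OF max_ideal_ideal])

lemma (in local_ring) one_notin_max_ideal: "\<one> \<notin> max_ideal R"
  using ideal.one_imp_carrier[OF max_ideal_ideal] maximalideal.I_notcarr[OF max_ideal_maximal] by blast

lemma (in local_ring) max_ideal_mult: "x \<in> max_ideal R \<Longrightarrow> a \<in> carrier R \<Longrightarrow> a \<otimes> x \<in> max_ideal R"
  by (simp add: ideal.I_l_closed max_ideal_ideal)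

text \<open>
  A nonunit generates a proper ideal, and by Zorn's lemma that ideal is contained in a maximal one.
\<close>

lemma (in local_ring) Units_outside_max_ideal:
  assumes x: "x \<in> carrier R" "x \<notin> max_ideal R" shows "x \<in> Units R"
proof (rule ccontr)
  assume nu: "x \<notin> Units R"
  have "\<one> \<notin> PIdl x"
  proof
    assume "\<one> \<in> PIdl x"
    then obtain y where "y \<in> carrier R" "\<one> = y \<otimes> x" by (auto simp: cgenideal_def)
    with x nu show False unfolding Units_def by (metis (mono_tags, lifting) m_comm mem_Collect_eq)
  qed
  then obtain H where H: "ideal H R" "PIdl x \<subseteq> H" "\<one> \<notin> H"
    "\<And>J. ideal J R \<Longrightarrow> H \<subseteq> J \<Longrightarrow> J \<subseteq> carrier R \<Longrightarrow> \<one> \<notin> J \<Longrightarrow> J = H"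
    using maximal_ideal_avoiding[OF cgenideal_ideal[OF x(1)], of "carrier R" \<one>]
      ideal_subset[OF cgenideal_ideal[OF x(1)]] by metis
  have "maximalideal H R"
    using H(1,3,4) ideal.one_imp_carrier by (intro maximalidealI) auto
  then have "H = max_ideal R" using unique_maximal max_ideal_maximal by blast
  then show False using H(2) cgenideal_self[OF x(1)] x(2) by blast
qed

lemma (in local_ring) cancel_one_minus:
  assumes "a \<in> max_ideal R" "x \<in> carrier R" "x = a \<otimes> x" shows "x = \<zero>"
proof -
  have a: "a \<in> carrier R" using assms max_idealD by blast
  have "\<one> \<ominus> a \<notin> max_ideal R"
  proof
    assume "\<one> \<ominus> a \<in> max_ideal R"
    then have "\<one> \<ominus> a \<oplus> a \<in> max_ideal R" using assms(1) ideal_add_mem[OF max_ideal_ideal] by blast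
    then show False using one_notin_max_ideal a by (simp add: a_minus_def a_assoc l_neg)
  qed
  then have u: "\<one> \<ominus> a \<in> Units R" using a Units_outside_max_ideal by simp
  have "(\<one> \<ominus> a) \<otimes> x = x \<ominus> a \<otimes> x" using a assms by (simp add: a_minus_def l_distr l_minus)
  also have "\<dots> = \<zero>" using assms(2) by (simp add: a_minus_def r_neg flip: assms(3))
  finally have "(\<one> \<ominus> a) \<otimes> x = (\<one> \<ominus> a) \<otimes> \<zero>" using a by simp
  then show ?thesis using Units_l_cancel[OF u] assms(2) by blast
qed

text \<open>
  A proper ideal whose complement consists of units contains every other proper ideal. Besides
  proving locality, this serves to compute the maximal ideal.
\<close>

lemma local_ring_criterion:
  fixes R (structure)
  assumes "cring R" and M: "ideal M R" "\<one> \<notin> M"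
    and U: "\<And>x. x \<in> carrier R \<Longrightarrow> x \<notin> M \<Longrightarrow> x \<in> Units R"
  shows "local_ring R" and "max_ideal R = M"
proof -
  interpret cring R by fact
  have big: "J = carrier R" if J: "ideal J R" and notsub: "\<not> J \<subseteq> M" for J
  proof -
    obtain x where x: "x \<in> J" "x \<notin> M" using notsub by blast
    then have "x \<in> Units R" using U ideal.Icarr[OF J] by blast
    then have "inv x \<otimes> x = \<one>" "inv x \<in> carrier R" by (auto simp: Units_closed)
    then have "\<one> \<in> J" using ideal.I_l_closed[OF J x(1)] by metis
    then show ?thesis using ideal.one_imp_carrier J by blast
  qed
  have m: "maximalideal M R"
    using M big by (intro maximalidealI) auto
  have un: "N = M" if "maximalideal N R" for N
  proof -
    interpret N: maximalideal N R by fact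
    have "N \<subseteq> M" using big[OF N.is_ideal] N.I_notcarr by blast
    then show ?thesis using N.I_maximal[OF M(1)] M ideal_subset[OF M(1)] by blast
  qed
  show "local_ring R" by unfold_locales (rule ex1I[of _ M], rule m, rule un)
  show "max_ideal R = M" unfolding max_ideal_def by (rule the_equality) (rule m, rule un)
qed

locale artinian_local_ring = local_ring R + artinian_ring R for R (structure)

sublocale gorenstein_artin_local_ring \<subseteq> artinian_local_ring ..

context artinian_local_ring
begin

abbreviation \<mm> where "\<mm> \<equiv> max_ideal R"

text \<open>
  The powers of \<open>\<mm>\<close> become stationary at an idempotent ideal \<open>I\<close>. If \<open>I \<noteq> 0\<close>, let \<open>J\<close> be minimal
  among the ideals with \<open>I J \<noteq> 0\<close>, and let \<open>x \<in> J\<close> with \<open>I x \<noteq> 0\<close>. Then \<open>I (I x) = I x \<noteq> 0\<close>, so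
  \<open>I x = J\<close> by minimality. Hence \<open>x = a x\<close> with \<open>a \<in> I \<subseteq> \<mm>\<close>, and \<open>x = 0\<close> because \<open>1 - a\<close> is a
  unit.
\<close>

lemma max_ideal_nilpotent: "\<exists>n. ideal_power R \<mm> n = {\<zero>}"
proof -
  note mi = max_ideal_ideal
  obtain n0 where n0: "\<And>n. n \<ge> n0 \<Longrightarrow> ideal_power R \<mm> n = ideal_power R \<mm> n0"
    using descending_chain_condition[of "ideal_power R \<mm>"] ideal_power_ideal[OF mi]
      ideal_power_antimono[OF mi, of _ 1] by auto
  \<comment> \<open>The successor makes sure that the power is contained in the maximal ideal.\<close>
  define I where "I = ideal_power R \<mm> (Suc n0)"
  have I: "ideal I R" unfolding I_def by (rule ideal_power_ideal[OF mi])
  have Im: "I \<subseteq> \<mm>" using ideal_power_antimono[OF mi, of "Suc 0" n0] ideal_power_1[OF mi]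
    by (simp add: I_def)
  have II: "I \<cdot> I = I"
    unfolding I_def ideal_power_add[OF mi]
    by (rule trans[OF n0 n0[symmetric]]) simp_all
  have "I = {\<zero>}"
  proof (rule ccontr)
    assume ne: "I \<noteq> {\<zero>}"
    define C where "C = {J. ideal J R \<and> (\<exists>i\<in>I. \<exists>j\<in>J. i \<otimes> j \<noteq> \<zero>)}"
    have "I \<in> C"
    proof (rule ccontr)
      assume "I \<notin> C"
      then have "I \<cdot> I \<subseteq> {\<zero>}" using I by (intro ideal_prod_least zeroideal) (auto simp: C_def)
      then show False using II ne ideal_zero_mem[OF I] by auto
    qed
    then obtain J where J: "J \<in> C" "\<And>K. K \<in> C \<Longrightarrow> K \<subseteq> J \<Longrightarrow> K = J"
      using minimal_ideal[of I C] unfolding C_def by blast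
    then obtain i x where ix: "i \<in> I" "x \<in> J" "i \<otimes> x \<noteq> \<zero>" and Ji: "ideal J R" by (auto simp: C_def)
    have x: "x \<in> carrier R" using ideal.Icarr[OF Ji ix(2)] .
    note Ic = ideal.Icarr[OF I]
    define K where "K = {a \<otimes> x | a. a \<in> I}"
    have K: "ideal K R"
    proof (rule ideal_criterion)
      show "\<zero> \<in> K" using ideal_zero_mem[OF I] x unfolding K_def by force
      show "a \<oplus> b \<in> K" if "a \<in> K" "b \<in> K" for a b
        using that x Ic ideal_add_mem[OF I] unfolding K_def by (auto simp flip: l_distr; metis)
      show "y \<otimes> a \<in> K" if "a \<in> K" "y \<in> carrier R" for a y
        using that x Ic ideal.I_l_closed[OF I] unfolding K_def by (auto simp flip: m_assoc; metis)
    qed (use x Ic in \<open>auto simp: K_def\<close>)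
    have ann: "ideal {a \<in> carrier R. a \<otimes> x = \<zero>} R"
      using x by (intro ideal_criterion) (auto simp: l_distr m_assoc)
    have "\<exists>a\<in>I. \<exists>b\<in>I. (a \<otimes> b) \<otimes> x \<noteq> \<zero>"
    proof (rule ccontr)
      assume "\<not> ?thesis"
      then have "I \<cdot> I \<subseteq> {a \<in> carrier R. a \<otimes> x = \<zero>}" using Ic
        by (intro ideal_prod_least ann) auto
      then show False using II ix by auto
    qed
    then have "K \<in> C" using K x Ic unfolding C_def K_def by (auto simp: m_assoc)
    moreover have "K \<subseteq> J" using ideal.I_l_closed[OF Ji ix(2)] Ic unfolding K_def by auto
    ultimately have "x \<in> K" using J(2) ix(2) by blast
    then obtain a where "a \<in> I" "x = a \<otimes> x" unfolding K_def by auto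
    then have "x = \<zero>" using cancel_one_minus[of a x] Im x by blast
    then show False using ix Ic by simp
  qed
  then show ?thesis unfolding I_def by blast
qed

text \<open>
  Nakayama's lemma without finite generation of \<open>N\<close>: substituting the inclusion into itself
  replaces \<open>\<mm> N\<close> by \<open>\<mm>\<^sup>n N\<close> for every \<open>n\<close>, and \<open>\<mm>\<close> is nilpotent.
\<close>

lemma nakayama:
  assumes N: "ideal N R" and B: "ideal B R" and sub: "N \<subseteq> B <+> \<mm> \<cdot> N"
  shows "N \<subseteq> B"
proof -
  note mi = max_ideal_ideal
  note pw = ideal_power_ideal[OF mi]
  have "N \<subseteq> B <+> ideal_power R \<mm> n \<cdot> N" for n
  proof (induction n)
    case 0
    have "ideal_power R \<mm> 0 \<cdot> N = N"
      unfolding ideal_power_0 by (simp add: ideal_prod_commute[OF oneideal N] ideal_prod_one N)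
    moreover have "x = \<zero> \<oplus> x" if "x \<in> N" for x using that ideal.Icarr[OF N] by simp
    ultimately show ?case using set_add_memI[OF ideal_zero_mem[OF B]] by (metis subsetI)
  next
    case (Suc n)
    let ?P = "ideal_power R \<mm> n" and ?K = "B <+> ideal_power R \<mm> (Suc n) \<cdot> N"
    have assoc: "ideal_power R \<mm> (Suc n) \<cdot> N = ?P \<cdot> (\<mm> \<cdot> N)"
      unfolding ideal_power_Suc by (simp add: ideal_prod_assoc pw mi N)
    have i: "ideal (\<mm> \<cdot> N) R" "ideal (?P \<cdot> (\<mm> \<cdot> N)) R" by (intro ideal_prod_is_ideal pw mi N)+
    have K: "ideal ?K R" unfolding assoc by (intro add_ideals B i)
    have BK: "B \<subseteq> ?K"
    proof
      fix b assume b: "b \<in> B"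
      show "b \<in> ?K" using set_add_memI[OF b ideal_zero_mem[OF i(2)]] ideal.Icarr[OF B b] unfolding assoc by simp
    qed
    have "?P \<cdot> N \<subseteq> ?K"
    proof (rule ideal_prod_least[OF K])
      fix a x assume a: "a \<in> ?P" and x: "x \<in> N"
      then obtain b y where b: "b \<in> B" and y: "y \<in> \<mm> \<cdot> N" and xe: "x = b \<oplus> y"
        using set_add_memE[OF subsetD[OF sub x]] by metis
      have "a \<otimes> x = a \<otimes> b \<oplus> a \<otimes> y"
        using ideal.Icarr[OF pw a] ideal.Icarr[OF B b] ideal.Icarr[OF i(1) y] by (simp add: xe r_distr)
      moreover have "a \<otimes> b \<in> B" using ideal.I_l_closed[OF B b] ideal.Icarr[OF pw a] by blast
      moreover have "a \<otimes> y \<in> ?P \<cdot> (\<mm> \<cdot> N)" using a y by (rule ideal_prod.prod)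
      ultimately show "a \<otimes> x \<in> ?K" unfolding assoc by (simp add: set_add_memI)
    qed
    then have "B <+> ?P \<cdot> N \<subseteq> ?K"
      using BK set_add_least[OF K] by simp
    then show ?case using Suc by blast
  qed
  moreover obtain n where "ideal_power R \<mm> n = {\<zero>}" using max_ideal_nilpotent by blast
  moreover have "{\<zero>} \<cdot> N = {\<zero>}"
    using ideal_prod_commute[OF zeroideal N] ideal_prod_zero[OF N] by simp
  ultimately have "N \<subseteq> B <+> {\<zero>}" by metis
  moreover have "{\<zero>} \<subseteq> B" using ideal_zero_mem[OF B] by simp
  ultimately show ?thesis using set_add_least[OF B, of B "{\<zero>}"] by simp
qed

text \<open>
  A minimal nonzero ideal \<open>J\<close> below the principal ideal of \<open>x\<close> satisfies \<open>\<mm> J \<noteq> J\<close> by Nakayama's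
  lemma. Hence \<open>\<mm> J = 0\<close>, that is, \<open>J\<close> is contained in the socle.
\<close>

lemma exists_multiple_in_socle:
  assumes x: "x \<in> carrier R" "x \<noteq> \<zero>"
  obtains c where "c \<in> carrier R" "c \<otimes> x \<in> socle R" "c \<otimes> x \<noteq> \<zero>"
proof -
  define C where "C = {J. ideal J R \<and> J \<subseteq> PIdl x \<and> J \<noteq> {\<zero>}}"
  have "PIdl x \<in> C" using cgenideal_ideal cgenideal_self[of x] x by (auto simp: C_def)
  then obtain J where J: "J \<in> C" "\<And>K. K \<in> C \<Longrightarrow> K \<subseteq> J \<Longrightarrow> K = J"
    using minimal_ideal[of _ C] unfolding C_def by blast
  then have Ji: "ideal J R" "J \<subseteq> PIdl x" "J \<noteq> {\<zero>}" by (auto simp: C_def)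
  have mJ: "ideal (\<mm> \<cdot> J) R" "\<mm> \<cdot> J \<subseteq> J"
    using ideal_prod_is_ideal[OF max_ideal_ideal Ji(1)] ideal_prod_inter[OF max_ideal_ideal Ji(1)] by auto
  have "\<mm> \<cdot> J = {\<zero>}"
  proof (rule ccontr)
    assume "\<mm> \<cdot> J \<noteq> {\<zero>}"
    then have "\<mm> \<cdot> J \<in> C" using mJ Ji unfolding C_def by auto
    then have e: "\<mm> \<cdot> J = J" using J(2) mJ by blast
    have "j = \<zero> \<oplus> j" if "j \<in> J" for j using ideal.Icarr[OF Ji(1) that] by simp
    then have "J \<subseteq> {\<zero>} <+> \<mm> \<cdot> J" unfolding e by (metis set_add_memI singletonI subsetI)
    then have "J \<subseteq> {\<zero>}" using nakayama[OF Ji(1) zeroideal] by blast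
    then show False using Ji ideal_zero_mem by blast
  qed
  moreover obtain y where y: "y \<in> J" "y \<noteq> \<zero>" using Ji ideal_zero_mem by blast
  ultimately have "a \<otimes> y = \<zero>" if "a \<in> \<mm>" for a
    using ideal_prod.prod[of a \<mm> y J R] that by simp
  then have "y \<in> socle R" using ideal.Icarr[OF Ji(1) y(1)] m_comm max_idealD unfolding socle_def by fastforce
  moreover obtain c where "c \<in> carrier R" "y = c \<otimes> x" using y Ji(2) by (auto simp: cgenideal_def)
  ultimately show thesis using that y by blast
qed

text \<open>
  Nilpotency of \<open>\<mm>\<close> makes the set in the definition of the Loewy length finite, so that its
  maximum is meaningful.
\<close>

lemma loewy_length_ge_2_iff:
  "loewy_length R \<ge> 2 \<longleftrightarrow> (\<exists>x\<in>\<mm>. \<exists>y\<in>\<mm>. x \<otimes> y \<noteq> \<zero>)"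
proof -
  note mi = max_ideal_ideal
  let ?A = "{n. ideal_power R \<mm> n \<noteq> {\<zero>}}"
  obtain n where n: "ideal_power R \<mm> n = {\<zero>}" using max_ideal_nilpotent by blast
  have up: "ideal_power R \<mm> j = {\<zero>}" if "ideal_power R \<mm> i = {\<zero>}" "i \<le> j" for i j
    using that ideal_power_antimono[OF mi, of i "j - i"] ideal_zero_mem[OF ideal_power_ideal[OF mi], of j]
    by auto
  have "?A \<subseteq> {..n}" using up[OF n] by (metis (mono_tags, lifting) atMost_iff linear mem_Collect_eq subsetI)
  then have fin: "finite ?A" by (rule finite_subset) simp
  have "\<one> \<noteq> \<zero>" using one_notin_max_ideal ideal_zero_mem[OF mi] by metis
  then have "ideal_power R \<mm> 0 \<noteq> {\<zero>}" unfolding ideal_power_0 using one_closed by (metis singletonD)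
  then have "0 \<in> ?A" by (rule CollectI)
  then have "loewy_length R \<ge> 2 \<longleftrightarrow> (\<exists>n\<in>?A. n \<ge> 2)"
    unfolding loewy_length_def using Max_ge_iff[OF fin, of 2] by blast
  also have "\<dots> \<longleftrightarrow> ideal_power R \<mm> 2 \<noteq> {\<zero>}"
    using up[of _ 2] up[of 2] by (metis (mono_tags, lifting) mem_Collect_eq order_refl)
  also have "\<dots> \<longleftrightarrow> (\<exists>x\<in>\<mm>. \<exists>y\<in>\<mm>. x \<otimes> y \<noteq> \<zero>)"
  proof -
    have "\<mm> \<cdot> \<mm> \<subseteq> {\<zero>}" if "\<forall>x\<in>\<mm>. \<forall>y\<in>\<mm>. x \<otimes> y = \<zero>"
      using that by (intro ideal_prod_least zeroideal) auto
    then show ?thesis unfolding ideal_power_2[OF mi]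
      using ideal_prod.prod[of _ \<mm> _ \<mm> R] ideal_zero_mem[OF ideal_prod_is_ideal[OF mi mi]] by blast
  qed
  finally show ?thesis .
qed

end



section \<open>Length and socle\<close>

lemma module_length_ge:
  assumes "\<And>i. i \<le> n \<Longrightarrow> submodule (N i) R M" "\<And>i. i < n \<Longrightarrow> N i \<subset> N (Suc i)"
  shows "enat n \<le> module_length R M"
  unfolding module_length_def using assms by (intro Sup_upper) blast

lemma module_length_le:
  assumes "\<And>N n. (\<And>i. i \<le> n \<Longrightarrow> submodule (N i) R M) \<Longrightarrow> (\<And>i. i < n \<Longrightarrow> N i \<subset> N (Suc i)) \<Longrightarrow> n \<le> b"
  shows "module_length R M \<le> enat b"
  unfolding module_length_def
proof (rule Sup_least)
  fix x assume "x \<in> {enat n |n. \<exists>N. (\<forall>i\<le>n. submodule (N i) R M) \<and> (\<forall>i<n. N i \<subset> N (Suc i))}"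
  then obtain n N where "x = enat n" "\<forall>i\<le>n. submodule (N i) R M" "\<forall>i<n. N i \<subset> N (Suc i)" by blast
  then show "x \<le> enat b" using assms[of n N] by simp
qed

lemma (in cring) submodule_ideal_module:
  assumes I: "ideal I R"
  shows "submodule N R (ideal_module R I) \<longleftrightarrow> ideal N R \<and> N \<subseteq> I"
proof
  assume "submodule N R (ideal_module R I)"
  then interpret N: submodule N R "ideal_module R I" .
  have c: "N \<subseteq> I" using N.subset by (simp add: ideal_module_def)
  moreover have "ideal N R"
  proof (rule ideal_criterion)
    show "N \<subseteq> carrier R" using c ideal_subset[OF I] by (rule subset_trans)
  qed (use N.one_closed N.m_closed N.smult_closed in \<open>auto simp: ideal_module_def\<close>)
  ultimately show "ideal N R \<and> N \<subseteq> I" by simp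
next
  assume N: "ideal N R \<and> N \<subseteq> I"
  interpret M: Module.module R "ideal_module R I" by (rule ideal_module_is_module[OF is_cring I])
  have "\<ominus>\<^bsub>ideal_module R I\<^esub> a \<in> N" if a: "a \<in> N" for a
  proof -
    have c: "a \<in> carrier (ideal_module R I)" using a N by (auto simp: ideal_module_def)
    have "\<ominus>\<^bsub>ideal_module R I\<^esub> a = (\<ominus> \<one>) \<odot>\<^bsub>ideal_module R I\<^esub> a"
      using c by (simp add: M.smult_l_minus)
    also have "\<dots> = (\<ominus> \<one>) \<otimes> a" by (simp add: ideal_module_def)
    finally show ?thesis using a N ideal.I_l_closed[of N R a "\<ominus> \<one>"] by simp
  qed
  then show "submodule N R (ideal_module R I)"
    using N ideal_zero_mem[of N] ideal_add_mem[of N] ideal.I_l_closed[of N R]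
    by (intro M.submoduleI) (auto simp: ideal_module_def)
qed

text \<open>
  A module has length one if and only if it is simple, and simplicity of an ideal means that each of
  its nonzero elements generates it.
\<close>

lemma (in cring) ideal_module_length_one_iff:
  assumes I: "ideal I R"
  shows "module_length R (ideal_module R I) = 1 \<longleftrightarrow>
    I \<noteq> {\<zero>} \<and> (\<forall>a\<in>I. \<forall>b\<in>I. b \<noteq> \<zero> \<longrightarrow> (\<exists>c\<in>carrier R. a = c \<otimes> b))"
proof (intro iffI conjI ballI impI)
  let ?M = "ideal_module R I"
  note sub = submodule_ideal_module[OF I]
  assume one: "module_length R ?M = 1"
  show "I \<noteq> {\<zero>}"
  proof
    assume I0: "I = {\<zero>}"
    have "module_length R ?M \<le> enat 0"
    proof (rule module_length_le)
      fix N :: "nat \<Rightarrow> 'a set" and n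
      assume N: "\<And>i. i \<le> n \<Longrightarrow> submodule (N i) R ?M" "\<And>i. i < n \<Longrightarrow> N i \<subset> N (Suc i)"
      show "n \<le> 0"
      proof (rule ccontr)
        assume "\<not> n \<le> 0"
        then have "ideal (N 0) R" "N 1 \<subseteq> {\<zero>}" "N 0 \<subset> N 1" using N[unfolded sub] I0 by auto
        then show False using ideal_zero_mem by auto
      qed
    qed
    then show False using one by (simp add: zero_enat_def[symmetric])
  qed
  fix a b assume ab: "a \<in> I" "b \<in> I" "b \<noteq> \<zero>"
  have b: "b \<in> carrier R" using ideal.Icarr[OF I ab(2)] .
  have "a \<in> PIdl b"
  proof (rule ccontr)
    assume na: "a \<notin> PIdl b"
    define N where "N i = (if i = 0 then {\<zero>} else if i = 1 then PIdl b else I)" for i :: nat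
    have P: "PIdl b \<subseteq> I" "ideal (PIdl b) R" "b \<in> PIdl b"
      using cgenideal_minimal[OF I ab(2)] cgenideal_ideal[OF b] cgenideal_self[OF b] by auto
    have "enat 2 \<le> module_length R ?M"
    proof (rule module_length_ge)
      show "submodule (N i) R ?M" for i
        using P I zeroideal ideal_zero_mem[OF I] by (auto simp: N_def sub)
      show "N i \<subset> N (Suc i)" if "i < 2" for i
        using that P ab na ideal_zero_mem[OF P(2)] by (cases "i = 0") (auto simp: N_def)
    qed
    then show False using one by (simp add: one_enat_def)
  qed
  then show "\<exists>c\<in>carrier R. a = c \<otimes> b" by (auto simp: cgenideal_def)
next
  let ?M = "ideal_module R I"
  note sub = submodule_ideal_module[OF I]
  assume simple: "I \<noteq> {\<zero>} \<and> (\<forall>a\<in>I. \<forall>b\<in>I. b \<noteq> \<zero> \<longrightarrow> (\<exists>c\<in>carrier R. a = c \<otimes> b))"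
  have whole: "N = I" if N: "ideal N R" "N \<subseteq> I" "b \<in> N" "b \<noteq> \<zero>" for N b
  proof
    show "I \<subseteq> N"
    proof
      fix a assume "a \<in> I"
      then obtain c where "c \<in> carrier R" "a = c \<otimes> b" using simple N by blast
      then show "a \<in> N" using ideal.I_l_closed[OF N(1,3)] by simp
    qed
  qed fact
  have "enat 1 \<le> module_length R ?M"
    by (rule module_length_ge[where N = "\<lambda>i. if i = 0 then {\<zero>} else I"])
      (use I simple zeroideal ideal_zero_mem[OF I] in \<open>auto simp: sub\<close>)
  moreover have "module_length R ?M \<le> enat 1"
  proof (rule module_length_le)
    fix N :: "nat \<Rightarrow> 'a set" and n
    assume N: "\<And>i. i \<le> n \<Longrightarrow> submodule (N i) R ?M" "\<And>i. i < n \<Longrightarrow> N i \<subset> N (Suc i)"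
    show "n \<le> 1"
    proof (rule ccontr)
      assume n: "\<not> n \<le> 1"
      have i: "ideal (N 0) R" "ideal (N 1) R" "N 1 \<subseteq> I" "N (Suc 1) \<subseteq> I"
        using N(1)[unfolded sub, of 0] N(1)[unfolded sub, of 1] N(1)[unfolded sub, of "Suc 1"] n by simp_all
      have s: "N 0 \<subset> N 1" "N 1 \<subset> N (Suc 1)" using N(2)[of 0] N(2)[of 1] n by simp_all
      obtain b where "b \<in> N 1" "b \<notin> N 0" using s(1) by blast
      then have "N 1 = I" using whole[OF i(2,3)] ideal_zero_mem[OF i(1)] by metis
      then show False using s i by blast
    qed
  qed
  ultimately show "module_length R ?M = 1" by (simp add: one_enat_def)
qed

lemma (in local_ring) socle_ideal: "ideal (socle R) R"
  using max_idealD by (intro ideal_criterion) (auto simp: socle_def l_distr m_assoc)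

lemma (in local_ring) socleD: "a \<in> socle R \<Longrightarrow> a \<in> carrier R"
  by (simp add: socle_def)

lemma (in local_ring) socle_mult_zero: "a \<in> socle R \<Longrightarrow> x \<in> max_ideal R \<Longrightarrow> a \<otimes> x = \<zero>"
  by (simp add: socle_def)

context gorenstein_artin_local_ring
begin

lemma exists_socle_nonzero: "\<exists>a\<in>socle R. a \<noteq> \<zero>"
  using type_one ideal_module_length_one_iff[OF socle_ideal] ideal_zero_mem[OF socle_ideal] by blast

text \<open>
  Every nonzero ideal meets the socle, and the socle is simple.
\<close>

lemma socle_subset_principal:
  assumes x: "x \<in> carrier R" "x \<noteq> \<zero>" and a: "a \<in> socle R"
  obtains c where "c \<in> carrier R" "a = c \<otimes> x"
proof -
  obtain d where d: "d \<in> carrier R" "d \<otimes> x \<in> socle R" "d \<otimes> x \<noteq> \<zero>"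
    using exists_multiple_in_socle[OF x] .
  then obtain c where c: "c \<in> carrier R" "a = c \<otimes> (d \<otimes> x)"
    using type_one a unfolding ideal_module_length_one_iff[OF socle_ideal] by blast
  then show thesis using that[of "c \<otimes> d"] d x by (simp add: m_assoc)
qed

lemma socle_generatorI:
  assumes d: "d \<in> socle R" "d \<noteq> \<zero>" shows "socle_generator R d"
proof -
  have c: "d \<in> carrier R" using socleD d by blast
  have "socle R \<subseteq> PIdl d"
    using socle_subset_principal[OF c d(2)] unfolding cgenideal_def by blast
  then have "socle R = Idl {d}"
    using cgenideal_eq_genideal[OF c] cgenideal_minimal[OF socle_ideal d(1)] by auto
  then show ?thesis using c by (simp add: socle_generator_def)
qed

lemma socle_generatorD:
  assumes "socle_generator R d"
  shows "d \<in> socle R" "d \<noteq> \<zero>" "a \<in> socle R \<Longrightarrow> \<exists>c\<in>carrier R. a = c \<otimes> d"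
proof -
  have d: "d \<in> carrier R" and s: "socle R = Idl {d}" using assms by (auto simp: socle_generator_def)
  have s': "socle R = PIdl d" using s cgenideal_eq_genideal[OF d] by simp
  show "d \<in> socle R" using cgenideal_self[OF d] s' by simp
  show "d \<noteq> \<zero>"
  proof
    assume "d = \<zero>"
    then show False using s genideal_zero exists_socle_nonzero by auto
  qed
  show "\<exists>c\<in>carrier R. a = c \<otimes> d" if "a \<in> socle R" using that s' by (auto simp: cgenideal_def)
qed

text \<open>
  The ideal \<open>\<mm>\<^sup>2\<close> is nonzero, so it contains the socle. This is why gluing along the socles does not
  affect \<open>\<mm> / \<mm>\<^sup>2\<close> of the summands.
\<close>

lemma socle_subset_max_ideal_square:
  assumes "loewy_length R \<ge> 2" shows "socle R \<subseteq> \<mm> \<cdot> \<mm>"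
proof
  fix a assume a: "a \<in> socle R"
  obtain x y where xy: "x \<in> \<mm>" "y \<in> \<mm>" "x \<otimes> y \<noteq> \<zero>" using assms loewy_length_ge_2_iff by blast
  then have c: "x \<in> carrier R" "y \<in> carrier R" using max_idealD by auto
  then obtain b where b: "b \<in> carrier R" "a = b \<otimes> (x \<otimes> y)"
    using socle_subset_principal[of "x \<otimes> y", OF _ xy(3) a] by auto
  then have "a = (b \<otimes> x) \<otimes> y" using c by (simp add: m_assoc)
  then show "a \<in> \<mm> \<cdot> \<mm>" using ideal_prod.prod[of "b \<otimes> x" \<mm> y \<mm> R] xy b max_ideal_mult by simp
qed

end

lemma gorenstein_criterion:
  fixes R (structure)
  assumes "artinian_local_ring R" and "\<exists>a\<in>socle R. a \<noteq> \<zero>"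
    and "\<And>a b. a \<in> socle R \<Longrightarrow> b \<in> socle R \<Longrightarrow> b \<noteq> \<zero> \<Longrightarrow> \<exists>c\<in>carrier R. a = c \<otimes> b"
  shows "gorenstein_artin_local_ring R"
proof -
  interpret artinian_local_ring R by fact
  show ?thesis
    by unfold_locales (use assms(2,3) in \<open>unfold ideal_module_length_one_iff[OF socle_ideal], blast\<close>)
qed

section \<open>Embedding dimension\<close>

context artinian_local_ring
begin

lemma max_ideal_square: "ideal (\<mm> \<cdot> \<mm>) R" "\<mm> \<cdot> \<mm> \<subseteq> \<mm>"
  using ideal_prod_is_ideal[OF max_ideal_ideal max_ideal_ideal]
    ideal_prod_inter[OF max_ideal_ideal max_ideal_ideal] by auto

text \<open>
  Generators of \<open>\<mm> / \<mm>\<^sup>2\<close> lift to generators of \<open>\<mm>\<close>, by Nakayama's lemma.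
\<close>

lemma genideal_eq_max_ideal:
  assumes A: "A \<subseteq> \<mm>" and sub: "\<mm> \<subseteq> Idl (A \<union> \<mm> \<cdot> \<mm>)"
  shows "Idl A = \<mm>"
proof
  have Ac: "A \<subseteq> carrier R" using A max_idealD by blast
  show "Idl A \<subseteq> \<mm>" using genideal_minimal[OF max_ideal_ideal A] .
  note K = add_ideals[OF genideal_ideal[OF Ac] max_ideal_square(1)]
  have "A \<subseteq> Idl A <+> \<mm> \<cdot> \<mm>"
  proof
    fix a assume a: "a \<in> A"
    show "a \<in> Idl A <+> \<mm> \<cdot> \<mm>"
      using set_add_memI[OF subsetD[OF genideal_self[OF Ac] a] ideal_zero_mem[OF max_ideal_square(1)]] a Ac
      by auto
  qed
  moreover have "\<mm> \<cdot> \<mm> \<subseteq> Idl A <+> \<mm> \<cdot> \<mm>"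
  proof
    fix a assume a: "a \<in> \<mm> \<cdot> \<mm>"
    show "a \<in> Idl A <+> \<mm> \<cdot> \<mm>"
      using set_add_memI[OF ideal_zero_mem[OF genideal_ideal[OF Ac]] a] ideal.Icarr[OF max_ideal_square(1) a]
      by simp
  qed
  ultimately have "Idl (A \<union> \<mm> \<cdot> \<mm>) \<subseteq> Idl A <+> \<mm> \<cdot> \<mm>" by (intro genideal_minimal[OF K]) simp
  then show "\<mm> \<subseteq> Idl A" using sub by (intro nakayama[OF max_ideal_ideal genideal_ideal[OF Ac]]) simp
qed

text \<open>
  The exchange lemma of linear algebra in \<open>\<mm> / \<mm>\<^sup>2\<close>: in \<open>y = n + c x\<close> the coefficient \<open>c\<close> is a unit,
  since otherwise \<open>c x \<in> \<mm>\<^sup>2 \<subseteq> N\<close>.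
\<close>

lemma genideal_exchange:
  assumes N: "ideal N R" "\<mm> \<cdot> \<mm> \<subseteq> N" and x: "x \<in> \<mm>" and y: "y \<in> Idl (insert x N)" "y \<notin> N"
  shows "x \<in> Idl (insert y N)"
proof -
  have xc: "x \<in> carrier R" using x max_idealD by blast
  obtain n c where nc: "n \<in> N" "c \<in> carrier R" "y = n \<oplus> c \<otimes> x"
    using genideal_insert[OF N(1) xc y(1)] by blast
  have n: "n \<in> carrier R" using ideal.Icarr[OF N(1) nc(1)] .
  have yc: "y \<in> carrier R" using n nc xc by simp
  have "c \<notin> \<mm>"
  proof
    assume "c \<in> \<mm>"
    then have "c \<otimes> x \<in> N" using ideal_prod.prod[of c \<mm> x \<mm> R] x N(2) by blast
    then show False using y(2) nc ideal_add_mem[OF N(1)] by simp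
  qed
  then have u: "c \<in> Units R" using nc Units_outside_max_ideal by blast
  let ?K = "Idl (insert y N)"
  have sc: "insert y N \<subseteq> carrier R" using yc ideal_subset[OF N(1)] by simp
  have K: "ideal ?K R" and s: "insert y N \<subseteq> ?K" using genideal_ideal[OF sc] genideal_self[OF sc] by auto
  have "y \<ominus> n = c \<otimes> x" using nc n xc by (simp add: a_minus_def a_ac r_neg2 r_neg)
  then have "c \<otimes> x \<in> ?K" using ideal_minus_mem[OF K, of y n] s nc by auto
  then have "inv c \<otimes> (c \<otimes> x) \<in> ?K" using ideal.I_l_closed[OF K] u by simp
  moreover have "inv c \<otimes> (c \<otimes> x) = x" using u xc nc(2) by (simp flip: m_assoc)
  ultimately show ?thesis by simp
qed

text \<open>
  Consider the ideals \<open>W\<close> between \<open>\<mm>\<^sup>2\<close> and \<open>\<mm>\<close> that generate \<open>\<mm>\<close> together with finitely many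
  elements. A minimal such \<open>W\<close> is \<open>\<mm>\<^sup>2\<close>: otherwise a hyperplane \<open>H\<close> of \<open>W\<close>, with one more
  generator outside \<open>H\<close>, would be a smaller candidate. Nakayama's lemma then removes \<open>\<mm>\<^sup>2\<close>.
\<close>

lemma max_ideal_finitely_generated: "\<exists>A. finite A \<and> A \<subseteq> \<mm> \<and> Idl A = \<mm>"
proof -
  note mi = max_ideal_ideal and mc = ideal_subset[OF max_ideal_ideal] and sq = max_ideal_square
  define C where "C = {W. ideal W R \<and> \<mm> \<cdot> \<mm> \<subseteq> W \<and> W \<subseteq> \<mm> \<and> (\<exists>F. finite F \<and> F \<subseteq> \<mm> \<and> \<mm> \<subseteq> Idl (F \<union> W))}"
  have "\<mm> \<subseteq> Idl ({} \<union> \<mm>)" using genideal_self[OF mc] by simp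
  then have "\<mm> \<in> C" unfolding C_def using mi sq by blast
  then obtain W where W: "W \<in> C" and min: "\<And>J. J \<in> C \<Longrightarrow> J \<subseteq> W \<Longrightarrow> J = W"
    using minimal_ideal[of \<mm> C] unfolding C_def by blast
  then obtain F where Wi: "ideal W R" "\<mm> \<cdot> \<mm> \<subseteq> W" "W \<subseteq> \<mm>"
    and F: "finite F" "F \<subseteq> \<mm>" "\<mm> \<subseteq> Idl (F \<union> W)" by (auto simp: C_def)
  have "W = \<mm> \<cdot> \<mm>"
  proof (rule ccontr)
    assume "W \<noteq> \<mm> \<cdot> \<mm>"
    then obtain x where x: "x \<in> W" "x \<notin> \<mm> \<cdot> \<mm>" using Wi by blast
    obtain H where H: "ideal H R" "\<mm> \<cdot> \<mm> \<subseteq> H" "H \<subseteq> W" "x \<notin> H"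
      and max: "\<And>J. ideal J R \<Longrightarrow> H \<subseteq> J \<Longrightarrow> J \<subseteq> W \<Longrightarrow> x \<notin> J \<Longrightarrow> J = H"
      using maximal_ideal_avoiding[OF sq(1) Wi(2) x(2)] by metis
    have xF: "insert x F \<subseteq> \<mm>" using x F(2) Wi(3) by blast
    have c: "insert x F \<union> H \<subseteq> carrier R" using xF H(3) Wi(3) mc by blast
    let ?K = "Idl (insert x F \<union> H)"
    have K: "ideal ?K R" and KS: "insert x F \<union> H \<subseteq> ?K" using genideal_ideal[OF c] genideal_self[OF c] by auto
    have xH: "Idl (insert x H) \<subseteq> ?K" using KS by (intro genideal_minimal[OF K]) blast
    have "W \<subseteq> ?K"
    proof
      fix y assume y: "y \<in> W"
      show "y \<in> ?K"
      proof (cases "y \<in> H")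
        case True then show ?thesis using KS by blast
      next
        case False
        have yH: "insert y H \<subseteq> carrier R" using y H(3) Wi(3) mc by blast
        let ?J = "Idl (insert y H)"
        have J: "ideal ?J R" "insert y H \<subseteq> ?J" using genideal_ideal[OF yH] genideal_self[OF yH] by auto
        have "?J \<subseteq> W" using y H(3) by (intro genideal_minimal[OF Wi(1)]) simp
        then have "x \<in> ?J" using max[OF J(1)] J(2) False by blast
        moreover have "y \<in> \<mm>" using y Wi(3) by blast
        ultimately have "y \<in> Idl (insert x H)" using genideal_exchange[OF H(1,2)] H(4) by blast
        then show ?thesis using xH by blast
      qed
    qed
    then have "Idl (F \<union> W) \<subseteq> ?K" using KS by (intro genideal_minimal[OF K]) simp
    then have m: "\<mm> \<subseteq> ?K" using F(3) by simp
    have "H \<subseteq> \<mm>" using H(3) Wi(3) by simp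
    then have "H \<in> C" unfolding C_def using H(1,2) m xF F(1)
      by (intro CollectI conjI exI[of _ "insert x F"]) simp_all
    then have "H = W" using min H(3) by blast
    then show False using x H by blast
  qed
  then have "Idl F = \<mm>" using genideal_eq_max_ideal[OF F(2)] F(3) by simp
  then show ?thesis using F by blast
qed

lemma emb_dim_le:
  assumes "finite A" "A \<subseteq> carrier R" "Idl A = \<mm>" shows "emb_dim R \<le> card A"
  unfolding emb_dim_def using assms by (intro Least_le exI[of _ A]) auto

lemma emb_dim_attained: "\<exists>A. finite A \<and> A \<subseteq> \<mm> \<and> card A = emb_dim R \<and> Idl A = \<mm>"
proof -
  let ?P = "\<lambda>n. \<exists>A\<subseteq>carrier R. finite A \<and> card A = n \<and> Idl A = \<mm>"
  obtain A where A: "finite A" "A \<subseteq> \<mm>" "Idl A = \<mm>" using max_ideal_finitely_generated by blast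
  then have "?P (card A)" using ideal_subset[OF max_ideal_ideal] by blast
  then have "?P (LEAST n. ?P n)" by (rule LeastI)
  then obtain B where B: "B \<subseteq> carrier R" "finite B" "card B = emb_dim R" "Idl B = \<mm>"
    unfolding emb_dim_def by blast
  then show ?thesis using genideal_self[OF B(1)] by auto
qed

text \<open>
  By Nakayama's lemma, fewer than \<open>emb_dim R\<close> elements together with \<open>\<mm>\<^sup>2\<close> never generate \<open>\<mm>\<close>. Hence
  as many elements can be chosen one after the other outside the ideal generated so far.
\<close>

lemma emb_dim_chain:
  "\<exists>I :: nat \<Rightarrow> 'a set. (\<forall>i. ideal (I i) R \<and> \<mm> \<cdot> \<mm> \<subseteq> I i \<and> I i \<subseteq> \<mm>) \<and>
    (\<forall>i < emb_dim R. I i \<subset> I (Suc i))"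
proof -
  note mi = max_ideal_ideal and mc = ideal_subset[OF max_ideal_ideal] and sq = max_ideal_square
  define V where "V x i = Idl (x ` {..<i} \<union> \<mm> \<cdot> \<mm>)" for x :: "nat \<Rightarrow> 'a" and i
  have "\<exists>x. (\<forall>i. x i \<in> \<mm>) \<and> (\<forall>i<n. x i \<notin> V x i)" if "n \<le> emb_dim R" for n
    using that
  proof (induction n)
    case 0
    show ?case using ideal_zero_mem[OF mi] by (intro exI[of _ "\<lambda>_. \<zero>"]) simp
  next
    case (Suc n)
    then obtain x where x: "\<And>i. x i \<in> \<mm>" "\<And>i. i < n \<Longrightarrow> x i \<notin> V x i" by auto
    let ?A = "x ` {..<n}"
    have A: "?A \<subseteq> \<mm>" using x by blast
    have "card ?A < emb_dim R" using card_image_le[of "{..<n}" x] Suc.prems by simp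
    then have "Idl ?A \<noteq> \<mm>" using emb_dim_le[of ?A] A mc by force
    then obtain y where y: "y \<in> \<mm>" "y \<notin> V x n" using genideal_eq_max_ideal[OF A] unfolding V_def by blast
    have V: "V (x(n := y)) i = V x i" if "i \<le> n" for i
    proof -
      have "x(n := y) ` {..<i} = x ` {..<i}" using that by (intro image_cong) auto
      then show ?thesis unfolding V_def by simp
    qed
    have "(x(n := y)) i \<notin> V (x(n := y)) i" if "i < Suc n" for i
    proof (cases "i = n")
      case True then show ?thesis unfolding V[OF that[unfolded less_Suc_eq_le]] using y by simp
    next
      case False then show ?thesis unfolding V[OF that[unfolded less_Suc_eq_le]] using x(2)[of i] that by simp
    qed
    then show ?case using x(1) y(1) by (intro exI[of _ "x(n := y)"]) (simp add: fun_upd_def)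
  qed
  then obtain x where x: "\<And>i. x i \<in> \<mm>" "\<And>i. i < emb_dim R \<Longrightarrow> x i \<notin> V x i" by blast
  have m: "x ` {..<i} \<union> \<mm> \<cdot> \<mm> \<subseteq> \<mm>" for i using x(1) sq(2) by blast
  have c: "x ` {..<i} \<union> \<mm> \<cdot> \<mm> \<subseteq> carrier R" for i using m mc by (rule subset_trans)
  have self: "x ` {..<i} \<union> \<mm> \<cdot> \<mm> \<subseteq> V x i" for i unfolding V_def by (rule genideal_self[OF c])
  show ?thesis
  proof (intro exI[of _ "V x"] conjI allI impI)
    show "ideal (V x i) R" for i unfolding V_def by (rule genideal_ideal[OF c])
    show "\<mm> \<cdot> \<mm> \<subseteq> V x i" for i using self by blast
    show "V x i \<subseteq> \<mm>" for i unfolding V_def by (rule genideal_minimal[OF mi m])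
    fix i assume i: "i < emb_dim R"
    have "x i \<in> V x (Suc i)" using self[of "Suc i"] by (auto simp: lessThan_Suc)
    moreover have "V x i \<subseteq> V x (Suc i)" unfolding V_def by (rule subset_Idl_subset[OF c]) auto
    ultimately show "V x i \<subset> V x (Suc i)" using x(2)[OF i] by blast
  qed
qed

end



section \<open>Residue maps and quotients by the annihilator of an element\<close>

context local_ring
begin

lemma residue_map_hom:
  assumes "residue_map R k \<pi>" shows "ring_hom_cring R k \<pi>"
proof -
  interpret k: field k using assms by (simp add: residue_map_def)
  show ?thesis by unfold_locales (use assms in \<open>simp add: residue_map_def\<close>)
qed

lemma residue_map_eq_zero_iff:
  assumes "residue_map R k \<pi>" "r \<in> carrier R"
  shows "\<pi> r = \<zero>\<^bsub>k\<^esub> \<longleftrightarrow> r \<in> max_ideal R"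
proof -
  have "a_kernel R k \<pi> = max_ideal R" using assms(1) by (simp add: residue_map_def)
  then show ?thesis using assms(2) by (auto simp: a_kernel_def')
qed

lemma residue_map_eq_iff:
  assumes res: "residue_map R k \<pi>" and ab: "a \<in> carrier R" "b \<in> carrier R"
  shows "\<pi> a = \<pi> b \<longleftrightarrow> a \<ominus> b \<in> max_ideal R"
proof -
  interpret h: ring_hom_cring R k \<pi> by (rule residue_map_hom[OF res])
  have "\<pi> (a \<ominus> b) = \<pi> a \<ominus>\<^bsub>k\<^esub> \<pi> b" using ab by (simp add: a_minus_def)
  then show ?thesis using residue_map_eq_zero_iff[OF res, of "a \<ominus> b"] ab by simp
qed

end

text \<open>
  \<open>T\<close> is a copy of \<open>R / (0 : g)\<close>. Describing it by a surjection with kernel \<open>(0 : g)\<close> leaves the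
  element type of \<open>T\<close> free. As an \<open>R\<close>-module it is isomorphic to the ideal \<open>g R\<close>, and all properties
  of \<open>T\<close> are read off from multiplication by \<open>g\<close>.
\<close>

locale annihilator_quotient = gorenstein_artin_local_ring R + T: cring T
  for R (structure) and T +
  fixes g \<alpha>
  assumes g: "g \<in> carrier R" "g \<noteq> \<zero>"
    and hom: "\<alpha> \<in> ring_hom R T" and surj: "\<alpha> ` carrier R = carrier T"
    and kernel: "\<And>r. r \<in> carrier R \<Longrightarrow> \<alpha> r = \<zero>\<^bsub>T\<^esub> \<longleftrightarrow> r \<otimes> g = \<zero>"
begin

sublocale h: ring_hom_cring R T \<alpha>
  by unfold_locales (rule hom)

lemma eq_iff:
  assumes ab: "a \<in> carrier R" "b \<in> carrier R"
  shows "\<alpha> a = \<alpha> b \<longleftrightarrow> a \<otimes> g = b \<otimes> g"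
proof -
  have "\<alpha> (a \<ominus> b) = \<alpha> a \<ominus>\<^bsub>T\<^esub> \<alpha> b" using ab by (simp add: a_minus_def)
  moreover have "(a \<ominus> b) \<otimes> g = a \<otimes> g \<ominus> b \<otimes> g" using ab g by (simp add: a_minus_def l_distr l_minus)
  ultimately show ?thesis using kernel[of "a \<ominus> b"] ab g by simp
qed

lemma obtain_preimage:
  assumes "t \<in> carrier T" obtains r where "r \<in> carrier R" "t = \<alpha> r"
  using assms surj by blast

lemma local_quotient: "local_ring T" and max_ideal_quotient: "max_ideal T = \<alpha> ` \<mm>"
proof -
  have M: "ideal (\<alpha> ` \<mm>) T"
  proof (rule T.ideal_criterion)
    show "\<alpha> ` \<mm> \<subseteq> carrier T" using max_idealD by auto
    show "\<zero>\<^bsub>T\<^esub> \<in> \<alpha> ` \<mm>" using ideal_zero_mem[OF max_ideal_ideal] h.hom_zero by (metis imageI)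
    show "a \<oplus>\<^bsub>T\<^esub> b \<in> \<alpha> ` \<mm>" if ab: "a \<in> \<alpha> ` \<mm>" "b \<in> \<alpha> ` \<mm>" for a b
    proof -
      obtain x y where xy: "x \<in> \<mm>" "y \<in> \<mm>" "a = \<alpha> x" "b = \<alpha> y" using ab by blast
      then have "a \<oplus>\<^bsub>T\<^esub> b = \<alpha> (x \<oplus> y)" using max_idealD by simp
      then show ?thesis using ideal_add_mem[OF max_ideal_ideal xy(1,2)] by blast
    qed
    show "c \<otimes>\<^bsub>T\<^esub> a \<in> \<alpha> ` \<mm>" if a: "a \<in> \<alpha> ` \<mm>" and c: "c \<in> carrier T" for a c
    proof -
      obtain x where x: "x \<in> \<mm>" "a = \<alpha> x" using a by blast
      obtain d where d: "d \<in> carrier R" "c = \<alpha> d" using obtain_preimage[OF c] .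
      have "c \<otimes>\<^bsub>T\<^esub> a = \<alpha> (d \<otimes> x)" using x d max_idealD by simp
      then show ?thesis using max_ideal_mult[OF x(1) d(1)] by blast
    qed
  qed
  have one: "\<one>\<^bsub>T\<^esub> \<notin> \<alpha> ` \<mm>"
  proof
    assume "\<one>\<^bsub>T\<^esub> \<in> \<alpha> ` \<mm>"
    then obtain x where x: "x \<in> \<mm>" "\<alpha> \<one> = \<alpha> x" by auto
    then have "g = x \<otimes> g" using eq_iff[of \<one> x] g max_idealD by simp
    then show False using cancel_one_minus[OF x(1) g(1)] g by simp
  qed
  have U: "t \<in> Units T" if t: "t \<in> carrier T" "t \<notin> \<alpha> ` \<mm>" for t
  proof -
    obtain r where r: "r \<in> carrier R" "t = \<alpha> r" using obtain_preimage[OF t(1)] .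
    then have "r \<notin> \<mm>" using t(2) by blast
    then have u: "r \<in> Units R" by (rule Units_outside_max_ideal[OF r(1)])
    have "\<alpha> (inv r) \<otimes>\<^bsub>T\<^esub> t = \<alpha> (inv r \<otimes> r)" "t \<otimes>\<^bsub>T\<^esub> \<alpha> (inv r) = \<alpha> (r \<otimes> inv r)"
      unfolding r(2) by (rule h.hom_mult[symmetric]; use r u in simp)+
    then have "\<alpha> (inv r) \<otimes>\<^bsub>T\<^esub> t = \<one>\<^bsub>T\<^esub>" "t \<otimes>\<^bsub>T\<^esub> \<alpha> (inv r) = \<one>\<^bsub>T\<^esub>" using u by simp_all
    moreover have "\<alpha> (inv r) \<in> carrier T" using u by simp
    ultimately show ?thesis using t(1) unfolding Units_def by blast
  qed
  show "local_ring T" "max_ideal T = \<alpha> ` \<mm>"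
    using local_ring_criterion[OF T.is_cring M one U] by auto
qed

lemma artinian_quotient: "artinian_ring T"
proof unfold_locales
  fix I :: "nat \<Rightarrow> _" assume I: "\<And>n. ideal (I n) T" "\<And>n. I (Suc n) \<subseteq> I n"
  define J where "J n = {r \<in> carrier R. \<alpha> r \<in> I n}" for n
  have img: "I n = \<alpha> ` J n" for n
  proof
    show "I n \<subseteq> \<alpha> ` J n"
    proof
      fix t assume t: "t \<in> I n"
      obtain r where "r \<in> carrier R" "t = \<alpha> r" using obtain_preimage[OF ideal.Icarr[OF I(1) t]] .
      then show "t \<in> \<alpha> ` J n" using t by (auto simp: J_def)
    qed
  qed (auto simp: J_def)
  have "\<exists>n0. \<forall>n\<ge>n0. J n = J n0"
  proof (rule descending_chain_condition)
    show "ideal (J n) R" for n unfolding J_def by (rule h.ring.ideal_vimage[OF I(1)])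
    show "J (Suc n) \<subseteq> J n" for n using I(2) unfolding J_def by blast
  qed
  then show "\<exists>n0. \<forall>n\<ge>n0. I n = I n0" unfolding img by metis
qed

sublocale quot: artinian_local_ring T
  by (rule artinian_local_ring.intro[OF local_quotient artinian_quotient])

text \<open>
  Under the isomorphism with \<open>g R\<close>, the socle of the quotient corresponds to the socle of \<open>R\<close>, which
  is contained in \<open>g R\<close>. This is why the quotient is Gorenstein again.
\<close>

lemma socle_quotient_iff:
  assumes x: "x \<in> carrier R"
  shows "\<alpha> x \<in> socle T \<longleftrightarrow> x \<otimes> g \<in> socle R"
proof -
  have "\<alpha> x \<otimes>\<^bsub>T\<^esub> \<alpha> y = \<zero>\<^bsub>T\<^esub> \<longleftrightarrow> x \<otimes> g \<otimes> y = \<zero>" if "y \<in> \<mm>" for y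
  proof -
    have y: "y \<in> carrier R" using max_idealD that .
    have "x \<otimes> y \<otimes> g = x \<otimes> g \<otimes> y" using x y g by (simp add: m_ac)
    moreover have "\<alpha> x \<otimes>\<^bsub>T\<^esub> \<alpha> y = \<alpha> (x \<otimes> y)" using x y by simp
    ultimately show ?thesis using kernel[of "x \<otimes> y"] x y by simp
  qed
  then show ?thesis unfolding socle_def max_ideal_quotient using x g by auto
qed

lemma gorenstein_quotient: "gorenstein_artin_local_ring T"
proof (rule gorenstein_criterion[OF quot.artinian_local_ring_axioms])
  obtain c where "c \<in> carrier R" "c \<otimes> g \<in> socle R" "c \<otimes> g \<noteq> \<zero>" using exists_multiple_in_socle[OF g] .
  then show "\<exists>a\<in>socle T. a \<noteq> \<zero>\<^bsub>T\<^esub>" using socle_quotient_iff kernel by blast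
next
  fix a b assume ab: "a \<in> socle T" "b \<in> socle T" "b \<noteq> \<zero>\<^bsub>T\<^esub>"
  obtain x where x: "x \<in> carrier R" "a = \<alpha> x" using obtain_preimage[OF quot.socleD[OF ab(1)]] .
  obtain y where y: "y \<in> carrier R" "b = \<alpha> y" using obtain_preimage[OF quot.socleD[OF ab(2)]] .
  have "y \<otimes> g \<noteq> \<zero>" "x \<otimes> g \<in> socle R" using ab x y kernel socle_quotient_iff by auto
  then obtain c where c: "c \<in> carrier R" "x \<otimes> g = c \<otimes> (y \<otimes> g)"
    using socle_subset_principal[of "y \<otimes> g" "x \<otimes> g"] y(1) g(1) by auto
  then have "\<alpha> x = \<alpha> (c \<otimes> y)" using eq_iff[of x "c \<otimes> y"] x y g by (simp add: m_assoc)
  then have "a = \<alpha> c \<otimes>\<^bsub>T\<^esub> b" using x y c by simp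
  then show "\<exists>c\<in>carrier T. a = c \<otimes>\<^bsub>T\<^esub> b" using c(1) h.hom_closed by blast
qed

sublocale quot: gorenstein_artin_local_ring T
  by (rule gorenstein_quotient)

lemma loewy_length_quotient:
  assumes "x \<in> \<mm>" "y \<in> \<mm>" "x \<otimes> y \<otimes> g \<noteq> \<zero>"
  shows "loewy_length T \<ge> 2"
proof -
  have "x \<in> carrier R" "y \<in> carrier R" using assms max_idealD by auto
  then have "\<alpha> x \<otimes>\<^bsub>T\<^esub> \<alpha> y \<noteq> \<zero>\<^bsub>T\<^esub>" using kernel[of "x \<otimes> y"] assms(3) by simp
  then show ?thesis unfolding quot.loewy_length_ge_2_iff max_ideal_quotient using assms by blast
qed

text \<open>
  As \<open>g \<noteq> 0\<close>, the kernel \<open>(0 : g)\<close> contains no unit, so \<open>\<pi>\<close> factors through the quotient.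
\<close>

lemma residue_map_quotient:
  assumes res: "residue_map R k \<pi>"
  shows "\<exists>\<pi>'. residue_map T k \<pi>' \<and> (\<forall>r\<in>carrier R. \<pi>' (\<alpha> r) = \<pi> r)"
proof -
  interpret p: ring_hom_cring R k \<pi> by (rule residue_map_hom[OF res])
  have wd: "\<pi> a = \<pi> b" if ab: "a \<in> carrier R" "b \<in> carrier R" "\<alpha> a = \<alpha> b" for a b
  proof -
    have "(a \<ominus> b) \<otimes> g = a \<otimes> g \<ominus> b \<otimes> g" using ab g by (simp add: a_minus_def l_distr l_minus)
    also have "\<dots> = \<zero>" using eq_iff ab g by simp
    finally have z: "(a \<ominus> b) \<otimes> g = \<zero>" .
    have "a \<ominus> b \<in> \<mm>"
    proof (rule ccontr)
      assume "a \<ominus> b \<notin> \<mm>"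
      then have "a \<ominus> b \<in> Units R" using Units_outside_max_ideal ab by simp
      moreover have "(a \<ominus> b) \<otimes> g = (a \<ominus> b) \<otimes> \<zero>" using z ab by simp
      ultimately show False using Units_l_cancel[of "a \<ominus> b" g \<zero>] g by simp
    qed
    then show ?thesis using residue_map_eq_iff[OF res] ab by simp
  qed
  define \<pi>' where "\<pi>' t = \<pi> (SOME r. r \<in> carrier R \<and> \<alpha> r = t)" for t
  have p': "\<pi>' (\<alpha> r) = \<pi> r" if r: "r \<in> carrier R" for r
  proof -
    have "(SOME x. x \<in> carrier R \<and> \<alpha> x = \<alpha> r) \<in> carrier R \<and> \<alpha> (SOME x. x \<in> carrier R \<and> \<alpha> x = \<alpha> r) = \<alpha> r"
      by (rule someI[of _ r]) (simp add: r)
    then show ?thesis unfolding \<pi>'_def using wd r by blast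
  qed
  have "\<pi>' \<in> ring_hom T k"
  proof (rule ring_hom_memI)
    show "\<pi>' t \<in> carrier k" if t: "t \<in> carrier T" for t
      using obtain_preimage[OF t] p' p.hom_closed by metis
    show "\<pi>' (t \<otimes>\<^bsub>T\<^esub> u) = \<pi>' t \<otimes>\<^bsub>k\<^esub> \<pi>' u" "\<pi>' (t \<oplus>\<^bsub>T\<^esub> u) = \<pi>' t \<oplus>\<^bsub>k\<^esub> \<pi>' u"
      if t: "t \<in> carrier T" and u: "u \<in> carrier T" for t u
    proof -
      obtain r where r: "r \<in> carrier R" "t = \<alpha> r" using obtain_preimage[OF t] .
      obtain s where s: "s \<in> carrier R" "u = \<alpha> s" using obtain_preimage[OF u] .
      show "\<pi>' (t \<otimes>\<^bsub>T\<^esub> u) = \<pi>' t \<otimes>\<^bsub>k\<^esub> \<pi>' u" using p'[of "r \<otimes> s"] p'[of r] p'[of s] r s by simp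
      show "\<pi>' (t \<oplus>\<^bsub>T\<^esub> u) = \<pi>' t \<oplus>\<^bsub>k\<^esub> \<pi>' u" using p'[of "r \<oplus> s"] p'[of r] p'[of s] r s by simp
    qed
    show "\<pi>' \<one>\<^bsub>T\<^esub> = \<one>\<^bsub>k\<^esub>" using p'[of \<one>] by simp
  qed
  moreover have "\<pi>' ` carrier T = carrier k"
  proof -
    have "\<pi>' ` carrier T = \<pi>' ` \<alpha> ` carrier R" by (simp add: surj)
    also have "\<dots> = \<pi> ` carrier R" using p' by (auto simp: image_image)
    also have "\<dots> = carrier k" using res by (simp add: residue_map_def)
    finally show ?thesis .
  qed
  moreover have "a_kernel T k \<pi>' = max_ideal T"
  proof -
    have "\<pi>' t = \<zero>\<^bsub>k\<^esub> \<longleftrightarrow> t \<in> max_ideal T" if t: "t \<in> carrier T" for t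
    proof -
      obtain r where r: "r \<in> carrier R" "t = \<alpha> r" using obtain_preimage[OF t] .
      have "\<pi>' t = \<zero>\<^bsub>k\<^esub> \<longleftrightarrow> r \<in> \<mm>"
        unfolding r(2) p'[OF r(1)] by (rule residue_map_eq_zero_iff[OF res r(1)])
      moreover have "r \<in> \<mm>" if a: "\<alpha> r = \<alpha> s" "s \<in> \<mm>" for s
      proof -
        have "\<pi> r = \<pi> s" using wd[OF r(1) max_idealD[OF a(2)] a(1)] .
        also have "\<dots> = \<zero>\<^bsub>k\<^esub>" using residue_map_eq_zero_iff[OF res max_idealD[OF a(2)]] a(2) by simp
        finally show ?thesis using residue_map_eq_zero_iff[OF res r(1)] by simp
      qed
      ultimately show ?thesis unfolding max_ideal_quotient r(2) by blast
    qed
    then show ?thesis using quot.max_idealD by (auto simp: a_kernel_def')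
  qed
  ultimately have "residue_map T k \<pi>'" using res by (simp add: residue_map_def)
  then show ?thesis using p' by blast
qed

end

text \<open>
  An isomorphism is the quotient map by \<open>(0 : 1)\<close>, so it is known to map the maximal ideal onto the
  maximal ideal.
\<close>

lemma emb_dim_ring_iso:
  assumes "gorenstein_artin_local_ring R" "cring Q" "\<theta> \<in> ring_iso R Q"
  shows "emb_dim Q \<le> emb_dim R"
proof -
  interpret R: gorenstein_artin_local_ring R by fact
  interpret Q0: cring Q by fact
  have hom: "\<theta> \<in> ring_hom R Q" and bij: "bij_betw \<theta> (carrier R) (carrier Q)"
    using assms(3) by (auto simp: ring_iso_def)
  interpret h: ring_hom_cring R Q \<theta> by unfold_locales (rule hom)
  have inj: "inj_on \<theta> (carrier R)" using bij by (rule bij_betw_imp_inj_on)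
  have k: "\<theta> r = \<zero>\<^bsub>Q\<^esub> \<longleftrightarrow> r \<otimes>\<^bsub>R\<^esub> \<one>\<^bsub>R\<^esub> = \<zero>\<^bsub>R\<^esub>" if "r \<in> carrier R" for r
    using inj_onD[OF inj _ that R.zero_closed] that by auto
  have one: "\<one>\<^bsub>R\<^esub> \<noteq> \<zero>\<^bsub>R\<^esub>"
    using R.one_notin_max_ideal R.ideal_zero_mem[OF R.max_ideal_ideal] by metis
  interpret annihilator_quotient R Q "\<one>\<^bsub>R\<^esub>" \<theta>
    by unfold_locales (use k hom bij one in \<open>auto simp: bij_betw_def\<close>)
  obtain A where A: "finite A" "A \<subseteq> max_ideal R" "card A = emb_dim R" "Idl\<^bsub>R\<^esub> A = max_ideal R"
    using R.emb_dim_attained by blast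
  have m: "\<theta> ` A \<subseteq> max_ideal Q" using A(2) by (auto simp: max_ideal_quotient)
  then have c: "\<theta> ` A \<subseteq> carrier Q" using quot.max_idealD by blast
  have K: "ideal (Idl\<^bsub>Q\<^esub> (\<theta> ` A)) Q" "\<theta> ` A \<subseteq> Idl\<^bsub>Q\<^esub> (\<theta> ` A)"
    using Q0.genideal_ideal[OF c] Q0.genideal_self[OF c] by auto
  have "Idl\<^bsub>R\<^esub> A \<subseteq> {r \<in> carrier R. \<theta> r \<in> Idl\<^bsub>Q\<^esub> (\<theta> ` A)}"
    using A(2) K R.max_idealD by (intro R.genideal_minimal h.ring.ideal_vimage) auto
  then have "max_ideal Q \<subseteq> Idl\<^bsub>Q\<^esub> (\<theta> ` A)" unfolding max_ideal_quotient A(4) by blast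
  then have "Idl\<^bsub>Q\<^esub> (\<theta> ` A) = max_ideal Q"
    using Q0.genideal_minimal[OF quot.max_ideal_ideal m] by blast
  then have "emb_dim Q \<le> card (\<theta> ` A)" using quot.emb_dim_le c A(1) by simp
  then show ?thesis using card_image_le[OF A(1), of \<theta>] A(3) by simp
qed



section \<open>Presentations of connected sums\<close>

abbreviation max_ideal_sq :: "('a, 'b) ring_scheme \<Rightarrow> 'a set" where
  "max_ideal_sq R \<equiv> ideal_prod R (max_ideal R) (max_ideal R)"

text \<open>
  The data of an isomorphism of \<open>Q\<close> with a connected sum of \<open>R\<close> and \<open>S\<close>, in the form of the
  surjection from the fibre product onto \<open>Q\<close>. The values of \<open>\<phi>\<close> matter only on pairs with equal
  residues. In this form the notion is visibly symmetric in \<open>R\<close> and \<open>S\<close>, and it passes to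
  quotients.
\<close>

locale connected_sum_presentation =
  R: gorenstein_artin_local_ring R + S: gorenstein_artin_local_ring S +
  Q: gorenstein_artin_local_ring Q
  for R :: "('r, 'c) ring_scheme" and S :: "('s, 'd) ring_scheme" and Q :: "('q, 'a) ring_scheme" +
  fixes k :: "('k, 'b) ring_scheme" and \<pi> :: "'r \<Rightarrow> 'k" and \<rho> :: "'s \<Rightarrow> 'k"
    and \<delta> :: 'r and \<epsilon> :: 's and \<phi> :: "'r \<Rightarrow> 's \<Rightarrow> 'q"
  assumes residue_R: "residue_map R k \<pi>" and residue_S: "residue_map S k \<rho>"
    and loewy_R: "loewy_length R \<ge> 2" and loewy_S: "loewy_length S \<ge> 2"
    and generator_R: "socle_generator R \<delta>" and generator_S: "socle_generator S \<epsilon>"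
    and \<phi>_closed: "\<And>r s. r \<in> carrier R \<Longrightarrow> s \<in> carrier S \<Longrightarrow> \<pi> r = \<rho> s \<Longrightarrow> \<phi> r s \<in> carrier Q"
    and \<phi>_surj: "\<And>q. q \<in> carrier Q \<Longrightarrow> \<exists>r\<in>carrier R. \<exists>s\<in>carrier S. \<pi> r = \<rho> s \<and> q = \<phi> r s"
    and \<phi>_add: "\<And>r s r' s'. r \<in> carrier R \<Longrightarrow> s \<in> carrier S \<Longrightarrow> \<pi> r = \<rho> s \<Longrightarrow>
      r' \<in> carrier R \<Longrightarrow> s' \<in> carrier S \<Longrightarrow> \<pi> r' = \<rho> s' \<Longrightarrow>
      \<phi> (r \<oplus>\<^bsub>R\<^esub> r') (s \<oplus>\<^bsub>S\<^esub> s') = \<phi> r s \<oplus>\<^bsub>Q\<^esub> \<phi> r' s'"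
    and \<phi>_mult: "\<And>r s r' s'. r \<in> carrier R \<Longrightarrow> s \<in> carrier S \<Longrightarrow> \<pi> r = \<rho> s \<Longrightarrow>
      r' \<in> carrier R \<Longrightarrow> s' \<in> carrier S \<Longrightarrow> \<pi> r' = \<rho> s' \<Longrightarrow>
      \<phi> (r \<otimes>\<^bsub>R\<^esub> r') (s \<otimes>\<^bsub>S\<^esub> s') = \<phi> r s \<otimes>\<^bsub>Q\<^esub> \<phi> r' s'"
    and \<phi>_one: "\<phi> \<one>\<^bsub>R\<^esub> \<one>\<^bsub>S\<^esub> = \<one>\<^bsub>Q\<^esub>"
    and \<phi>_zero_iff: "\<And>r s. r \<in> carrier R \<Longrightarrow> s \<in> carrier S \<Longrightarrow> \<pi> r = \<rho> s \<Longrightarrow>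
      \<phi> r s = \<zero>\<^bsub>Q\<^esub> \<longleftrightarrow>
        (\<exists>a\<in>carrier R. \<exists>b\<in>carrier S. \<pi> a = \<rho> b \<and> r = a \<otimes>\<^bsub>R\<^esub> \<delta> \<and> s = \<ominus>\<^bsub>S\<^esub> (b \<otimes>\<^bsub>S\<^esub> \<epsilon>))"
begin

sublocale p: ring_hom_cring R k \<pi> by (rule R.residue_map_hom[OF residue_R])
sublocale q: ring_hom_cring S k \<rho> by (rule S.residue_map_hom[OF residue_S])

lemmas \<pi>_zero_iff = R.residue_map_eq_zero_iff[OF residue_R]
lemmas \<rho>_zero_iff = S.residue_map_eq_zero_iff[OF residue_S]

lemma socle_elements:
  "\<delta> \<in> socle R" "\<delta> \<in> max_ideal_sq R" "\<delta> \<in> max_ideal R" "\<delta> \<in> carrier R" "\<delta> \<noteq> \<zero>\<^bsub>R\<^esub>"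
  "\<epsilon> \<in> socle S" "\<epsilon> \<in> max_ideal_sq S" "\<epsilon> \<in> max_ideal S" "\<epsilon> \<in> carrier S" "\<epsilon> \<noteq> \<zero>\<^bsub>S\<^esub>"
proof -
  show d: "\<delta> \<in> socle R" "\<delta> \<noteq> \<zero>\<^bsub>R\<^esub>" and e: "\<epsilon> \<in> socle S" "\<epsilon> \<noteq> \<zero>\<^bsub>S\<^esub>"
    using R.socle_generatorD[OF generator_R] S.socle_generatorD[OF generator_S] by auto
  then show d2: "\<delta> \<in> max_ideal_sq R" and e2: "\<epsilon> \<in> max_ideal_sq S"
    using R.socle_subset_max_ideal_square[OF loewy_R] S.socle_subset_max_ideal_square[OF loewy_S] by auto
  then show dm: "\<delta> \<in> max_ideal R" and em: "\<epsilon> \<in> max_ideal S"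
    using R.max_ideal_square(2) S.max_ideal_square(2) by auto
  show "\<delta> \<in> carrier R" "\<epsilon> \<in> carrier S" using R.max_idealD[OF dm] S.max_idealD[OF em] by auto
qed

lemma matched: "r \<in> max_ideal R \<Longrightarrow> s \<in> max_ideal S \<Longrightarrow> \<pi> r = \<rho> s"
  using \<pi>_zero_iff \<rho>_zero_iff R.max_idealD S.max_idealD by metis

lemma matched_max_ideal_iff:
  assumes "r \<in> carrier R" "s \<in> carrier S" "\<pi> r = \<rho> s"
  shows "r \<in> max_ideal R \<longleftrightarrow> s \<in> max_ideal S"
  using assms \<pi>_zero_iff \<rho>_zero_iff by metis

lemma obtain_matched:
  assumes "q \<in> carrier Q"
  obtains r s where "r \<in> carrier R" "s \<in> carrier S" "\<pi> r = \<rho> s" "q = \<phi> r s"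
  using \<phi>_surj[OF assms] by metis

lemma obtain_match_right:
  assumes "r \<in> carrier R" obtains s where "s \<in> carrier S" "\<pi> r = \<rho> s"
proof -
  have "\<pi> r \<in> \<rho> ` carrier S" using assms residue_S p.hom_closed by (simp add: residue_map_def)
  then show thesis using that by blast
qed

text \<open>
  The kernel is symmetric because \<open>(a\<delta>, -b\<epsilon>)\<close> is also \<open>(-(a'\<delta>), b'\<epsilon>)\<close> with \<open>a' = -a\<close> and
  \<open>b' = -b\<close>.
\<close>

lemma swap: "connected_sum_presentation S R Q k \<rho> \<pi> \<epsilon> \<delta> (\<lambda>s r. \<phi> r s)"
proof unfold_locales
  fix s r assume sr: "s \<in> carrier S" "r \<in> carrier R" "\<rho> s = \<pi> r"
  have neg: "\<exists>b\<in>carrier S. \<exists>a\<in>carrier R. \<rho> b = \<pi> a \<and> s = b \<otimes>\<^bsub>S\<^esub> \<epsilon> \<and> r = \<ominus>\<^bsub>R\<^esub> (a \<otimes>\<^bsub>R\<^esub> \<delta>)"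
    if ab: "a \<in> carrier R" "b \<in> carrier S" "\<pi> a = \<rho> b" "r = a \<otimes>\<^bsub>R\<^esub> \<delta>" "s = \<ominus>\<^bsub>S\<^esub> (b \<otimes>\<^bsub>S\<^esub> \<epsilon>)" for a b
    using ab socle_elements(4,9)
    by (intro bexI[of _ "\<ominus>\<^bsub>S\<^esub> b"] bexI[of _ "\<ominus>\<^bsub>R\<^esub> a"]) (simp_all add: S.l_minus R.l_minus)
  have neg': "\<exists>a\<in>carrier R. \<exists>b\<in>carrier S. \<pi> a = \<rho> b \<and> r = a \<otimes>\<^bsub>R\<^esub> \<delta> \<and> s = \<ominus>\<^bsub>S\<^esub> (b \<otimes>\<^bsub>S\<^esub> \<epsilon>)"
    if ab: "a \<in> carrier R" "b \<in> carrier S" "\<rho> b = \<pi> a" "s = b \<otimes>\<^bsub>S\<^esub> \<epsilon>" "r = \<ominus>\<^bsub>R\<^esub> (a \<otimes>\<^bsub>R\<^esub> \<delta>)" for a b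
    using ab socle_elements(4,9)
    by (intro bexI[of _ "\<ominus>\<^bsub>R\<^esub> a"] bexI[of _ "\<ominus>\<^bsub>S\<^esub> b"]) (simp_all add: S.l_minus R.l_minus)
  show "\<phi> r s = \<zero>\<^bsub>Q\<^esub> \<longleftrightarrow>
      (\<exists>b\<in>carrier S. \<exists>a\<in>carrier R. \<rho> b = \<pi> a \<and> s = b \<otimes>\<^bsub>S\<^esub> \<epsilon> \<and> r = \<ominus>\<^bsub>R\<^esub> (a \<otimes>\<^bsub>R\<^esub> \<delta>))"
    unfolding \<phi>_zero_iff[OF sr(2,1) sr(3)[symmetric]] using neg neg' by blast
next
  fix q assume "q \<in> carrier Q"
  then show "\<exists>s\<in>carrier S. \<exists>r\<in>carrier R. \<rho> s = \<pi> r \<and> q = \<phi> r s" using \<phi>_surj[of q] by metis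
qed (simp_all add: residue_R residue_S loewy_R loewy_S generator_R generator_S \<phi>_closed \<phi>_add \<phi>_mult \<phi>_one)

lemma \<phi>_zero: "\<phi> \<zero>\<^bsub>R\<^esub> \<zero>\<^bsub>S\<^esub> = \<zero>\<^bsub>Q\<^esub>"
proof -
  have "\<phi> (\<zero>\<^bsub>R\<^esub> \<oplus>\<^bsub>R\<^esub> \<zero>\<^bsub>R\<^esub>) (\<zero>\<^bsub>S\<^esub> \<oplus>\<^bsub>S\<^esub> \<zero>\<^bsub>S\<^esub>) = \<phi> \<zero>\<^bsub>R\<^esub> \<zero>\<^bsub>S\<^esub> \<oplus>\<^bsub>Q\<^esub> \<phi> \<zero>\<^bsub>R\<^esub> \<zero>\<^bsub>S\<^esub>"
    by (rule \<phi>_add) simp_all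
  moreover have "\<phi> \<zero>\<^bsub>R\<^esub> \<zero>\<^bsub>S\<^esub> \<in> carrier Q" by (rule \<phi>_closed) simp_all
  ultimately show ?thesis by (metis Q.add.r_cancel_one Q.r_zero R.r_zero R.zero_closed S.r_zero S.zero_closed)
qed

lemma \<phi>_minus:
  assumes rs: "r \<in> carrier R" "s \<in> carrier S" "\<pi> r = \<rho> s" "r' \<in> carrier R" "s' \<in> carrier S" "\<pi> r' = \<rho> s'"
  shows "\<phi> (r \<ominus>\<^bsub>R\<^esub> r') (s \<ominus>\<^bsub>S\<^esub> s') = \<phi> r s \<ominus>\<^bsub>Q\<^esub> \<phi> r' s'"
proof -
  have m: "\<pi> (\<ominus>\<^bsub>R\<^esub> r') = \<rho> (\<ominus>\<^bsub>S\<^esub> s')" using rs by simp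
  have "\<phi> (\<ominus>\<^bsub>R\<^esub> r') (\<ominus>\<^bsub>S\<^esub> s') \<oplus>\<^bsub>Q\<^esub> \<phi> r' s' = \<phi> (\<ominus>\<^bsub>R\<^esub> r' \<oplus>\<^bsub>R\<^esub> r') (\<ominus>\<^bsub>S\<^esub> s' \<oplus>\<^bsub>S\<^esub> s')"
    by (rule \<phi>_add[symmetric]) (use rs m in simp_all)
  also have "\<dots> = \<zero>\<^bsub>Q\<^esub>" using rs \<phi>_zero by (simp add: R.l_neg S.l_neg)
  finally have "\<ominus>\<^bsub>Q\<^esub> \<phi> r' s' = \<phi> (\<ominus>\<^bsub>R\<^esub> r') (\<ominus>\<^bsub>S\<^esub> s')"
    by (rule Q.minus_equality) (use rs m in \<open>auto intro: \<phi>_closed\<close>)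
  then show ?thesis unfolding a_minus_def using \<phi>_add[OF rs(1-3) _ _ m] rs by simp
qed

lemma \<phi>_eqD:
  assumes rs: "r \<in> carrier R" "s \<in> carrier S" "\<pi> r = \<rho> s" "r' \<in> carrier R" "s' \<in> carrier S" "\<pi> r' = \<rho> s'"
    and eq: "\<phi> r s = \<phi> r' s'"
  obtains a b where "a \<in> carrier R" "b \<in> carrier S" "\<pi> a = \<rho> b"
    "r \<ominus>\<^bsub>R\<^esub> r' = a \<otimes>\<^bsub>R\<^esub> \<delta>" "s \<ominus>\<^bsub>S\<^esub> s' = \<ominus>\<^bsub>S\<^esub> (b \<otimes>\<^bsub>S\<^esub> \<epsilon>)"
proof -
  have m: "\<pi> (r \<ominus>\<^bsub>R\<^esub> r') = \<rho> (s \<ominus>\<^bsub>S\<^esub> s')" using rs by (simp add: a_minus_def)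
  have "\<phi> (r \<ominus>\<^bsub>R\<^esub> r') (s \<ominus>\<^bsub>S\<^esub> s') = \<zero>\<^bsub>Q\<^esub>"
    unfolding \<phi>_minus[OF rs] eq using \<phi>_closed[OF rs(4-6)] by simp
  then show thesis using \<phi>_zero_iff[OF _ _ m] rs that by auto
qed

text \<open>
  If \<open>(r, s)\<close> is a pair with equal residues, then \<open>r\<close> and \<open>s\<close> are both units or both in the
  maximal ideals. In the first case the inverses again have equal residues.
\<close>

lemma max_ideal_eq: "max_ideal Q = {\<phi> r s | r s. r \<in> max_ideal R \<and> s \<in> max_ideal S}" (is "_ = ?M")
proof (rule local_ring_criterion(2)[OF Q.is_cring])
  note Rm = R.max_idealD and Sm = S.max_idealD
  show "ideal ?M Q"
  proof (rule Q.ideal_criterion)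
    show "?M \<subseteq> carrier Q" using \<phi>_closed matched Rm Sm by blast
    show "\<zero>\<^bsub>Q\<^esub> \<in> ?M"
      using \<phi>_zero R.ideal_zero_mem[OF R.max_ideal_ideal] S.ideal_zero_mem[OF S.max_ideal_ideal] by force
  next
    fix x y assume "x \<in> ?M" "y \<in> ?M"
    then obtain r s r' s' where x: "x = \<phi> r s" "r \<in> max_ideal R" "s \<in> max_ideal S"
      and y: "y = \<phi> r' s'" "r' \<in> max_ideal R" "s' \<in> max_ideal S" by blast
    have "x \<oplus>\<^bsub>Q\<^esub> y = \<phi> (r \<oplus>\<^bsub>R\<^esub> r') (s \<oplus>\<^bsub>S\<^esub> s')"
      unfolding x(1) y(1) by (rule \<phi>_add[symmetric])
        (use x y matched[OF x(2,3)] matched[OF y(2,3)] in \<open>simp_all add: Rm Sm\<close>)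
    then show "x \<oplus>\<^bsub>Q\<^esub> y \<in> ?M"
      using x y R.ideal_add_mem[OF R.max_ideal_ideal] S.ideal_add_mem[OF S.max_ideal_ideal] by blast
  next
    fix x c assume "x \<in> ?M" "c \<in> carrier Q"
    then obtain r s a b where x: "x = \<phi> r s" "r \<in> max_ideal R" "s \<in> max_ideal S"
      and c: "c = \<phi> a b" "a \<in> carrier R" "b \<in> carrier S" "\<pi> a = \<rho> b" using \<phi>_surj by blast
    have "c \<otimes>\<^bsub>Q\<^esub> x = \<phi> (a \<otimes>\<^bsub>R\<^esub> r) (b \<otimes>\<^bsub>S\<^esub> s)"
      unfolding x(1) c(1) by (rule \<phi>_mult[symmetric])
        (use x c matched[OF x(2,3)] in \<open>simp_all add: Rm Sm\<close>)
    then show "c \<otimes>\<^bsub>Q\<^esub> x \<in> ?M" using x c R.max_ideal_mult S.max_ideal_mult by blast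
  qed
  show "\<one>\<^bsub>Q\<^esub> \<notin> ?M"
  proof
    assume "\<one>\<^bsub>Q\<^esub> \<in> ?M"
    then obtain r s where x: "\<phi> \<one>\<^bsub>R\<^esub> \<one>\<^bsub>S\<^esub> = \<phi> r s" "r \<in> max_ideal R" "s \<in> max_ideal S"
      using \<phi>_one by auto
    then obtain a where "a \<in> carrier R" "\<one>\<^bsub>R\<^esub> \<ominus>\<^bsub>R\<^esub> r = a \<otimes>\<^bsub>R\<^esub> \<delta>"
      using \<phi>_eqD[of "\<one>\<^bsub>R\<^esub>" "\<one>\<^bsub>S\<^esub>" r s] Rm Sm matched by (metis R.one_closed S.one_closed p.hom_one q.hom_one)
    then have "\<one>\<^bsub>R\<^esub> \<ominus>\<^bsub>R\<^esub> r \<in> max_ideal R" using R.max_ideal_mult[OF socle_elements(3)] by simp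
    then have "(\<one>\<^bsub>R\<^esub> \<ominus>\<^bsub>R\<^esub> r) \<oplus>\<^bsub>R\<^esub> r \<in> max_ideal R" using R.ideal_add_mem[OF R.max_ideal_ideal] x by blast
    then show False using R.one_notin_max_ideal Rm[OF x(2)] by (simp add: a_minus_def R.a_assoc R.l_neg)
  qed
  fix x assume x: "x \<in> carrier Q" "x \<notin> ?M"
  obtain r s where rs: "r \<in> carrier R" "s \<in> carrier S" "\<pi> r = \<rho> s" "x = \<phi> r s"
    using obtain_matched[OF x(1)] .
  then have "r \<notin> max_ideal R" "s \<notin> max_ideal S" using x(2) matched_max_ideal_iff by blast+
  then have u: "r \<in> Units R" "s \<in> Units S"
    using R.Units_outside_max_ideal[OF rs(1)] S.Units_outside_max_ideal[OF rs(2)] by auto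
  have c: "inv\<^bsub>R\<^esub> r \<in> carrier R" "inv\<^bsub>S\<^esub> s \<in> carrier S" using u by auto
  have m: "\<pi> (inv\<^bsub>R\<^esub> r) = \<rho> (inv\<^bsub>S\<^esub> s)"
  proof (rule p.S.inv_unique)
    have "\<pi> (inv\<^bsub>R\<^esub> r) \<otimes>\<^bsub>k\<^esub> \<rho> s = \<pi> (inv\<^bsub>R\<^esub> r \<otimes>\<^bsub>R\<^esub> r)" using rs c by simp
    then show "\<pi> (inv\<^bsub>R\<^esub> r) \<otimes>\<^bsub>k\<^esub> \<rho> s = \<one>\<^bsub>k\<^esub>" using u(1) by simp
    have "\<rho> s \<otimes>\<^bsub>k\<^esub> \<rho> (inv\<^bsub>S\<^esub> s) = \<rho> (s \<otimes>\<^bsub>S\<^esub> inv\<^bsub>S\<^esub> s)" using rs c by simp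
    then show "\<rho> s \<otimes>\<^bsub>k\<^esub> \<rho> (inv\<^bsub>S\<^esub> s) = \<one>\<^bsub>k\<^esub>" using u(2) by simp
  qed (use rs c in simp_all)
  have "\<phi> (inv\<^bsub>R\<^esub> r) (inv\<^bsub>S\<^esub> s) \<otimes>\<^bsub>Q\<^esub> x = \<one>\<^bsub>Q\<^esub>"
    using \<phi>_mult[OF c m rs(1-3)] u \<phi>_one rs(4) by simp
  moreover have "\<phi> (inv\<^bsub>R\<^esub> r) (inv\<^bsub>S\<^esub> s) \<in> carrier Q" by (rule \<phi>_closed[OF c m])
  ultimately show "x \<in> Units Q" using x(1) Q.m_comm unfolding Units_def by force
qed

text \<open>
  The preimage of \<open>I\<close> under the projection of \<open>\<mm>\<^sub>Q\<close> to \<open>\<mm>\<^sub>R / soc R\<close>, for an ideal \<open>I\<close> between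
  \<open>\<mm>\<^sub>R\<^sup>2\<close> and \<open>\<mm>\<^sub>R\<close>. It carries chains of ideals from \<open>\<mm>\<^sub>R / \<mm>\<^sub>R\<^sup>2\<close> to \<open>\<mm>\<^sub>Q / \<mm>\<^sub>Q\<^sup>2\<close>.
\<close>

definition spread :: "'r set \<Rightarrow> 'q set" where
  "spread I = {\<phi> r s | r s. r \<in> I \<and> s \<in> max_ideal S}"

context
  fixes I assumes I: "ideal I R" "max_ideal_sq R \<subseteq> I" "I \<subseteq> max_ideal R"
begin

text \<open>
  The representative \<open>r\<close> of an element of \<open>\<mm>\<^sub>Q\<close> is determined up to the socle of \<open>R\<close>, which lies in
  \<open>\<mm>\<^sub>R\<^sup>2 \<subseteq> I\<close>.
\<close>

lemma spread_mem_iff: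
  assumes rs: "r \<in> max_ideal R" "s \<in> max_ideal S"
  shows "\<phi> r s \<in> spread I \<longleftrightarrow> r \<in> I"
proof
  assume "\<phi> r s \<in> spread I"
  then obtain r' s' where e: "\<phi> r s = \<phi> r' s'" "r' \<in> I" "s' \<in> max_ideal S" by (auto simp: spread_def)
  have r': "r' \<in> max_ideal R" using e I by blast
  obtain a where a: "a \<in> carrier R" "r \<ominus>\<^bsub>R\<^esub> r' = a \<otimes>\<^bsub>R\<^esub> \<delta>"
    using \<phi>_eqD[OF R.max_idealD[OF rs(1)] S.max_idealD[OF rs(2)] matched[OF rs]
        R.max_idealD[OF r'] S.max_idealD[OF e(3)] matched[OF r' e(3)] e(1)] by metis
  have "a \<otimes>\<^bsub>R\<^esub> \<delta> \<in> I" using ideal.I_l_closed[OF I(1) _ a(1)] socle_elements(2) I(2) by blast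
  then have "(r \<ominus>\<^bsub>R\<^esub> r') \<oplus>\<^bsub>R\<^esub> r' \<in> I" using a e R.ideal_add_mem[OF I(1)] by simp
  then show "r \<in> I" using R.max_idealD[OF rs(1)] R.max_idealD[OF r'] by (simp add: a_minus_def R.a_assoc R.l_neg)
qed (use rs in \<open>auto simp: spread_def\<close>)

lemma spread_ideal: "ideal (spread I) Q"
proof (rule Q.ideal_criterion)
  have Rm: "r \<in> carrier R" "r \<in> max_ideal R" if "r \<in> I" for r using that I R.max_idealD by auto
  note Sm = S.max_idealD
  show "spread I \<subseteq> carrier Q" unfolding spread_def using \<phi>_closed matched Rm Sm by blast
  show "\<zero>\<^bsub>Q\<^esub> \<in> spread I"
    using \<phi>_zero R.ideal_zero_mem[OF I(1)] S.ideal_zero_mem[OF S.max_ideal_ideal] unfolding spread_def by force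
  fix x assume "x \<in> spread I"
  then obtain r s where x: "x = \<phi> r s" "r \<in> I" "s \<in> max_ideal S" by (auto simp: spread_def)
  show "x \<oplus>\<^bsub>Q\<^esub> y \<in> spread I" if y0: "y \<in> spread I" for y
  proof -
    obtain r' s' where y: "y = \<phi> r' s'" "r' \<in> I" "s' \<in> max_ideal S" using y0 by (auto simp: spread_def)
    have "x \<oplus>\<^bsub>Q\<^esub> y = \<phi> (r \<oplus>\<^bsub>R\<^esub> r') (s \<oplus>\<^bsub>S\<^esub> s')"
      unfolding x(1) y(1) by (rule \<phi>_add[symmetric])
        (use x y matched[OF Rm(2)[OF x(2)] x(3)] matched[OF Rm(2)[OF y(2)] y(3)] in \<open>simp_all add: Rm Sm\<close>)
    then show ?thesis
      using x y R.ideal_add_mem[OF I(1)] S.ideal_add_mem[OF S.max_ideal_ideal] unfolding spread_def by blast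
  qed
  show "c \<otimes>\<^bsub>Q\<^esub> x \<in> spread I" if c0: "c \<in> carrier Q" for c
  proof -
    obtain a b where c: "a \<in> carrier R" "b \<in> carrier S" "\<pi> a = \<rho> b" "c = \<phi> a b" using obtain_matched[OF c0] .
    have "c \<otimes>\<^bsub>Q\<^esub> x = \<phi> (a \<otimes>\<^bsub>R\<^esub> r) (b \<otimes>\<^bsub>S\<^esub> s)"
      unfolding x(1) c(4) by (rule \<phi>_mult[symmetric])
        (use x c matched[OF Rm(2)[OF x(2)] x(3)] in \<open>simp_all add: Rm Sm\<close>)
    then show ?thesis
      using ideal.I_l_closed[OF I(1) x(2) c(1)] S.max_ideal_mult[OF x(3) c(2)] unfolding spread_def by blast
  qed
qed

lemma max_ideal_sq_subset_spread: "max_ideal_sq Q \<subseteq> spread I"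
proof (rule Q.ideal_prod_least[OF spread_ideal])
  fix x y assume "x \<in> max_ideal Q" "y \<in> max_ideal Q"
  then obtain r s r' s' where x: "x = \<phi> r s" "r \<in> max_ideal R" "s \<in> max_ideal S"
    and y: "y = \<phi> r' s'" "r' \<in> max_ideal R" "s' \<in> max_ideal S" unfolding max_ideal_eq by blast
  have "x \<otimes>\<^bsub>Q\<^esub> y = \<phi> (r \<otimes>\<^bsub>R\<^esub> r') (s \<otimes>\<^bsub>S\<^esub> s')"
    unfolding x(1) y(1) by (rule \<phi>_mult[symmetric])
      (use x y matched[OF x(2,3)] matched[OF y(2,3)] in \<open>simp_all add: R.max_idealD S.max_idealD\<close>)
  moreover have "r \<otimes>\<^bsub>R\<^esub> r' \<in> I" using ideal_prod.prod[OF x(2) y(2), of R] I(2) by blast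
  moreover have "s \<otimes>\<^bsub>S\<^esub> s' \<in> max_ideal S" using S.max_ideal_mult[OF y(3) S.max_idealD[OF x(3)]] .
  ultimately show "x \<otimes>\<^bsub>Q\<^esub> y \<in> spread I" unfolding spread_def by blast
qed

end

lemma max_ideal_sq_proper: "\<exists>r\<in>max_ideal R. r \<notin> max_ideal_sq R"
proof (rule ccontr)
  assume "\<not> ?thesis"
  then have sub: "max_ideal R \<subseteq> max_ideal_sq R" by blast
  have "x \<in> {\<zero>\<^bsub>R\<^esub>} <+>\<^bsub>R\<^esub> max_ideal_sq R" if "x \<in> max_ideal R" for x
    using R.set_add_memI[of "\<zero>\<^bsub>R\<^esub>" "{\<zero>\<^bsub>R\<^esub>}" x "max_ideal_sq R"] subsetD[OF sub that] R.max_idealD[OF that] by simp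
  then have "max_ideal R \<subseteq> {\<zero>\<^bsub>R\<^esub>}" using R.nakayama[OF R.max_ideal_ideal R.zeroideal] by blast
  then show False using socle_elements(3,5) by blast
qed

text \<open>
  Let \<open>A\<close> be a smallest set of generators of \<open>\<mm>\<^sub>Q\<close>, and let \<open>s \<in> \<mm>\<^sub>S\<close> be outside \<open>\<mm>\<^sub>S\<^sup>2\<close>. Then
  \<open>y = \<phi>(0, s)\<close> is outside \<open>\<mm>\<^sub>Q\<^sup>2\<close>, so it can be exchanged for some \<open>j \<in> A\<close>. Since \<open>y\<close> has first
  component \<open>0\<close>, the first components of the elements of \<open>A\<close> other than \<open>j\<close> generate \<open>\<mm>\<^sub>R\<close> modulo
  \<open>\<mm>\<^sub>R\<^sup>2\<close>, hence generate it by Nakayama's lemma.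
\<close>

lemma emb_dim_less: "emb_dim R < emb_dim Q"
proof -
  interpret sw: connected_sum_presentation S R Q k \<rho> \<pi> \<epsilon> \<delta> "\<lambda>s r. \<phi> r s" by (rule swap)
  obtain A where A: "finite A" "A \<subseteq> max_ideal Q" "card A = emb_dim Q" "Idl\<^bsub>Q\<^esub> A = max_ideal Q"
    using Q.emb_dim_attained by blast
  have "\<forall>x\<in>A. \<exists>r s. x = \<phi> r s \<and> r \<in> max_ideal R \<and> s \<in> max_ideal S"
    using A(2) unfolding max_ideal_eq by blast
  then obtain u v where uv: "\<And>x. x \<in> A \<Longrightarrow> x = \<phi> (u x) (v x)"
    "\<And>x. x \<in> A \<Longrightarrow> u x \<in> max_ideal R" "\<And>x. x \<in> A \<Longrightarrow> v x \<in> max_ideal S" by metis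
  have zR: "\<zero>\<^bsub>R\<^esub> \<in> max_ideal R" by (rule R.ideal_zero_mem[OF R.max_ideal_ideal])
  obtain s where s: "s \<in> max_ideal S" "s \<notin> max_ideal_sq S" using sw.max_ideal_sq_proper by blast
  define y where "y = \<phi> \<zero>\<^bsub>R\<^esub> s"
  have ym: "y \<in> max_ideal Q" unfolding y_def max_ideal_eq using zR s by blast
  have y2: "y \<notin> max_ideal_sq Q"
    using sw.max_ideal_sq_subset_spread[OF S.max_ideal_square(1) subset_refl S.max_ideal_square(2)]
      sw.spread_mem_iff[OF S.max_ideal_square(1) subset_refl S.max_ideal_square(2) s(1) zR] s(2)
    unfolding y_def by blast
  note Qc = Q.ideal_subset[OF Q.max_ideal_ideal]
  define G where "G B = Idl\<^bsub>Q\<^esub> (B \<union> max_ideal_sq Q)" for B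
  have Gsub: "B \<union> max_ideal_sq Q \<subseteq> carrier Q" if "B \<subseteq> A" for B
    using that A(2) Q.max_ideal_square(2) Qc by blast
  \<comment> \<open>A minimal subset of \<open>A\<close> that spans \<open>y\<close> modulo \<open>\<mm>\<^sub>Q\<^sup>2\<close> supplies the element \<open>j\<close>.\<close>
  define F where "F = {B. B \<subseteq> A \<and> y \<in> G B}"
  have "y \<in> G A"
    using ym A(4) Q.subset_Idl_subset[OF Gsub[OF subset_refl], of A] unfolding G_def by blast
  then have "F \<noteq> {}" unfolding F_def by blast
  moreover have "finite F" unfolding F_def using A(1) by simp
  ultimately have "\<exists>B\<in>F. \<forall>C\<in>F. C \<subseteq> B \<longrightarrow> B = C" by (intro finite_has_minimal)
  then obtain B where BF: "B \<in> F" "\<forall>C\<in>F. C \<subseteq> B \<longrightarrow> B = C" by (elim bexE)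
  then have B: "B \<subseteq> A" "y \<in> G B" by (simp_all add: F_def)
  have Bmin: "y \<notin> G C" if C: "C \<subset> B" for C
    using BF(2) C B(1) unfolding F_def by blast
  have G0: "G {} = max_ideal_sq Q" unfolding G_def using Q.genideal_of_ideal[OF Q.max_ideal_square(1)] by simp
  have "B \<noteq> {}" using B(2) y2 by (intro notI) (simp add: G0)
  then obtain j where j: "j \<in> B" by blast
  define N where "N = G (B - {j})"
  have BA: "B - {j} \<subseteq> A" using B by blast
  have N: "ideal N Q" "(B - {j}) \<union> max_ideal_sq Q \<subseteq> N"
    unfolding N_def G_def using Q.genideal_ideal[OF Gsub[OF BA]] Q.genideal_self[OF Gsub[OF BA]] by auto
  have yN: "y \<notin> N" unfolding N_def using Bmin[of "B - {j}"] j by blast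
  have jm: "j \<in> max_ideal Q" using j B A by blast
  have "insert j ((B - {j}) \<union> max_ideal_sq Q) = B \<union> max_ideal_sq Q" using j by blast
  then have "Idl\<^bsub>Q\<^esub> (insert j N) = G B"
    unfolding N_def G_def using Q.genideal_insert_genideal[of j "(B - {j}) \<union> max_ideal_sq Q"] Gsub[OF B(1)] by simp
  then have jN: "j \<in> Idl\<^bsub>Q\<^esub> (insert y N)"
    using Q.genideal_exchange[OF N(1) _ jm _ yN] N(2) B(2) by blast
  define U where "U = u ` (A - {j})"
  have U: "U \<subseteq> max_ideal R" "finite U" unfolding U_def using uv A(1) by auto
  define I where "I = Idl\<^bsub>R\<^esub> (U \<union> max_ideal_sq R)"
  have Um: "U \<union> max_ideal_sq R \<subseteq> max_ideal R" using U R.max_ideal_square(2) by blast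
  have Uc: "U \<union> max_ideal_sq R \<subseteq> carrier R" using Um R.max_idealD by blast
  have UI: "U \<union> max_ideal_sq R \<subseteq> I" unfolding I_def by (rule R.genideal_self[OF Uc])
  have I: "ideal I R" "max_ideal_sq R \<subseteq> I" "I \<subseteq> max_ideal R"
    using R.genideal_ideal[OF Uc] UI R.genideal_minimal[OF R.max_ideal_ideal Um] by (auto simp: I_def)
  note sI = spread_ideal[OF I] and miff = spread_mem_iff[OF I]
  have A': "x \<in> spread I" if "x \<in> A - {j}" for x
  proof -
    have x: "x \<in> A" using that by blast
    have "u x \<in> I" using UI that unfolding U_def by blast
    then have "\<phi> (u x) (v x) \<in> spread I" using miff[OF uv(2)[OF x] uv(3)[OF x]] by simp
    then show ?thesis using uv(1)[OF x] by simp
  qed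
  have yI: "y \<in> spread I" unfolding y_def using miff[OF zR s(1)] R.ideal_zero_mem[OF I(1)] by simp
  have "N \<subseteq> spread I" unfolding N_def G_def
    using A' B max_ideal_sq_subset_spread[OF I] by (intro Q.genideal_minimal[OF sI]) blast
  then have "Idl\<^bsub>Q\<^esub> (insert y N) \<subseteq> spread I" using yI by (intro Q.genideal_minimal[OF sI]) blast
  then have "A \<subseteq> spread I" using A' jN by blast
  then have mQ: "max_ideal Q \<subseteq> spread I" using Q.genideal_minimal[OF sI] A(4) by blast
  have "max_ideal R \<subseteq> I"
  proof
    fix r assume r: "r \<in> max_ideal R"
    have zS: "\<zero>\<^bsub>S\<^esub> \<in> max_ideal S" by (rule S.ideal_zero_mem[OF S.max_ideal_ideal])
    have "\<phi> r \<zero>\<^bsub>S\<^esub> \<in> max_ideal Q" unfolding max_ideal_eq using r zS by blast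
    then show "r \<in> I" using mQ miff[OF r zS] by blast
  qed
  then have "Idl\<^bsub>R\<^esub> U = max_ideal R" using R.genideal_eq_max_ideal[OF U(1)] unfolding I_def by blast
  then have "emb_dim R \<le> card U" using R.emb_dim_le[OF U(2)] Uc by simp
  also have "\<dots> \<le> card (A - {j})" unfolding U_def using A(1) by (intro card_image_le) simp
  also have "\<dots> < card A" using A(1) j B(1) by (meson card_Diff1_less subsetD)
  finally show ?thesis using A(3) by simp
qed

lemma not_iso_component: "\<not> R \<simeq> Q"
  using emb_dim_ring_iso[OF R.gorenstein_artin_local_ring_axioms Q.is_cring] emb_dim_less
  unfolding is_ring_iso_def by fastforce

end



section \<open>Length of the annihilator modulo the square of the maximal ideal\<close>

lemma (in cring) annihilator_ideal:
  assumes "f \<in> carrier R" shows "ideal (annihilator R f) R"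
  using assms by (intro ideal_criterion) (auto simp: annihilator_def l_distr m_assoc)

context cring
begin

context
  fixes A N assumes A: "ideal A R" and N: "ideal N R" "N \<subseteq> A"
begin

lemma quotient_module_carrier:
  "carrier (quotient_module (ideal_module R A) N) = (+>) N ` A"
  by (auto simp: quotient_module_def ideal_module_def A_RCOSETS_def' a_r_coset_def')

lemma quotient_module_zero: "\<zero>\<^bsub>quotient_module (ideal_module R A) N\<^esub> = N +> \<zero>"
  using a_rcos_zero[OF N(1) ideal_zero_mem[OF N(1)]] by (simp add: quotient_module_def)

lemma quotient_module_add:
  assumes "x \<in> A" "y \<in> A"
  shows "(N +> x) \<oplus>\<^bsub>quotient_module (ideal_module R A) N\<^esub> (N +> y) = N +> (x \<oplus> y)"
proof -
  have "x \<in> carrier R" "y \<in> carrier R" using assms ideal.Icarr[OF A] by auto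
  then have "(N +> x) <+> (N +> y) = N +> (x \<oplus> y)" by (rule ideal.a_rcos_sum[OF N(1)])
  then show ?thesis by (simp add: quotient_module_def ideal_module_def set_add_def')
qed

lemma quotient_module_smult:
  assumes a: "a \<in> carrier R" and y: "y \<in> A"
  shows "a \<odot>\<^bsub>quotient_module (ideal_module R A) N\<^esub> (N +> y) = N +> (a \<otimes> y)"
proof -
  have yc: "y \<in> carrier R" using y ideal.Icarr[OF A] by blast
  have eq: "N +> (a \<otimes> x) = N +> (a \<otimes> y)" if x: "x \<in> N +> y" for x
  proof -
    obtain n where n: "n \<in> N" "x = n \<oplus> y" using x by (auto simp: a_r_coset_def')
    have nc: "n \<in> carrier R" using ideal.Icarr[OF N(1) n(1)] .
    have "a \<otimes> x \<ominus> a \<otimes> y = a \<otimes> n"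
      using n nc yc a by (simp add: r_distr a_minus_def a_assoc r_neg)
    also have "\<dots> \<in> N" using ideal.I_l_closed[OF N(1) n(1) a] .
    finally show ?thesis
      using quotient_eq_iff_same_a_r_cos[OF N(1), of "a \<otimes> x" "a \<otimes> y"] n nc yc a by simp
  qed
  have "y = \<zero> \<oplus> y" using yc by simp
  then have "y \<in> N +> y" using ideal_zero_mem[OF N(1)] unfolding a_r_coset_def' by blast
  then have "(\<Union>x\<in>N +> y. N +> (a \<otimes> x)) = N +> (a \<otimes> y)" using eq by blast
  then show ?thesis by (simp add: quotient_module_def ideal_module_def a_r_coset_def')
qed

lemma submodule_quotient_module:
  assumes K: "ideal K R" "K \<subseteq> A"
  shows "submodule ((+>) N ` K) R (quotient_module (ideal_module R A) N)"
proof -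
  let ?M = "quotient_module (ideal_module R A) N"
  interpret M: Module.module R ?M
    by (intro quotient_module_is_module ideal_module_is_module is_cring A)
      (use N submodule_ideal_module[OF A] in simp)
  note sub = subsetD[OF K(2)]
  show ?thesis
  proof (rule M.submoduleI)
    show c: "(+>) N ` K \<subseteq> carrier ?M" unfolding quotient_module_carrier using K(2) by blast
    show "\<zero>\<^bsub>?M\<^esub> \<in> (+>) N ` K" unfolding quotient_module_zero using ideal_zero_mem[OF K(1)] by blast
    have sm: "a \<odot>\<^bsub>?M\<^esub> X \<in> (+>) N ` K" if a: "a \<in> carrier R" and X: "X \<in> (+>) N ` K" for a X
      using X quotient_module_smult[OF a sub] ideal.I_l_closed[OF K(1) _ a] by fastforce
    show "a \<odot>\<^bsub>?M\<^esub> X \<in> (+>) N ` K" if "a \<in> carrier R" "X \<in> (+>) N ` K" for a X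
      using sm that .
    show "\<ominus>\<^bsub>?M\<^esub> X \<in> (+>) N ` K" if X: "X \<in> (+>) N ` K" for X
    proof -
      have "X \<in> carrier ?M" using c X by blast
      then have "(\<ominus> \<one>) \<odot>\<^bsub>?M\<^esub> X = \<ominus>\<^bsub>?M\<^esub> X" by (simp add: M.smult_l_minus)
      then show ?thesis using sm[of "\<ominus> \<one>" X] X by simp
    qed
    show "X \<oplus>\<^bsub>?M\<^esub> Y \<in> (+>) N ` K" if X: "X \<in> (+>) N ` K" and Y: "Y \<in> (+>) N ` K" for X Y
    proof -
      obtain x y where xy: "x \<in> K" "y \<in> K" "X = N +> x" "Y = N +> y" using X Y by blast
      have "X \<oplus>\<^bsub>?M\<^esub> Y = N +> (x \<oplus> y)"
        unfolding xy(3,4) by (rule quotient_module_add[OF sub[OF xy(1)] sub[OF xy(2)]])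
      then show ?thesis using ideal_add_mem[OF K(1) xy(1,2)] by blast
    qed
  qed
qed

text \<open>
  Ideals between \<open>N\<close> and \<open>A\<close> can be recovered from the submodules of \<open>A / N\<close> that they induce.
\<close>

lemma quotient_module_length_ge:
  assumes K: "\<And>i. i \<le> n \<Longrightarrow> ideal (K i) R" "\<And>i. i \<le> n \<Longrightarrow> N \<subseteq> K i" "\<And>i. i \<le> n \<Longrightarrow> K i \<subseteq> A"
    and strict: "\<And>i. i < n \<Longrightarrow> K i \<subset> K (Suc i)"
  shows "enat n \<le> module_length R (quotient_module (ideal_module R A) N)"
proof (rule module_length_ge)
  show "submodule ((+>) N ` K i) R (quotient_module (ideal_module R A) N)" if "i \<le> n" for i
    by (rule submodule_quotient_module[OF K(1,3)[OF that]])
next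
  fix i assume i: "i < n"
  then have i': "i \<le> n" "Suc i \<le> n" by auto
  obtain x where x: "x \<in> K (Suc i)" "x \<notin> K i" using strict[OF i] by blast
  have "N +> x \<notin> (+>) N ` K i"
  proof
    assume "N +> x \<in> (+>) N ` K i"
    then obtain y where y: "y \<in> K i" "N +> x = N +> y" by blast
    have c: "x \<in> carrier R" "y \<in> carrier R"
      using ideal.Icarr[OF K(1)[OF i'(2)] x(1)] ideal.Icarr[OF K(1)[OF i'(1)] y(1)] .
    then have "x \<ominus> y \<in> K i" using quotient_eq_iff_same_a_r_cos[OF N(1) c] y(2) K(2)[OF i'(1)] by blast
    then have "(x \<ominus> y) \<oplus> y \<in> K i" using ideal_add_mem[OF K(1)[OF i'(1)]] y(1) by blast
    then show False using x(2) c by (simp add: a_minus_def a_assoc l_neg)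
  qed
  then show "(+>) N ` K i \<subset> (+>) N ` K (Suc i)" using strict[OF i] x(1) by blast
qed

end

end

context connected_sum_presentation
begin

context
  fixes f assumes f: "f \<in> carrier Q"
    and lift: "\<And>r. r \<in> max_ideal R \<Longrightarrow> \<exists>s\<in>max_ideal S. \<phi> r s \<in> annihilator Q f"
begin

text \<open>
  If \<open>(0 : f)\<close> projects onto \<open>\<mm>\<^sub>R\<close>, then so does \<open>A = (0 : f) + \<mm>\<^sub>Q\<^sup>2\<close>, and the preimages in \<open>A\<close> of a
  chain of ideals between \<open>\<mm>\<^sub>R\<^sup>2\<close> and \<open>\<mm>\<^sub>R\<close> stay strictly increasing.
\<close>

lemma emb_dim_le_length: "enat (emb_dim R) \<le> module_length Q (annihilator_mod_square Q f)"
proof -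
  note ann = Q.annihilator_ideal[OF f] and sq = Q.max_ideal_square(1)
  define A where "A = annihilator Q f <+>\<^bsub>Q\<^esub> max_ideal_sq Q"
  have A: "ideal A Q" unfolding A_def by (rule Q.add_ideals[OF ann sq])
  have annA: "annihilator Q f \<subseteq> A"
  proof
    fix x assume x: "x \<in> annihilator Q f"
    show "x \<in> A"
      using Q.set_add_memI[OF x Q.ideal_zero_mem[OF sq]] ideal.Icarr[OF ann x] unfolding A_def by simp
  qed
  have sqA: "max_ideal_sq Q \<subseteq> A"
  proof
    fix x assume x: "x \<in> max_ideal_sq Q"
    show "x \<in> A"
      using Q.set_add_memI[OF Q.ideal_zero_mem[OF ann] x] ideal.Icarr[OF sq x] unfolding A_def by simp
  qed
  obtain I :: "nat \<Rightarrow> 'r set" where I: "\<And>i. ideal (I i) R" "\<And>i. max_ideal_sq R \<subseteq> I i"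
      "\<And>i. I i \<subseteq> max_ideal R"
    and strict: "\<And>i. i < emb_dim R \<Longrightarrow> I i \<subset> I (Suc i)"
    using R.emb_dim_chain by blast
  have "enat (emb_dim R) \<le> module_length Q (quotient_module (ideal_module Q A) (max_ideal_sq Q))"
  proof (rule Q.quotient_module_length_ge[OF A sq sqA, where K = "\<lambda>i. spread (I i) \<inter> A"])
    show "ideal (spread (I i) \<inter> A) Q" for i by (intro Q.i_intersect spread_ideal I A)
    show "max_ideal_sq Q \<subseteq> spread (I i) \<inter> A" for i
      using max_ideal_sq_subset_spread[OF I(1) I(2) I(3)] sqA by blast
    fix i assume i: "i < emb_dim R"
    obtain r where r: "r \<in> I (Suc i)" "r \<notin> I i" using strict[OF i] by blast
    have rm: "r \<in> max_ideal R" using r(1) I(3) by blast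
    obtain s where s: "s \<in> max_ideal S" "\<phi> r s \<in> annihilator Q f" using lift[OF rm] by blast
    have "\<phi> r s \<in> spread (I (Suc i)) \<inter> A" "\<phi> r s \<notin> spread (I i) \<inter> A"
      using spread_mem_iff[OF I(1) I(2) I(3) rm s(1)] r s annA by auto
    moreover have "spread (I i) \<subseteq> spread (I (Suc i))" using strict[OF i] unfolding spread_def by blast
    ultimately show "spread (I i) \<inter> A \<subset> spread (I (Suc i)) \<inter> A" by blast
  qed simp
  then show ?thesis
    unfolding annihilator_mod_square_def Let_def Q.ideal_power_2[OF Q.max_ideal_ideal] A_def .
qed

lemma annihilator_not_in_square: "\<not> annihilator Q f \<subseteq> max_ideal_sq Q"
proof
  note sq = R.max_ideal_square(1) subset_refl R.max_ideal_square(2)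
  assume sub: "annihilator Q f \<subseteq> max_ideal_sq Q"
  obtain r where r: "r \<in> max_ideal R" "r \<notin> max_ideal_sq R" using max_ideal_sq_proper by blast
  obtain s where s: "s \<in> max_ideal S" "\<phi> r s \<in> annihilator Q f" using lift[OF r(1)] by blast
  have "\<phi> r s \<in> spread (max_ideal_sq R)" using s(2) sub max_ideal_sq_subset_spread[OF sq] by blast
  then show False using spread_mem_iff[OF sq r(1) s(1)] r(2) by simp
qed

end

text \<open>
  The hypothesis on \<open>g\<close> puts \<open>r g\<close> into the socle of \<open>R\<close>. The hypothesis on \<open>y\<close> lets \<open>\<mm>\<^sub>S h\<close>
  contain the socle of \<open>S\<close>, so that \<open>r g\<close> can be compensated in the second component.
\<close>

lemma annihilator_lift:
  assumes g: "g \<in> max_ideal R" and h: "h \<in> max_ideal S"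
    and kill: "\<And>x y. x \<in> max_ideal R \<Longrightarrow> y \<in> max_ideal R \<Longrightarrow> x \<otimes>\<^bsub>R\<^esub> y \<otimes>\<^bsub>R\<^esub> g = \<zero>\<^bsub>R\<^esub>"
    and y: "y \<in> max_ideal S" "y \<otimes>\<^bsub>S\<^esub> h \<noteq> \<zero>\<^bsub>S\<^esub>" and r: "r \<in> max_ideal R"
  shows "\<exists>s\<in>max_ideal S. \<phi> r s \<in> annihilator Q (\<phi> g h)"
proof -
  note Rm = R.max_idealD and Sm = S.max_idealD
  have gc: "g \<in> carrier R" "h \<in> carrier S" "r \<in> carrier R" "y \<in> carrier S" using g h r y Rm Sm by auto
  have "r \<otimes>\<^bsub>R\<^esub> g \<otimes>\<^bsub>R\<^esub> x = \<zero>\<^bsub>R\<^esub>" if x: "x \<in> max_ideal R" for x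
  proof -
    have "r \<otimes>\<^bsub>R\<^esub> g \<otimes>\<^bsub>R\<^esub> x = x \<otimes>\<^bsub>R\<^esub> r \<otimes>\<^bsub>R\<^esub> g" using gc Rm[OF x] by (simp add: R.m_ac)
    then show ?thesis using kill[OF x r] by simp
  qed
  then have "r \<otimes>\<^bsub>R\<^esub> g \<in> socle R" using gc by (simp add: socle_def)
  then obtain a where a: "a \<in> carrier R" "r \<otimes>\<^bsub>R\<^esub> g = a \<otimes>\<^bsub>R\<^esub> \<delta>"
    using R.socle_generatorD(3)[OF generator_R] by blast
  obtain z where z: "z \<in> carrier S" "\<epsilon> = z \<otimes>\<^bsub>S\<^esub> (y \<otimes>\<^bsub>S\<^esub> h)"
    using S.socle_subset_principal[OF _ y(2) socle_elements(6)] gc by auto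
  obtain b where b: "b \<in> carrier S" "\<pi> a = \<rho> b" using obtain_match_right[OF a(1)] .
  \<comment> \<open>Chosen such that \<open>s h = -b\<epsilon>\<close>; the factor \<open>y\<close> keeps \<open>s\<close> in the maximal ideal.\<close>
  define s where "s = (\<ominus>\<^bsub>S\<^esub> (b \<otimes>\<^bsub>S\<^esub> z)) \<otimes>\<^bsub>S\<^esub> y"
  have s: "s \<in> max_ideal S" unfolding s_def using b z by (intro S.max_ideal_mult[OF y(1)]) simp
  have sc: "s \<in> carrier S" using Sm[OF s] .
  have sh: "s \<otimes>\<^bsub>S\<^esub> h = \<ominus>\<^bsub>S\<^esub> (b \<otimes>\<^bsub>S\<^esub> \<epsilon>)"
    unfolding s_def z(2) using b z(1) gc by (simp add: S.l_minus S.m_assoc)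
  have m: "\<pi> r = \<rho> s" "\<pi> g = \<rho> h" using matched[OF r s] matched[OF g h] by auto
  have "\<phi> r s \<otimes>\<^bsub>Q\<^esub> \<phi> g h = \<phi> (r \<otimes>\<^bsub>R\<^esub> g) (s \<otimes>\<^bsub>S\<^esub> h)"
    by (rule \<phi>_mult[symmetric]) (use gc sc m in simp_all)
  also have "\<dots> = \<zero>\<^bsub>Q\<^esub>"
  proof -
    have "r \<otimes>\<^bsub>R\<^esub> g \<in> carrier R" "s \<otimes>\<^bsub>S\<^esub> h \<in> carrier S" "\<pi> (r \<otimes>\<^bsub>R\<^esub> g) = \<rho> (s \<otimes>\<^bsub>S\<^esub> h)"
      using gc sc m by simp_all
    from \<phi>_zero_iff[OF this] show ?thesis using a b sh by blast
  qed
  finally have "\<phi> r s \<in> annihilator Q (\<phi> g h)" using \<phi>_closed[OF gc(3) sc m(1)] by (simp add: annihilator_def)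
  then show ?thesis using s by blast
qed

text \<open>
  Either \<open>\<mm>\<^sub>S h\<close> is nonzero and the pairs found above project onto \<open>\<mm>\<^sub>R\<close>, or \<open>\<mm>\<^sub>S h = 0\<close> and the pairs
  \<open>(0, s)\<close> project onto \<open>\<mm>\<^sub>S\<close>.
\<close>

lemma annihilator_large:
  assumes g: "g \<in> max_ideal R" and h: "h \<in> max_ideal S"
    and kill: "\<And>x y. x \<in> max_ideal R \<Longrightarrow> y \<in> max_ideal R \<Longrightarrow> x \<otimes>\<^bsub>R\<^esub> y \<otimes>\<^bsub>R\<^esub> g = \<zero>\<^bsub>R\<^esub>"
  shows "enat (min (emb_dim R) (emb_dim S)) \<le> module_length Q (annihilator_mod_square Q (\<phi> g h))"
    and "\<not> annihilator Q (\<phi> g h) \<subseteq> max_ideal_sq Q"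
proof -
  interpret sw: connected_sum_presentation S R Q k \<rho> \<pi> \<epsilon> \<delta> "\<lambda>s r. \<phi> r s" by (rule swap)
  note gc = R.max_idealD[OF g] and hc = S.max_idealD[OF h] and m = matched[OF g h]
  have f: "\<phi> g h \<in> carrier Q" by (rule \<phi>_closed[OF gc hc m])
  have "enat (min (emb_dim R) (emb_dim S)) \<le> module_length Q (annihilator_mod_square Q (\<phi> g h)) \<and>
    \<not> annihilator Q (\<phi> g h) \<subseteq> max_ideal_sq Q"
  proof (cases "\<exists>y\<in>max_ideal S. y \<otimes>\<^bsub>S\<^esub> h \<noteq> \<zero>\<^bsub>S\<^esub>")
    case True
    then obtain y where y: "y \<in> max_ideal S" "y \<otimes>\<^bsub>S\<^esub> h \<noteq> \<zero>\<^bsub>S\<^esub>" by blast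
    note lift = annihilator_lift[OF g h kill y]
    have "enat (min (emb_dim R) (emb_dim S)) \<le> enat (emb_dim R)" by simp
    also have "\<dots> \<le> module_length Q (annihilator_mod_square Q (\<phi> g h))" by (rule emb_dim_le_length[OF f lift])
    finally show ?thesis using annihilator_not_in_square[OF f lift] by blast
  next
    case False
    have zR: "\<zero>\<^bsub>R\<^esub> \<in> max_ideal R" by (rule R.ideal_zero_mem[OF R.max_ideal_ideal])
    have lift: "\<exists>r\<in>max_ideal R. \<phi> r s \<in> annihilator Q (\<phi> g h)" if s: "s \<in> max_ideal S" for s
    proof -
      note sc = S.max_idealD[OF s] and ms = matched[OF zR s]
      have "\<phi> \<zero>\<^bsub>R\<^esub> s \<otimes>\<^bsub>Q\<^esub> \<phi> g h = \<phi> (\<zero>\<^bsub>R\<^esub> \<otimes>\<^bsub>R\<^esub> g) (s \<otimes>\<^bsub>S\<^esub> h)"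
        by (rule \<phi>_mult[symmetric]) (use gc hc sc m ms in simp_all)
      also have "\<dots> = \<zero>\<^bsub>Q\<^esub>" using False s gc \<phi>_zero by simp
      finally have "\<phi> \<zero>\<^bsub>R\<^esub> s \<in> annihilator Q (\<phi> g h)"
        using \<phi>_closed[OF R.zero_closed sc ms] by (simp add: annihilator_def)
      then show ?thesis using zR by blast
    qed
    have "enat (min (emb_dim R) (emb_dim S)) \<le> enat (emb_dim S)" by simp
    also have "\<dots> \<le> module_length Q (annihilator_mod_square Q (\<phi> g h))" by (rule sw.emb_dim_le_length[OF f lift])
    finally show ?thesis using sw.annihilator_not_in_square[OF f lift] by blast
  qed
  then show "enat (min (emb_dim R) (emb_dim S)) \<le> module_length Q (annihilator_mod_square Q (\<phi> g h))"
    "\<not> annihilator Q (\<phi> g h) \<subseteq> max_ideal_sq Q" by auto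
qed

section \<open>Quotients of connected sums\<close>

text \<open>
  \<open>\<phi>(r, s)\<close> kills \<open>\<phi>(g, h)\<close> if and only if \<open>(r g, s h)\<close> is in the kernel of \<open>\<phi>\<close>. This condition
  depends only on the classes of \<open>r\<close> and \<open>s\<close> modulo \<open>(0 : g)\<close> and \<open>(0 : h)\<close>, and it has the shape of
  the kernel condition for the socle generators \<open>\<alpha> d\<close> and \<open>\<beta> e\<close> of the quotients, where
  \<open>d g = \<delta>\<close> and \<open>e h = \<epsilon>\<close>. The products \<open>x x' g\<close> and \<open>y y' h\<close> witness that the quotients have
  Loewy length at least two.
\<close>

lemma quotient_presentation:
  assumes g: "g \<in> max_ideal R" and h: "h \<in> max_ideal S"
    and x: "x \<in> max_ideal R" "x' \<in> max_ideal R" "x \<otimes>\<^bsub>R\<^esub> x' \<otimes>\<^bsub>R\<^esub> g \<noteq> \<zero>\<^bsub>R\<^esub>"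
    and y: "y \<in> max_ideal S" "y' \<in> max_ideal S" "y \<otimes>\<^bsub>S\<^esub> y' \<otimes>\<^bsub>S\<^esub> h \<noteq> \<zero>\<^bsub>S\<^esub>"
    and T: "annihilator_quotient R T g \<alpha>" and U: "annihilator_quotient S U h \<beta>"
    and V: "annihilator_quotient Q V (\<phi> g h) \<gamma>"
  shows "\<exists>\<pi>' \<rho>' \<delta>' \<epsilon>' \<phi>'. connected_sum_presentation T U V k \<pi>' \<rho>' \<delta>' \<epsilon>' \<phi>'"
proof -
  interpret T: annihilator_quotient R T g \<alpha> by (rule T)
  interpret U: annihilator_quotient S U h \<beta> by (rule U)
  interpret V: annihilator_quotient Q V "\<phi> g h" \<gamma> by (rule V)
  note gc = T.g(1) and hc = U.g(1) and m = matched[OF g h]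
  obtain \<pi>' where \<pi>': "residue_map T k \<pi>'" "\<And>r. r \<in> carrier R \<Longrightarrow> \<pi>' (\<alpha> r) = \<pi> r"
    using T.residue_map_quotient[OF residue_R] by blast
  obtain \<rho>' where \<rho>': "residue_map U k \<rho>'" "\<And>s. s \<in> carrier S \<Longrightarrow> \<rho>' (\<beta> s) = \<rho> s"
    using U.residue_map_quotient[OF residue_S] by blast
  obtain d where d: "d \<in> carrier R" "\<delta> = d \<otimes>\<^bsub>R\<^esub> g"
    using R.socle_subset_principal[OF T.g socle_elements(1)] .
  obtain e where e: "e \<in> carrier S" "\<epsilon> = e \<otimes>\<^bsub>S\<^esub> h"
    using S.socle_subset_principal[OF U.g socle_elements(6)] .
  have gen_T: "socle_generator T (\<alpha> d)"
    using T.socle_quotient_iff[OF d(1)] T.kernel[OF d(1)] d(2) socle_elements(1,5)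
    by (intro T.quot.socle_generatorI) auto
  have gen_U: "socle_generator U (\<beta> e)"
    using U.socle_quotient_iff[OF e(1)] U.kernel[OF e(1)] e(2) socle_elements(6,10)
    by (intro U.quot.socle_generatorI) auto
  define pr where "pr t = (SOME r. r \<in> carrier R \<and> \<alpha> r = t)" for t
  define ps where "ps u = (SOME s. s \<in> carrier S \<and> \<beta> s = u)" for u
  define \<phi>' where "\<phi>' t u = \<gamma> (\<phi> (pr t) (ps u))" for t u
  have mult_f: "\<phi> r s \<otimes>\<^bsub>Q\<^esub> \<phi> g h = \<phi> (r \<otimes>\<^bsub>R\<^esub> g) (s \<otimes>\<^bsub>S\<^esub> h)"
    if "r \<in> carrier R" "s \<in> carrier S" "\<pi> r = \<rho> s" for r s
    by (rule \<phi>_mult[symmetric]) (use that gc hc m in simp_all)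
  have \<phi>': "\<phi>' (\<alpha> r) (\<beta> s) = \<gamma> (\<phi> r s)" if rs: "r \<in> carrier R" "s \<in> carrier S" "\<pi> r = \<rho> s" for r s
  proof -
    have p: "pr (\<alpha> r) \<in> carrier R" "\<alpha> (pr (\<alpha> r)) = \<alpha> r"
      using someI[of "\<lambda>x. x \<in> carrier R \<and> \<alpha> x = \<alpha> r" r] rs by (simp_all add: pr_def)
    have q: "ps (\<beta> s) \<in> carrier S" "\<beta> (ps (\<beta> s)) = \<beta> s"
      using someI[of "\<lambda>x. x \<in> carrier S \<and> \<beta> x = \<beta> s" s] rs by (simp_all add: ps_def)
    have mt: "\<pi> (pr (\<alpha> r)) = \<rho> (ps (\<beta> s))"
      using \<pi>'(2)[OF p(1)] \<rho>'(2)[OF q(1)] \<pi>'(2)[OF rs(1)] \<rho>'(2)[OF rs(2)] p q rs by simp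
    have "\<phi> (pr (\<alpha> r)) (ps (\<beta> s)) \<otimes>\<^bsub>Q\<^esub> \<phi> g h = \<phi> r s \<otimes>\<^bsub>Q\<^esub> \<phi> g h"
      unfolding mult_f[OF p(1) q(1) mt] mult_f[OF rs]
      using T.eq_iff[OF p(1) rs(1)] U.eq_iff[OF q(1) rs(2)] p q by simp
    then show ?thesis unfolding \<phi>'_def using V.eq_iff \<phi>_closed p q mt rs by blast
  qed
  have pre: "\<exists>r s. r \<in> carrier R \<and> s \<in> carrier S \<and> \<pi> r = \<rho> s \<and> t = \<alpha> r \<and> u = \<beta> s"
    if tu: "t \<in> carrier T" "u \<in> carrier U" "\<pi>' t = \<rho>' u" for t u
  proof -
    obtain r where r: "r \<in> carrier R" "t = \<alpha> r" using T.obtain_preimage[OF tu(1)] .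
    obtain s where s: "s \<in> carrier S" "u = \<beta> s" using U.obtain_preimage[OF tu(2)] .
    show ?thesis using r s tu(3) \<pi>'(2) \<rho>'(2) by metis
  qed
  have "connected_sum_presentation T U V k \<pi>' \<rho>' (\<alpha> d) (\<beta> e) \<phi>'"
  proof unfold_locales
    show "2 \<le> loewy_length T" by (rule T.loewy_length_quotient[OF x])
    show "2 \<le> loewy_length U" by (rule U.loewy_length_quotient[OF y])
  next
    fix t u assume tu: "t \<in> carrier T" "u \<in> carrier U" "\<pi>' t = \<rho>' u"
    obtain r s where rs: "r \<in> carrier R" "s \<in> carrier S" "\<pi> r = \<rho> s" "t = \<alpha> r" "u = \<beta> s"
      using pre[OF tu] by blast
    show "\<phi>' t u \<in> carrier V" unfolding rs(4,5) \<phi>'[OF rs(1-3)] by (rule V.h.hom_closed[OF \<phi>_closed[OF rs(1-3)]])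
    have "\<phi>' t u = \<zero>\<^bsub>V\<^esub> \<longleftrightarrow> \<phi> (r \<otimes>\<^bsub>R\<^esub> g) (s \<otimes>\<^bsub>S\<^esub> h) = \<zero>\<^bsub>Q\<^esub>"
      unfolding rs(4,5) \<phi>'[OF rs(1-3)] V.kernel[OF \<phi>_closed[OF rs(1-3)]] mult_f[OF rs(1-3)] ..
    also have "\<dots> \<longleftrightarrow> (\<exists>a\<in>carrier R. \<exists>b\<in>carrier S. \<pi> a = \<rho> b \<and>
        r \<otimes>\<^bsub>R\<^esub> g = a \<otimes>\<^bsub>R\<^esub> \<delta> \<and> s \<otimes>\<^bsub>S\<^esub> h = \<ominus>\<^bsub>S\<^esub> (b \<otimes>\<^bsub>S\<^esub> \<epsilon>))"
      by (rule \<phi>_zero_iff) (use rs gc hc m in simp_all)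
    also have "\<dots> \<longleftrightarrow> (\<exists>a\<in>carrier R. \<exists>b\<in>carrier S. \<pi> a = \<rho> b \<and>
        t = \<alpha> a \<otimes>\<^bsub>T\<^esub> \<alpha> d \<and> u = \<ominus>\<^bsub>U\<^esub> (\<beta> b \<otimes>\<^bsub>U\<^esub> \<beta> e))"
    proof -
      have 1: "r \<otimes>\<^bsub>R\<^esub> g = a \<otimes>\<^bsub>R\<^esub> \<delta> \<longleftrightarrow> t = \<alpha> a \<otimes>\<^bsub>T\<^esub> \<alpha> d" if a: "a \<in> carrier R" for a
        using T.eq_iff[OF rs(1), of "a \<otimes>\<^bsub>R\<^esub> d"] a d gc rs(4) by (simp add: R.m_assoc)
      have 2: "s \<otimes>\<^bsub>S\<^esub> h = \<ominus>\<^bsub>S\<^esub> (b \<otimes>\<^bsub>S\<^esub> \<epsilon>) \<longleftrightarrow> u = \<ominus>\<^bsub>U\<^esub> (\<beta> b \<otimes>\<^bsub>U\<^esub> \<beta> e)" if b: "b \<in> carrier S" for b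
        using U.eq_iff[OF rs(2), of "\<ominus>\<^bsub>S\<^esub> (b \<otimes>\<^bsub>S\<^esub> e)"] b e hc rs(5) by (simp add: S.m_assoc S.l_minus)
      show ?thesis using 1 2 by blast
    qed
    also have "\<dots> \<longleftrightarrow> (\<exists>a\<in>carrier T. \<exists>b\<in>carrier U. \<pi>' a = \<rho>' b \<and>
        t = a \<otimes>\<^bsub>T\<^esub> \<alpha> d \<and> u = \<ominus>\<^bsub>U\<^esub> (b \<otimes>\<^bsub>U\<^esub> \<beta> e))" (is "?l \<longleftrightarrow> ?r")
    proof
      assume ?l
      then obtain a b where "a \<in> carrier R" "b \<in> carrier S" "\<pi> a = \<rho> b"
        "t = \<alpha> a \<otimes>\<^bsub>T\<^esub> \<alpha> d" "u = \<ominus>\<^bsub>U\<^esub> (\<beta> b \<otimes>\<^bsub>U\<^esub> \<beta> e)" by blast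
      then show ?r using \<pi>'(2) \<rho>'(2) by (intro bexI[of _ "\<alpha> a"] bexI[of _ "\<beta> b"]) simp_all
    next
      assume ?r
      then obtain a b where ab: "a \<in> carrier T" "b \<in> carrier U" "\<pi>' a = \<rho>' b"
        "t = a \<otimes>\<^bsub>T\<^esub> \<alpha> d" "u = \<ominus>\<^bsub>U\<^esub> (b \<otimes>\<^bsub>U\<^esub> \<beta> e)" by blast
      then show ?l using pre[OF ab(1-3)] by blast
    qed
    finally show "\<phi>' t u = \<zero>\<^bsub>V\<^esub> \<longleftrightarrow> (\<exists>a\<in>carrier T. \<exists>b\<in>carrier U. \<pi>' a = \<rho>' b \<and>
        t = a \<otimes>\<^bsub>T\<^esub> \<alpha> d \<and> u = \<ominus>\<^bsub>U\<^esub> (b \<otimes>\<^bsub>U\<^esub> \<beta> e))" .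
    fix t' u' assume tu': "t' \<in> carrier T" "u' \<in> carrier U" "\<pi>' t' = \<rho>' u'"
    obtain r' s' where rs': "r' \<in> carrier R" "s' \<in> carrier S" "\<pi> r' = \<rho> s'" "t' = \<alpha> r'" "u' = \<beta> s'"
      using pre[OF tu'] by blast
    note c = \<phi>_closed[OF rs(1-3)] \<phi>_closed[OF rs'(1-3)]
    have "\<phi>' (t \<oplus>\<^bsub>T\<^esub> t') (u \<oplus>\<^bsub>U\<^esub> u') = \<phi>' (\<alpha> (r \<oplus>\<^bsub>R\<^esub> r')) (\<beta> (s \<oplus>\<^bsub>S\<^esub> s'))"
      using rs rs' by simp
    also have "\<dots> = \<gamma> (\<phi> (r \<oplus>\<^bsub>R\<^esub> r') (s \<oplus>\<^bsub>S\<^esub> s'))" by (rule \<phi>') (use rs rs' in simp_all)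
    also have "\<dots> = \<phi>' t u \<oplus>\<^bsub>V\<^esub> \<phi>' t' u'"
      unfolding \<phi>_add[OF rs(1-3) rs'(1-3)] rs(4,5) rs'(4,5) \<phi>'[OF rs(1-3)] \<phi>'[OF rs'(1-3)] using c by simp
    finally show "\<phi>' (t \<oplus>\<^bsub>T\<^esub> t') (u \<oplus>\<^bsub>U\<^esub> u') = \<phi>' t u \<oplus>\<^bsub>V\<^esub> \<phi>' t' u'" .
    have "\<phi>' (t \<otimes>\<^bsub>T\<^esub> t') (u \<otimes>\<^bsub>U\<^esub> u') = \<phi>' (\<alpha> (r \<otimes>\<^bsub>R\<^esub> r')) (\<beta> (s \<otimes>\<^bsub>S\<^esub> s'))"
      using rs rs' by simp
    also have "\<dots> = \<gamma> (\<phi> (r \<otimes>\<^bsub>R\<^esub> r') (s \<otimes>\<^bsub>S\<^esub> s'))" by (rule \<phi>') (use rs rs' in simp_all)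
    also have "\<dots> = \<phi>' t u \<otimes>\<^bsub>V\<^esub> \<phi>' t' u'"
      unfolding \<phi>_mult[OF rs(1-3) rs'(1-3)] rs(4,5) rs'(4,5) \<phi>'[OF rs(1-3)] \<phi>'[OF rs'(1-3)] using c by simp
    finally show "\<phi>' (t \<otimes>\<^bsub>T\<^esub> t') (u \<otimes>\<^bsub>U\<^esub> u') = \<phi>' t u \<otimes>\<^bsub>V\<^esub> \<phi>' t' u'" .
  next
    fix v assume "v \<in> carrier V"
    then obtain q where q: "q \<in> carrier Q" "v = \<gamma> q" using V.obtain_preimage by blast
    obtain r s where rs: "r \<in> carrier R" "s \<in> carrier S" "\<pi> r = \<rho> s" "q = \<phi> r s"
      using obtain_matched[OF q(1)] .
    have "\<alpha> r \<in> carrier T" "\<beta> s \<in> carrier U" "\<pi>' (\<alpha> r) = \<rho>' (\<beta> s)" "v = \<phi>' (\<alpha> r) (\<beta> s)"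
      using rs q \<pi>'(2) \<rho>'(2) \<phi>'[OF rs(1-3)] by simp_all
    then show "\<exists>t\<in>carrier T. \<exists>u\<in>carrier U. \<pi>' t = \<rho>' u \<and> v = \<phi>' t u" by blast
  next
    have "\<phi>' (\<alpha> \<one>\<^bsub>R\<^esub>) (\<beta> \<one>\<^bsub>S\<^esub>) = \<gamma> (\<phi> \<one>\<^bsub>R\<^esub> \<one>\<^bsub>S\<^esub>)" by (rule \<phi>') simp_all
    then show "\<phi>' \<one>\<^bsub>T\<^esub> \<one>\<^bsub>U\<^esub> = \<one>\<^bsub>V\<^esub>" using \<phi>_one by simp
  qed (rule \<pi>' \<rho>' gen_T gen_U)+
  then show ?thesis by blast
qed

end



section \<open>Decomposability of quotients of connected sums\<close>

lemma carrier_fibre_product: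
  "carrier (fibre_product R \<pi> S \<rho>) = {(r, s). r \<in> carrier R \<and> s \<in> carrier S \<and> \<pi> r = \<rho> s}"
  by (simp add: fibre_product_def)

lemma fibre_product_ops:
  "(r, s) \<otimes>\<^bsub>fibre_product R \<pi> S \<rho>\<^esub> (r', s') = (r \<otimes>\<^bsub>R\<^esub> r', s \<otimes>\<^bsub>S\<^esub> s')"
  "(r, s) \<oplus>\<^bsub>fibre_product R \<pi> S \<rho>\<^esub> (r', s') = (r \<oplus>\<^bsub>R\<^esub> r', s \<oplus>\<^bsub>S\<^esub> s')"
  "\<one>\<^bsub>fibre_product R \<pi> S \<rho>\<^esub> = (\<one>\<^bsub>R\<^esub>, \<one>\<^bsub>S\<^esub>)"
  "\<zero>\<^bsub>fibre_product R \<pi> S \<rho>\<^esub> = (\<zero>\<^bsub>R\<^esub>, \<zero>\<^bsub>S\<^esub>)"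
  by (simp_all add: fibre_product_def RDirProd_def DirProd_def monoid.defs)

text \<open>
  \<open>\<delta>\<close> and \<open>\<epsilon>\<close> stand for generators of the socles; since they lie in the maximal ideals, \<open>(\<delta>, 0)\<close> and
  \<open>(0, \<epsilon>)\<close> are elements of the fibre product.
\<close>

locale fibre_product_data = R: local_ring R + S: local_ring S for R (structure) and S +
  fixes k \<pi> \<rho> \<delta> \<epsilon>
  assumes residue_R: "residue_map R k \<pi>" and residue_S: "residue_map S k \<rho>"
    and \<delta>: "\<delta> \<in> max_ideal R" and \<epsilon>: "\<epsilon> \<in> max_ideal S"
begin

abbreviation P where "P \<equiv> fibre_product R \<pi> S \<rho>"

definition amalgamated_ideal where
  "amalgamated_ideal = Idl\<^bsub>P\<^esub> {(\<delta>, \<zero>\<^bsub>S\<^esub>) \<ominus>\<^bsub>P\<^esub> (\<zero>\<^bsub>R\<^esub>, \<epsilon>)}"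

sublocale p: ring_hom_cring R k \<pi> by (rule R.residue_map_hom[OF residue_R])
sublocale q: ring_hom_cring S k \<rho> by (rule S.residue_map_hom[OF residue_S])

lemma cring_P: "cring P"
  using residue_R residue_S R.is_cring S.is_cring
  by (intro fibre_product_is_cring) (auto simp: residue_map_def)

sublocale P: cring P by (rule cring_P)

lemma generator_eq: "(\<delta>, \<zero>\<^bsub>S\<^esub>) \<ominus>\<^bsub>P\<^esub> (\<zero>\<^bsub>R\<^esub>, \<epsilon>) = (\<delta>, \<ominus>\<^bsub>S\<^esub> \<epsilon>)"
    and generator_carrier: "(\<delta>, \<ominus>\<^bsub>S\<^esub> \<epsilon>) \<in> carrier P"
proof -
  have c: "\<delta> \<in> carrier R" "\<epsilon> \<in> carrier S" "\<pi> \<delta> = \<zero>\<^bsub>k\<^esub>" "\<rho> \<epsilon> = \<zero>\<^bsub>k\<^esub>"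
    using \<delta> \<epsilon> R.max_idealD S.max_idealD R.residue_map_eq_zero_iff[OF residue_R]
      S.residue_map_eq_zero_iff[OF residue_S] by auto
  have "\<ominus>\<^bsub>P\<^esub> (\<zero>\<^bsub>R\<^esub>, \<epsilon>) = (\<zero>\<^bsub>R\<^esub>, \<ominus>\<^bsub>S\<^esub> \<epsilon>)"
    by (rule P.minus_equality) (use c in \<open>auto simp: fibre_product_ops carrier_fibre_product S.l_neg\<close>)
  then show "(\<delta>, \<zero>\<^bsub>S\<^esub>) \<ominus>\<^bsub>P\<^esub> (\<zero>\<^bsub>R\<^esub>, \<epsilon>) = (\<delta>, \<ominus>\<^bsub>S\<^esub> \<epsilon>)"
    using c by (simp add: a_minus_def fibre_product_ops)
  show "(\<delta>, \<ominus>\<^bsub>S\<^esub> \<epsilon>) \<in> carrier P" using c by (simp add: carrier_fibre_product)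
qed

lemma amalgamated_ideal_ideal: "ideal amalgamated_ideal P"
  unfolding amalgamated_ideal_def generator_eq using generator_carrier by (intro P.genideal_ideal) simp

lemma mem_amalgamated_ideal_iff:
  "x \<in> amalgamated_ideal \<longleftrightarrow> (\<exists>a\<in>carrier R. \<exists>b\<in>carrier S. \<pi> a = \<rho> b \<and>
    x = (a \<otimes>\<^bsub>R\<^esub> \<delta>, \<ominus>\<^bsub>S\<^esub> (b \<otimes>\<^bsub>S\<^esub> \<epsilon>)))"
proof -
  have e: "\<epsilon> \<in> carrier S" using \<epsilon> S.max_idealD by blast
  have "amalgamated_ideal = PIdl\<^bsub>P\<^esub> (\<delta>, \<ominus>\<^bsub>S\<^esub> \<epsilon>)"
    unfolding amalgamated_ideal_def generator_eq by (rule P.cgenideal_eq_genideal[OF generator_carrier, symmetric])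
  also have "x \<in> \<dots> \<longleftrightarrow> (\<exists>a\<in>carrier R. \<exists>b\<in>carrier S. \<pi> a = \<rho> b \<and> x = (a \<otimes>\<^bsub>R\<^esub> \<delta>, b \<otimes>\<^bsub>S\<^esub> (\<ominus>\<^bsub>S\<^esub> \<epsilon>)))"
    unfolding cgenideal_def carrier_fibre_product by (auto simp: fibre_product_ops)
  also have "\<dots> \<longleftrightarrow> (\<exists>a\<in>carrier R. \<exists>b\<in>carrier S. \<pi> a = \<rho> b \<and> x = (a \<otimes>\<^bsub>R\<^esub> \<delta>, \<ominus>\<^bsub>S\<^esub> (b \<otimes>\<^bsub>S\<^esub> \<epsilon>)))"
    using e by (simp add: S.r_minus cong: bex_cong)
  finally show ?thesis .
qed

lemma connected_sum_eq: "connected_sum R \<pi> \<delta> S \<rho> \<epsilon> = P Quot amalgamated_ideal"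
  by (simp add: connected_sum_def Let_def amalgamated_ideal_def)

end

lemma (in ideal) rcos_eq_ideal_iff:
  assumes "a \<in> carrier R" shows "I +> a = I \<longleftrightarrow> a \<in> I"
  using rcos_const_imp_mem[OF assms] a_rcos_zero[OF is_ideal] by blast

lemma annihilator_quotientI:
  assumes "gorenstein_artin_local_ring R" "g \<in> carrier R" "g \<noteq> \<zero>\<^bsub>R\<^esub>" and T: "ring T"
    and hom: "\<alpha> \<in> ring_hom R T" and surj: "\<alpha> ` carrier R = carrier T"
    and ker: "\<And>r. r \<in> carrier R \<Longrightarrow> \<alpha> r = \<zero>\<^bsub>T\<^esub> \<longleftrightarrow> r \<otimes>\<^bsub>R\<^esub> g = \<zero>\<^bsub>R\<^esub>"
  shows "annihilator_quotient R T g \<alpha>"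
proof -
  interpret R: gorenstein_artin_local_ring R by fact
  interpret T: ring T by fact
  have comm: "x \<otimes>\<^bsub>T\<^esub> y = y \<otimes>\<^bsub>T\<^esub> x" if "x \<in> carrier T" "y \<in> carrier T" for x y
  proof -
    have "x \<in> \<alpha> ` carrier R" "y \<in> \<alpha> ` carrier R" using that by (simp_all add: surj)
    then obtain a b where "a \<in> carrier R" "b \<in> carrier R" "x = \<alpha> a" "y = \<alpha> b" by blast
    then show ?thesis using R.m_comm[of a b] ring_hom_mult[OF hom] by metis
  qed
  interpret T: cring T by unfold_locales (rule comm)
  show ?thesis by unfold_locales (fact assms)+
qed

lemma quotient_by_annihilator:
  assumes "gorenstein_artin_local_ring Q" "f \<in> carrier Q" "f \<noteq> \<zero>\<^bsub>Q\<^esub>"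
  shows "annihilator_quotient Q (Q Quot annihilator Q f) f ((+>\<^bsub>Q\<^esub>) (annihilator Q f))"
proof -
  interpret Q: gorenstein_artin_local_ring Q by fact
  have mem: "r \<in> annihilator Q f \<longleftrightarrow> r \<otimes>\<^bsub>Q\<^esub> f = \<zero>\<^bsub>Q\<^esub>" if "r \<in> carrier Q" for r
    using that by (simp add: annihilator_def)
  interpret I: ideal "annihilator Q f" Q by (rule Q.annihilator_ideal[OF assms(2)])
  have zero: "\<zero>\<^bsub>Q Quot annihilator Q f\<^esub> = annihilator Q f" by (simp add: FactRing_def)
  show ?thesis
  proof (rule annihilator_quotientI[OF assms I.quotient_is_ring I.rcos_ring_hom])
    show "(+>\<^bsub>Q\<^esub>) (annihilator Q f) ` carrier Q = carrier (Q Quot annihilator Q f)"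
      by (simp add: FactRing_def A_RCOSETS_def' UNION_singleton_eq_range)
    show "annihilator Q f +>\<^bsub>Q\<^esub> r = \<zero>\<^bsub>Q Quot annihilator Q f\<^esub> \<longleftrightarrow> r \<otimes>\<^bsub>Q\<^esub> f = \<zero>\<^bsub>Q\<^esub>"
      if "r \<in> carrier Q" for r
      unfolding zero I.rcos_eq_ideal_iff[OF that] by (rule mem[OF that])
  qed
qed

text \<open>
  The presentation is the composition of the projection of the fibre product onto the connected sum
  with the isomorphism to \<open>Q\<close>.
\<close>

lemma presentation_of_decomposable:
  assumes "decomposable_as_connected_sum k Q R S"
  shows "\<exists>\<pi> \<rho> \<delta> \<epsilon> \<phi>. connected_sum_presentation R S Q k \<pi> \<rho> \<delta> \<epsilon> \<phi>"
proof -
  interpret Q: gorenstein_artin_local_ring Q using assms by (simp add: decomposable_as_connected_sum_def)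
  interpret R: gorenstein_artin_local_ring R using assms by (simp add: decomposable_as_connected_sum_def)
  interpret S: gorenstein_artin_local_ring S using assms by (simp add: decomposable_as_connected_sum_def)
  have l: "loewy_length R \<ge> 2" "loewy_length S \<ge> 2" using assms by (auto simp: decomposable_as_connected_sum_def)
  obtain \<pi> \<rho> \<delta> \<epsilon> where res: "residue_map R k \<pi>" "residue_map S k \<rho>"
    and gen: "socle_generator R \<delta>" "socle_generator S \<epsilon>"
    and iso: "Q \<simeq> connected_sum R \<pi> \<delta> S \<rho> \<epsilon>"
    using assms by (auto simp: decomposable_as_connected_sum_def)
  have d: "\<delta> \<in> max_ideal R" "\<epsilon> \<in> max_ideal S"
    using R.socle_generatorD(1)[OF gen(1)] S.socle_generatorD(1)[OF gen(2)]
      R.socle_subset_max_ideal_square[OF l(1)] S.socle_subset_max_ideal_square[OF l(2)]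
      R.max_ideal_square(2) S.max_ideal_square(2) by auto
  interpret F: fibre_product_data R S k \<pi> \<rho> \<delta> \<epsilon> by unfold_locales (fact res d)+
  let ?P = "fibre_product R \<pi> S \<rho>" and ?D = F.amalgamated_ideal
  interpret D: ideal ?D ?P by (rule F.amalgamated_ideal_ideal)
  obtain \<theta> where th: "\<theta> \<in> ring_iso (?P Quot ?D) Q"
    using ring_iso_sym[OF Q.ring_axioms iso] unfolding F.connected_sum_eq is_ring_iso_def by blast
  have bij: "bij_betw \<theta> (carrier (?P Quot ?D)) (carrier Q)" and th': "\<theta> \<in> ring_hom (?P Quot ?D) Q"
    using th by (auto simp: ring_iso_def)
  define \<psi> where "\<psi> = \<theta> \<circ> (+>\<^bsub>?P\<^esub>) ?D"
  have hom: "\<psi> \<in> ring_hom ?P Q" unfolding \<psi>_def by (rule ring_hom_trans[OF D.rcos_ring_hom th'])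
  interpret h: ring_hom_cring ?P Q \<psi> by unfold_locales (rule hom)
  interpret K: ring "?P Quot ?D" by (rule D.quotient_is_ring)
  have \<theta>_zero: "\<theta> \<zero>\<^bsub>?P Quot ?D\<^esub> = \<zero>\<^bsub>Q\<^esub>"
    by (rule ring_hom_zero[OF th' K.ring_axioms Q.ring_axioms])
  have cosets: "carrier (?P Quot ?D) = (+>\<^bsub>?P\<^esub>) ?D ` carrier ?P"
    by (simp add: FactRing_def A_RCOSETS_def' UNION_singleton_eq_range)
  have surj: "\<psi> ` carrier ?P = carrier Q"
    using bij unfolding \<psi>_def bij_betw_def cosets by (simp add: image_comp)
  have ker: "\<psi> x = \<zero>\<^bsub>Q\<^esub> \<longleftrightarrow> x \<in> ?D" if x: "x \<in> carrier ?P" for x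
  proof -
    have c: "?D +>\<^bsub>?P\<^esub> x \<in> carrier (?P Quot ?D)" unfolding cosets using x by blast
    have "\<psi> x = \<zero>\<^bsub>Q\<^esub> \<longleftrightarrow> \<theta> (?D +>\<^bsub>?P\<^esub> x) = \<theta> \<zero>\<^bsub>?P Quot ?D\<^esub>" unfolding \<psi>_def \<theta>_zero by simp
    also have "\<dots> \<longleftrightarrow> ?D +>\<^bsub>?P\<^esub> x = \<zero>\<^bsub>?P Quot ?D\<^esub>"
      using inj_on_eq_iff[OF bij_betw_imp_inj_on[OF bij] c K.zero_closed] .
    also have "\<dots> \<longleftrightarrow> x \<in> ?D" using D.rcos_eq_ideal_iff[OF x] by (simp add: FactRing_def)
    finally show ?thesis .
  qed
  have mem: "(r, s) \<in> carrier ?P" if "r \<in> carrier R" "s \<in> carrier S" "\<pi> r = \<rho> s" for r s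
    using that by (simp add: carrier_fibre_product)
  have "connected_sum_presentation R S Q k \<pi> \<rho> \<delta> \<epsilon> (\<lambda>r s. \<psi> (r, s))"
  proof unfold_locales
    fix r s assume rs: "r \<in> carrier R" "s \<in> carrier S" "\<pi> r = \<rho> s"
    note m = mem[OF rs]
    show "\<psi> (r, s) \<in> carrier Q" using h.hom_closed[OF m] .
    show "\<psi> (r, s) = \<zero>\<^bsub>Q\<^esub> \<longleftrightarrow> (\<exists>a\<in>carrier R. \<exists>b\<in>carrier S. \<pi> a = \<rho> b \<and>
        r = a \<otimes>\<^bsub>R\<^esub> \<delta> \<and> s = \<ominus>\<^bsub>S\<^esub> (b \<otimes>\<^bsub>S\<^esub> \<epsilon>))"
      unfolding ker[OF m] F.mem_amalgamated_ideal_iff by simp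
    fix r' s' assume rs': "r' \<in> carrier R" "s' \<in> carrier S" "\<pi> r' = \<rho> s'"
    note m' = mem[OF rs']
    show "\<psi> (r \<oplus>\<^bsub>R\<^esub> r', s \<oplus>\<^bsub>S\<^esub> s') = \<psi> (r, s) \<oplus>\<^bsub>Q\<^esub> \<psi> (r', s')"
      using h.hom_add[OF m m'] by (simp add: fibre_product_ops)
    show "\<psi> (r \<otimes>\<^bsub>R\<^esub> r', s \<otimes>\<^bsub>S\<^esub> s') = \<psi> (r, s) \<otimes>\<^bsub>Q\<^esub> \<psi> (r', s')"
      using h.hom_mult[OF m m'] by (simp add: fibre_product_ops)
  next
    fix q assume "q \<in> carrier Q"
    then obtain x where "x \<in> carrier ?P" "q = \<psi> x" using surj by blast
    then show "\<exists>r\<in>carrier R. \<exists>s\<in>carrier S. \<pi> r = \<rho> s \<and> q = \<psi> (r, s)"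
      by (auto simp: carrier_fibre_product)
  next
    show "\<psi> (\<one>\<^bsub>R\<^esub>, \<one>\<^bsub>S\<^esub>) = \<one>\<^bsub>Q\<^esub>" using h.hom_one by (simp add: fibre_product_ops)
  qed (fact res gen l)+
  then show ?thesis by blast
qed

context connected_sum_presentation
begin

text \<open>
  The converse passage is the homomorphism theorem. The two non-isomorphisms hold by comparison of
  embedding dimensions, for \<open>S\<close> after exchanging the roles of the summands.
\<close>

lemma decomposable:
  assumes "residue_map Q k \<sigma>" shows "decomposable_as_connected_sum k Q R S"
proof -
  interpret sw: connected_sum_presentation S R Q k \<rho> \<pi> \<epsilon> \<delta> "\<lambda>s r. \<phi> r s" by (rule swap)
  interpret F: fibre_product_data R S k \<pi> \<rho> \<delta> \<epsilon>
    by unfold_locales (fact residue_R residue_S socle_elements)+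
  let ?P = "fibre_product R \<pi> S \<rho>"
  have "(\<lambda>x. \<phi> (fst x) (snd x)) \<in> ring_hom ?P Q"
    by (rule ring_hom_memI)
      (auto simp: carrier_fibre_product fibre_product_ops \<phi>_one intro: \<phi>_closed \<phi>_add \<phi>_mult)
  then interpret h: ring_hom_ring ?P Q "\<lambda>x. \<phi> (fst x) (snd x)"
    by (rule ring_hom_ringI2[OF F.P.ring_axioms Q.ring_axioms])
  have surj: "(\<lambda>x. \<phi> (fst x) (snd x)) ` carrier ?P = carrier Q"
  proof
    show "carrier Q \<subseteq> (\<lambda>x. \<phi> (fst x) (snd x)) ` carrier ?P"
    proof
      fix q assume "q \<in> carrier Q"
      then obtain r s where rs: "r \<in> carrier R" "s \<in> carrier S" "\<pi> r = \<rho> s" "q = \<phi> r s"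
        by (rule obtain_matched)
      then show "q \<in> (\<lambda>x. \<phi> (fst x) (snd x)) ` carrier ?P"
        by (intro image_eqI[of _ _ "(r, s)"]) (simp_all add: carrier_fibre_product)
    qed
  qed (use h.hom_closed in blast)
  have "a_kernel ?P Q (\<lambda>x. \<phi> (fst x) (snd x)) = F.amalgamated_ideal"
  proof -
    have "x \<in> a_kernel ?P Q (\<lambda>x. \<phi> (fst x) (snd x)) \<longleftrightarrow> x \<in> F.amalgamated_ideal" if x: "x \<in> carrier ?P" for x
    proof -
      obtain r s where rs: "x = (r, s)" "r \<in> carrier R" "s \<in> carrier S" "\<pi> r = \<rho> s"
        using x by (auto simp: carrier_fibre_product)
      have "x \<in> a_kernel ?P Q (\<lambda>x. \<phi> (fst x) (snd x)) \<longleftrightarrow> \<phi> (fst x) (snd x) = \<zero>\<^bsub>Q\<^esub>"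
        unfolding a_kernel_def' using x by (simp only: mem_Collect_eq simp_thms)
      then show ?thesis
        unfolding rs(1) fst_conv snd_conv \<phi>_zero_iff[OF rs(2-4)] F.mem_amalgamated_ideal_iff by simp
    qed
    moreover have "F.amalgamated_ideal \<subseteq> carrier ?P" by (rule F.P.ideal_subset[OF F.amalgamated_ideal_ideal])
    moreover have "a_kernel ?P Q (\<lambda>x. \<phi> (fst x) (snd x)) \<subseteq> carrier ?P"
      unfolding a_kernel_def' by (rule Collect_restrict)
    ultimately show ?thesis by (meson subset_antisym subsetI subsetD)
  qed
  then have iso': "connected_sum R \<pi> \<delta> S \<rho> \<epsilon> \<simeq> Q" using h.FactRing_iso[OF surj] F.connected_sum_eq by simp
  have "ring (connected_sum R \<pi> \<delta> S \<rho> \<epsilon>)"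
    unfolding F.connected_sum_eq by (rule ideal.quotient_is_ring[OF F.amalgamated_ideal_ideal])
  then have iso: "Q \<simeq> connected_sum R \<pi> \<delta> S \<rho> \<epsilon>" using iso' by (rule ring_iso_sym)
  have "\<not> Q \<simeq> S" using sw.not_iso_component ring_iso_sym[OF Q.ring_axioms] by blast
  then show ?thesis unfolding decomposable_as_connected_sum_def
    using assms not_iso_component iso residue_R residue_S generator_R generator_S loewy_R loewy_S
      R.gorenstein_artin_local_ring_axioms S.gorenstein_artin_local_ring_axioms
      Q.gorenstein_artin_local_ring_axioms by blast
qed

text \<open>
  A copy of \<open>R / (0 : g)\<close> with sets of elements of \<open>Q\<close> as its elements, which is the element type of
  the quotient rings of \<open>Q\<close>: a class is represented by the set of all \<open>\<phi>(x, y)\<close> with \<open>x\<close> in the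
  class. That set determines the class, since \<open>\<phi>(x, y)\<close> determines \<open>x\<close> up to the socle, and the
  socle is killed by \<open>g \<in> \<mm>\<^sub>R\<close>.
\<close>

lemma component_quotient:
  assumes g: "g \<in> max_ideal R" "g \<noteq> \<zero>\<^bsub>R\<^esub>"
  shows "\<exists>(T :: 'q set ring) \<alpha>. annihilator_quotient R T g \<alpha>"
proof -
  have gc: "g \<in> carrier R" using g R.max_idealD by blast
  define \<alpha> where "\<alpha> r = {\<phi> x y | x y. x \<in> carrier R \<and> y \<in> carrier S \<and> \<pi> x = \<rho> y \<and> x \<otimes>\<^bsub>R\<^esub> g = r \<otimes>\<^bsub>R\<^esub> g}" for r
  have diff: "(a \<ominus>\<^bsub>R\<^esub> b) \<otimes>\<^bsub>R\<^esub> g = \<zero>\<^bsub>R\<^esub> \<longleftrightarrow> a \<otimes>\<^bsub>R\<^esub> g = b \<otimes>\<^bsub>R\<^esub> g"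
    if ab: "a \<in> carrier R" "b \<in> carrier R" for a b
  proof -
    have "(a \<ominus>\<^bsub>R\<^esub> b) \<otimes>\<^bsub>R\<^esub> g = a \<otimes>\<^bsub>R\<^esub> g \<ominus>\<^bsub>R\<^esub> b \<otimes>\<^bsub>R\<^esub> g"
      using ab gc by (simp add: a_minus_def R.l_distr R.l_minus)
    then show ?thesis using ab gc by simp
  qed
  have inj: "\<alpha> a = \<alpha> b \<longleftrightarrow> a \<otimes>\<^bsub>R\<^esub> g = b \<otimes>\<^bsub>R\<^esub> g" if ab: "a \<in> carrier R" "b \<in> carrier R" for a b
  proof
    assume eq: "\<alpha> a = \<alpha> b"
    obtain s where s: "s \<in> carrier S" "\<pi> a = \<rho> s" using obtain_match_right[OF ab(1)] .
    have "\<phi> a s \<in> \<alpha> a" unfolding \<alpha>_def using ab s by blast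
    then have "\<phi> a s \<in> \<alpha> b" using eq by simp
    then obtain x y where xy: "\<phi> a s = \<phi> x y" "x \<in> carrier R" "y \<in> carrier S" "\<pi> x = \<rho> y"
      and xb: "x \<otimes>\<^bsub>R\<^esub> g = b \<otimes>\<^bsub>R\<^esub> g" unfolding \<alpha>_def by blast
    obtain c where c: "c \<in> carrier R" "a \<ominus>\<^bsub>R\<^esub> x = c \<otimes>\<^bsub>R\<^esub> \<delta>"
      using \<phi>_eqD[OF ab(1) s xy(2-4) xy(1)] by metis
    have "(a \<ominus>\<^bsub>R\<^esub> x) \<otimes>\<^bsub>R\<^esub> g = c \<otimes>\<^bsub>R\<^esub> (\<delta> \<otimes>\<^bsub>R\<^esub> g)"
      unfolding c(2) using c(1) socle_elements(4) gc by (rule R.m_assoc)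
    also have "\<dots> = \<zero>\<^bsub>R\<^esub>" using R.socle_mult_zero[OF socle_elements(1) g(1)] c(1) by simp
    finally show "a \<otimes>\<^bsub>R\<^esub> g = b \<otimes>\<^bsub>R\<^esub> g" using diff[OF ab(1) xy(2)] xb by simp
  qed (simp add: \<alpha>_def)
  have weak: "weak_ring_morphism \<alpha> (annihilator R g) R"
    using inj diff R.annihilator_ideal[OF gc] by (intro weak_ring_morphismI) (auto simp: annihilator_def)
  have "annihilator_quotient R (image_ring \<alpha> R) g \<alpha>"
  proof (rule annihilator_quotientI[OF R.gorenstein_artin_local_ring_axioms gc g(2)])
    show "ring (image_ring \<alpha> R)" by (rule R.image_ring_is_ring[OF weak])
    show "\<alpha> \<in> ring_hom R (image_ring \<alpha> R)" by (rule R.weak_ring_morphism_is_hom[OF weak])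
    show "\<alpha> ` carrier R = carrier (image_ring \<alpha> R)" by (simp add: image_ring_carrier)
    show "\<alpha> r = \<zero>\<^bsub>image_ring \<alpha> R\<^esub> \<longleftrightarrow> r \<otimes>\<^bsub>R\<^esub> g = \<zero>\<^bsub>R\<^esub>" if "r \<in> carrier R" for r
      unfolding image_ring_zero inj[OF that R.zero_closed] using gc by simp
  qed
  then show ?thesis by blast
qed

end

theorem proposition4p6:
  fixes Q :: "('q, 'a) ring_scheme" and k :: "('k, 'b) ring_scheme"
    and R :: "('r, 'c) ring_scheme" and S :: "('s, 'd) ring_scheme"
    and f :: 'q and m n :: nat
  assumes "decomposable_as_connected_sum k Q R S"
    and "emb_dim R = m" and "emb_dim S = n"
    and "f \<in> max_ideal Q" and "f \<noteq> \<zero>\<^bsub>Q\<^esub>"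
  shows "(module_length Q (annihilator_mod_square Q f) < enat (min m n) \<longrightarrow>
            decomposable_connected_sum k (Q Quot annihilator Q f)) \<and>
         (annihilator Q f \<subseteq> ideal_power Q (max_ideal Q) 2 \<longrightarrow>
            decomposable_connected_sum k (Q Quot annihilator Q f))"
proof -
  obtain \<pi> \<rho> \<delta> \<epsilon> \<phi> where "connected_sum_presentation R S Q k \<pi> \<rho> \<delta> \<epsilon> \<phi>"
    using presentation_of_decomposable[OF assms(1)] by blast
  then interpret connected_sum_presentation R S Q k \<pi> \<rho> \<delta> \<epsilon> \<phi> .
  interpret sw: connected_sum_presentation S R Q k \<rho> \<pi> \<epsilon> \<delta> "\<lambda>s r. \<phi> r s" by (rule swap)
  let ?V = "Q Quot annihilator Q f"
  have fc: "f \<in> carrier Q" using assms(4) Q.max_idealD by blast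
  obtain \<sigma> where \<sigma>: "residue_map Q k \<sigma>"
    using assms(1) unfolding decomposable_as_connected_sum_def by blast
  obtain g h where gh: "f = \<phi> g h" "g \<in> max_ideal R" "h \<in> max_ideal S"
    using assms(4) unfolding max_ideal_eq by blast
  have V: "annihilator_quotient Q ?V f ((+>\<^bsub>Q\<^esub>) (annihilator Q f))"
    by (rule quotient_by_annihilator[OF Q.gorenstein_artin_local_ring_axioms fc assms(5)])
  have goal: "decomposable_connected_sum k ?V"
    if gR: "\<exists>x\<in>max_ideal R. \<exists>x'\<in>max_ideal R. x \<otimes>\<^bsub>R\<^esub> x' \<otimes>\<^bsub>R\<^esub> g \<noteq> \<zero>\<^bsub>R\<^esub>"
      and hS: "\<exists>y\<in>max_ideal S. \<exists>y'\<in>max_ideal S. y \<otimes>\<^bsub>S\<^esub> y' \<otimes>\<^bsub>S\<^esub> h \<noteq> \<zero>\<^bsub>S\<^esub>"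
  proof -
    obtain x x' where x: "x \<in> max_ideal R" "x' \<in> max_ideal R" "x \<otimes>\<^bsub>R\<^esub> x' \<otimes>\<^bsub>R\<^esub> g \<noteq> \<zero>\<^bsub>R\<^esub>"
      using gR by blast
    obtain y y' where y: "y \<in> max_ideal S" "y' \<in> max_ideal S" "y \<otimes>\<^bsub>S\<^esub> y' \<otimes>\<^bsub>S\<^esub> h \<noteq> \<zero>\<^bsub>S\<^esub>"
      using hS by blast
    have "g \<noteq> \<zero>\<^bsub>R\<^esub>" "h \<noteq> \<zero>\<^bsub>S\<^esub>" using x y R.max_idealD S.max_idealD by auto
    then obtain T \<alpha> U \<beta> where T: "annihilator_quotient R (T :: 'q set ring) g \<alpha>"
      and U: "annihilator_quotient S (U :: 'q set ring) h \<beta>"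
      using component_quotient[OF gh(2)] sw.component_quotient[OF gh(3)] by blast
    interpret V: annihilator_quotient Q ?V f "(+>\<^bsub>Q\<^esub>) (annihilator Q f)" by (rule V)
    obtain \<tau> where \<tau>: "residue_map ?V k \<tau>" using V.residue_map_quotient[OF \<sigma>] by blast
    obtain \<pi>' \<rho>' \<delta>' \<epsilon>' \<phi>' where "connected_sum_presentation T U ?V k \<pi>' \<rho>' \<delta>' \<epsilon>' \<phi>'"
      using quotient_presentation[OF gh(2,3) x y T U V[unfolded gh(1)]] unfolding gh(1) by blast
    then have "decomposable_as_connected_sum k ?V T U"
      using \<tau> by (rule connected_sum_presentation.decomposable)
    then show ?thesis unfolding decomposable_connected_sum_def by blast
  qed
  have large: "decomposable_connected_sum k ?V \<or>
      (enat (min m n) \<le> module_length Q (annihilator_mod_square Q f) \<and> \<not> annihilator Q f \<subseteq> max_ideal_sq Q)"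
  proof (cases "decomposable_connected_sum k ?V")
    case False
    then consider
      "\<And>x y. x \<in> max_ideal R \<Longrightarrow> y \<in> max_ideal R \<Longrightarrow> x \<otimes>\<^bsub>R\<^esub> y \<otimes>\<^bsub>R\<^esub> g = \<zero>\<^bsub>R\<^esub>"
      | "\<And>x y. x \<in> max_ideal S \<Longrightarrow> y \<in> max_ideal S \<Longrightarrow> x \<otimes>\<^bsub>S\<^esub> y \<otimes>\<^bsub>S\<^esub> h = \<zero>\<^bsub>S\<^esub>"
      using goal by blast
    then have "enat (min m n) \<le> module_length Q (annihilator_mod_square Q f) \<and>
        \<not> annihilator Q f \<subseteq> max_ideal_sq Q"
    proof cases
      case 1
      then show ?thesis using annihilator_large[OF gh(2,3)] assms(2,3) unfolding gh(1) by blast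
    next
      case 2
      have "enat (min n m) \<le> module_length Q (annihilator_mod_square Q f)"
        "\<not> annihilator Q f \<subseteq> max_ideal_sq Q"
        using sw.annihilator_large[OF gh(3,2) 2] assms(2,3) unfolding gh(1) by blast+
      then show ?thesis by (simp add: min.commute)
    qed
    then show ?thesis ..
  qed simp
  then show ?thesis
    unfolding Q.ideal_power_2[OF Q.max_ideal_ideal] by (meson leD)
qed

end
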